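(* Let $t_0>0$, $\mathcal I=[0,t_0]$, $|\mathcal I|=t_0$. For all $1<p,q<\infty$, the second order embedding $E_2:W^{2,p}_{\mathrm D}(\mathcal I)\to L^q(\mathcal I)$, $E_2u=u$, has norm $$\|E_2\|=\sup_{0\neq u\in W^{2,p}_{\mathrm D}(\mathcal I)}\frac{\|u\|_{L^q}}{\|u''\|_{L^p}}=\|\mathrm{SN}_1\|_{L^q}=\mathrm{sn}_1^{-1/q}=|\mathcal I|^{1/q-1/p+2}\,\lambda_1^{-1/q},$$ where $\lambda_1$ is the first spectral number on the unit interval $[0,1]$ and $(\mathrm{SN}_1,\mathrm{sn}_1)$ is the first spectral couple on $\mathcal I$.
   Context: $W^{2,p}_{\mathrm D}(\mathcal I)=\{u\in W^{2,p}(\mathcal I): u(0)=u(t_0)=0\}$ (real Sobolev space), with norm $\|u\|_{W^{2,p}_{\mathrm D}}=\|u''\|_{L^p(\mathcal I)}$. On an interval $[0,t_0]$ consider the eigenvalue problem $(\operatorname{sgn}(u'')|u''|^{p-1})''=\lambda\operatorname{sgn}(u)|u|^{q-1}$ on $[0,t_0]$, $u(0)=u(t_0)=u''(0)=u''(t_0)=0$, with $u\not\equiv0$ and $\lambda>0$; solutions are such that $u$, $u'$, $\operatorname{sgn}(u'')|u''|^{p-1}$ and $(\operatorname{sgn}(u'')|u''|^{p-1})'$ are $C^1$ on $[0,t_0]$. A spectral couple on $[0,t_0]$ is an eigenpair $(f,\lambda)$ normalized by $\|f''\|_{L^p}=1$ and $f'(0)>0$; $f$ is a spectral function and $\lambda$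 a spectral number. The first spectral couple is the one whose spectral function has no zeros in $(0,t_0)$ (its spectral number is the smallest). The first spectral couple on $[0,1]$ is denoted $(f_1,\lambda_1)$, and the first spectral couple on $\mathcal I=[0,t_0]$ is $\mathrm{SN}_1(t)=t_0^{2-1/p}f_1(t/t_0)$, $\mathrm{sn}_1=t_0^{q/p-1-2q}\lambda_1$. *)

theory Defs
  imports "HOL-Analysis.Analysis"
begin

text \<open>Throughout, functions on the interval \<open>[0, T]\<close> are total functions on \<open>real\<close>, and only
  their restriction to \<open>[0, T]\<close> is relevant.\<close>

definition Lp_space :: "real \<Rightarrow> real \<Rightarrow> (real \<Rightarrow> real) set" where
  "Lp_space T p = {u. set_borel_measurable lebesgue {0..T} u \<and>
                      set_integrable lebesgue {0..T} (\<lambda>x. \<bar>u x\<bar> powr p)}"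

definition Lp_norm :: "real \<Rightarrow> real \<Rightarrow> (real \<Rightarrow> real) \<Rightarrow> real" where
  "Lp_norm T p u = (LINT x:{0..T}|lebesgue. \<bar>u x\<bar> powr p) powr (1 / p)"

definition test_function :: "real \<Rightarrow> (real \<Rightarrow> real) \<Rightarrow> bool" where
  "test_function T \<phi> \<longleftrightarrow>
     (\<forall>n x. ((deriv ^^ n) \<phi>) differentiable (at x)) \<and>
     (\<exists>a b. 0 < a \<and> b < T \<and> (\<forall>x. x \<notin> {a..b} \<longrightarrow> \<phi> x = 0))"

definition locally_integrable :: "real \<Rightarrow> (real \<Rightarrow> real) \<Rightarrow> bool" where
  "locally_integrable T u \<longleftrightarrow> (\<forall>a b. 0 < a \<and> b < T \<longrightarrow> set_integrable lebesgue {a..b} u)"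

definition has_weak_deriv :: "real \<Rightarrow> (real \<Rightarrow> real) \<Rightarrow> (real \<Rightarrow> real) \<Rightarrow> bool" where
  "has_weak_deriv T u g \<longleftrightarrow> locally_integrable T u \<and> locally_integrable T g \<and>
     (\<forall>\<phi>. test_function T \<phi> \<longrightarrow>
        (LINT x:{0<..<T}|lebesgue. u x * deriv \<phi> x) = - (LINT x:{0<..<T}|lebesgue. g x * \<phi> x))"

text \<open>The weak derivative is determined only up to null sets; everything below depends only on its
  almost-everywhere class.\<close>

definition weak_deriv :: "real \<Rightarrow> (real \<Rightarrow> real) \<Rightarrow> real \<Rightarrow> real" where
  "weak_deriv T u = (SOME g. has_weak_deriv T u g)"

definition W2 :: "real \<Rightarrow> real \<Rightarrow> (real \<Rightarrow> real) set" where
  "W2 T p = {u. u \<in> Lp_space T p \<and>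
     (\<exists>g h. has_weak_deriv T u g \<and> g \<in> Lp_space T p \<and> has_weak_deriv T g h \<and> h \<in> Lp_space T p)}"

text \<open>Every class in \<open>W\<^sup>2\<^sup>,\<^sup>p\<close> has exactly one representative that is continuous on \<open>[0, T]\<close>. The
  boundary values refer to it, so the space consists of these representatives.\<close>

definition W2D :: "real \<Rightarrow> real \<Rightarrow> (real \<Rightarrow> real) set" where
  "W2D T p = {u \<in> W2 T p. continuous_on {0..T} u \<and> u 0 = 0 \<and> u T = 0}"

definition W2D_norm :: "real \<Rightarrow> real \<Rightarrow> (real \<Rightarrow> real) \<Rightarrow> real" where
  "W2D_norm T p u = Lp_norm T p (weak_deriv T (weak_deriv T u))"

definition E2 :: "(real \<Rightarrow> real) \<Rightarrow> real \<Rightarrow> real" where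
  "E2 u = u"

text \<open>Least bound of an operator \<open>A\<close> on \<open>X\<close>, with value \<open>\<infinity>\<close> if \<open>A\<close> is unbounded.\<close>

definition op_norm :: "'a set \<Rightarrow> ('a \<Rightarrow> real) \<Rightarrow> ('b \<Rightarrow> real) \<Rightarrow> ('a \<Rightarrow> 'b) \<Rightarrow> ereal" where
  "op_norm X nX nY A = (INF C\<in>{C. 0 \<le> C \<and> (\<forall>x\<in>X. nY (A x) \<le> C * nX x)}. ereal C)"

definition spow :: "real \<Rightarrow> real \<Rightarrow> real" where
  "spow r x = sgn x * \<bar>x\<bar> powr r"

text \<open>Derivatives on \<open>[0, T]\<close> are one-sided at the end points.\<close>

definition deriv_on :: "real \<Rightarrow> (real \<Rightarrow> real) \<Rightarrow> real \<Rightarrow> real" where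
  "deriv_on T f t = vector_derivative f (at t within {0..T})"

definition C1_on :: "real \<Rightarrow> (real \<Rightarrow> real) \<Rightarrow> bool" where
  "C1_on T f \<longleftrightarrow> f differentiable_on {0..T} \<and> continuous_on {0..T} (deriv_on T f)"

definition eigenpair :: "real \<Rightarrow> real \<Rightarrow> real \<Rightarrow> (real \<Rightarrow> real) \<Rightarrow> real \<Rightarrow> bool" where
  "eigenpair p q T u lam \<longleftrightarrow>
     (let u' = deriv_on T u; u'' = deriv_on T u';
          w = (\<lambda>t. spow (p - 1) (u'' t)); w' = deriv_on T w
      in C1_on T u \<and> C1_on T u' \<and> C1_on T w \<and> C1_on T w' \<and>
         (\<forall>t\<in>{0..T}. deriv_on T w' t = lam * spow (q - 1) (u t)) \<and>
         u 0 = 0 \<and> u T = 0 \<and> u'' 0 = 0 \<and> u'' T = 0 \<and>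
         (\<exists>t\<in>{0..T}. u t \<noteq> 0) \<and> 0 < lam)"

definition spectral_couple :: "real \<Rightarrow> real \<Rightarrow> real \<Rightarrow> (real \<Rightarrow> real) \<Rightarrow> real \<Rightarrow> bool" where
  "spectral_couple p q T f lam \<longleftrightarrow> eigenpair p q T f lam \<and>
     Lp_norm T p (deriv_on T (deriv_on T f)) = 1 \<and> 0 < deriv_on T f 0"

definition is_first_spectral_couple :: "real \<Rightarrow> real \<Rightarrow> real \<Rightarrow> (real \<Rightarrow> real) \<Rightarrow> real \<Rightarrow> bool" where
  "is_first_spectral_couple p q T f lam \<longleftrightarrow>
     spectral_couple p q T f lam \<and> (\<forall>t\<in>{0<..<T}. f t \<noteq> 0)"

text \<open>Extension by zero outside \<open>[0, T]\<close> makes the spectral function unique as a total function.\<close>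

definition first_spectral_couple :: "real \<Rightarrow> real \<Rightarrow> real \<Rightarrow> (real \<Rightarrow> real) \<times> real" where
  "first_spectral_couple p q T =
     (THE c. is_first_spectral_couple p q T (fst c) (snd c) \<and> (\<forall>t. t \<notin> {0..T} \<longrightarrow> fst c t = 0))"

definition SN1 :: "real \<Rightarrow> real \<Rightarrow> real \<Rightarrow> real \<Rightarrow> real" where
  "SN1 p q T = fst (first_spectral_couple p q T)"

definition sn1 :: "real \<Rightarrow> real \<Rightarrow> real \<Rightarrow> real" where
  "sn1 p q T = snd (first_spectral_couple p q T)"

definition lambda1 :: "real \<Rightarrow> real \<Rightarrow> real" where
  "lambda1 p q = sn1 p q 1"

end

theory Submission
  imports Defs "HOL-Complex_Analysis.Great_Picard"
begin

text \<open>Writing \<open>u = green h\<close> for the solution of \<open>- u'' = h\<close> with zero boundary values, the norm of the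
  embedding is the supremum \<open>Smax\<close> of \<open>\<parallel>green h\<parallel>\<^sub>q\<close> over \<open>\<parallel>h\<parallel>\<^sub>p \<le> 1\<close>. By the symmetry of \<open>green\<close> and
  Hoelder's inequality, replacing \<open>h\<close> by the dual function of \<open>green (sgn u \<bar>u\<bar>\<^sup>q\<^sup>-\<^sup>1)\<close> does not decrease
  \<open>\<parallel>green h\<parallel>\<^sub>q\<close>. So it suffices to consider continuous \<open>h\<close>, and no weak compactness is needed: the
  functions \<open>green h\<close> are equi-Lipschitz, and one such step applied to a uniform limit of a maximizing
  sequence yields a nonnegative maximizer. The equality case of Hoelder's inequality turns it into a
  zero-free eigenfunction with eigenvalue \<open>Smax\<^sup>-\<^sup>q\<close>.

  Conversely, zero-free spectral couples are unique. With \<open>v = - sgn(u'') \<bar>u''\<bar>\<^sup>p\<^sup>-\<^sup>1\<close> the problem is the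
  system \<open>u'' = - a v\<^sup>\<alpha>\<close>, \<open>v'' = - b u\<^sup>\<beta>\<close>, where \<open>u\<close> and \<open>v\<close> are scaled to have slope 1 at 0. After a
  rescaling of time two solutions share \<open>a\<close>. If the \<open>b\<close> differ, then the solutions separate
  strictly, which contradicts the boundary condition at the right end point of the shorter interval;
  if they agree, then the solutions coincide.\<close>

section \<open>Concave functions on an interval\<close>

text \<open>The exponents \<open>1 / (p - 1)\<close> and \<open>q - 1\<close> may lie below 1, so
  the right-hand sides of the shooting system need not be Lipschitz where both unknowns vanish, and
  this is where the solutions start. Concavity replaces the Lipschitz condition: it keeps both
  unknowns between \<open>\<kappa> * t\<close> and \<open>t\<close>, and on that cone a power is
  Lipschitz relative to the distance from 0. The comparison in \<open>b\<close> works because the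
  system reinforces a perturbation: a larger \<open>b\<close> lowers \<open>v\<close>, a lower
  \<open>v\<close> raises \<open>u\<close>, and a higher \<open>u\<close> lowers \<open>v\<close>
  again. The eigenvalue arises as follows. With \<open>m\<close> the dual norm of
  \<open>green\<close> of the signed power of \<open>u\<close>, a maximizer satisfies
  \<open>S powr q \<le> m \<le> S * S powr (q - 1)\<close>, so \<open>m = S powr q\<close>, and
  dividing by \<open>m\<close> normalizes Hoelder's equality case. Weak derivatives enter only at
  the end. Two integrations by parts reduce an arbitrary \<open>u\<close> in \<open>W2D\<close> to a
  pairing with \<open>green\<close> of a continuous function, after which the same iteration step
  bounds \<open>u\<close>. This is why a supremum over continuous second derivatives is
  enough.\<close>

lemma MVT_Icc:
  fixes f f' :: "real \<Rightarrow> real"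
  assumes d: "\<And>t. t \<in> {a..b} \<Longrightarrow> (f has_real_derivative f' t) (at t within {a..b})"
    and xy: "a \<le> x" "x < y" "y \<le> b"
  obtains \<xi> where "x < \<xi>" "\<xi> < y" "f y - f x = f' \<xi> * (y - x)"
proof -
  have "continuous_on {a..b} f" using d by (rule DERIV_continuous_on)
  then have "continuous_on {x..y} f" by (rule continuous_on_subset) (use xy in auto)
  moreover have "(f has_derivative (*) (f' t)) (at t)" if "x < t" "t < y" for t
  proof -
    have "at t within {a..b} = at t" using that xy by (intro at_within_Icc_at) auto
    with d[of t] that xy have "(f has_real_derivative f' t) (at t)" by simp
    then show ?thesis by (simp add: has_field_derivative_def)
  qed
  ultimately obtain \<xi> where "x < \<xi>" "\<xi> < y" "f y - f x = f' \<xi> * (y - x)"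
    by (rule mvt[OF xy(2), of f "\<lambda>t. (*) (f' t)"])
  then show thesis by (rule that)
qed

lemma increasing_from_0:
  fixes f f' :: "real \<Rightarrow> real"
  assumes d: "\<And>t. t \<in> {0..R} \<Longrightarrow> (f has_real_derivative f' t) (at t within {0..R})"
    and c: "0 < c" "c \<le> R" and pos: "\<And>t. 0 < t \<Longrightarrow> t < c \<Longrightarrow> 0 < f' t"
  shows "f 0 < f c"
proof -
  obtain \<xi> where "0 < \<xi>" "\<xi> < c" "f c - f 0 = f' \<xi> * (c - 0)"
    by (rule MVT_Icc[OF d order.refl c])
  with pos[of \<xi>] c have "0 < f c - f 0" by simp
  then show ?thesis by simp
qed

lemma pos_if_second_deriv_pos:
  fixes f f' f'' :: "real \<Rightarrow> real"
  assumes d: "\<And>t. t \<in> {0..R} \<Longrightarrow> (f has_real_derivative f' t) (at t within {0..R})"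
    "\<And>t. t \<in> {0..R} \<Longrightarrow> (f' has_real_derivative f'' t) (at t within {0..R})"
    and c: "0 < c" "c \<le> R" and pos: "\<And>t. 0 < t \<Longrightarrow> t < c \<Longrightarrow> 0 < f'' t"
    and z: "f 0 = 0" "f' 0 = 0"
  shows "0 < f c"
proof -
  have *: "0 < f' t" if "0 < t" "t < c" for t
  proof -
    have "f' 0 < f' t" by (rule increasing_from_0[OF d(2) that(1)]) (use that c pos in auto)
    with z show ?thesis by simp
  qed
  have "f 0 < f c" by (rule increasing_from_0[OF d(1) c *])
  with z show ?thesis by simp
qed

lemma concave_deriv_antimono:
  fixes f f' f'' :: "real \<Rightarrow> real"
  assumes d: "\<And>t. t \<in> {0..R} \<Longrightarrow> (f' has_real_derivative f'' t) (at t within {0..R})"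
    and neg: "\<And>t. 0 < t \<Longrightarrow> t < R \<Longrightarrow> f'' t \<le> 0" and xy: "0 \<le> x" "x \<le> y" "y \<le> R"
  shows "f' y \<le> f' x"
proof (cases "x = y")
  case False
  then have less: "x < y" using xy by simp
  obtain \<xi> where "x < \<xi>" "\<xi> < y" "f' y - f' x = f'' \<xi> * (y - x)"
    by (rule MVT_Icc[OF d xy(1) less xy(3)])
  with neg[of \<xi>] xy have "f' y - f' x \<le> 0" by (simp add: mult_nonpos_nonneg)
  then show ?thesis by simp
qed auto

text \<open>The mean slopes over \<open>[0, s]\<close> and \<open>[s, r]\<close> are values of the
  decreasing function \<open>f'\<close>. Cleared denominators keep \<open>s = 0\<close> in the
  statement. For \<open>r = T\<close> and \<open>f T = 0\<close> this is the maximum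
  principle.\<close>

lemma concave_chord:
  fixes f f' f'' :: "real \<Rightarrow> real"
  assumes d: "\<And>t. t \<in> {0..R} \<Longrightarrow> (f has_real_derivative f' t) (at t within {0..R})"
    "\<And>t. t \<in> {0..R} \<Longrightarrow> (f' has_real_derivative f'' t) (at t within {0..R})"
    and neg: "\<And>t. 0 < t \<Longrightarrow> t < R \<Longrightarrow> f'' t \<le> 0" and z: "f 0 = 0"
    and s: "0 \<le> s" "s \<le> r" "r \<le> R"
  shows "s * f r \<le> r * f s"
proof -
  consider "s = 0" | "s = r" | "0 < s" "s < r" using s by linarith
  then show ?thesis
  proof cases
    case 3
    obtain \<xi> where \<xi>: "0 < \<xi>" "\<xi> < s" "f s - f 0 = f' \<xi> * (s - 0)"
      using MVT_Icc[OF d(1), of 0 s] 3 s by auto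
    obtain \<eta> where \<eta>: "s < \<eta>" "\<eta> < r" "f r - f s = f' \<eta> * (r - s)"
      using MVT_Icc[OF d(1), of s r] 3 s by auto
    have "f' \<eta> \<le> f' \<xi>" by (rule concave_deriv_antimono[OF d(2) neg]) (use \<xi> \<eta> s in auto)
    then have "s * (f r - f s) \<le> s * (f' \<xi> * (r - s))"
      using \<eta> 3 by (intro mult_left_mono) auto
    also have "\<dots> = (r - s) * f s" using \<xi> z by (simp add: algebra_simps)
    finally show ?thesis by (simp add: algebra_simps)
  qed (use z in auto)
qed

text \<open>This drives the Picard iteration below. Both \<open>f - g\<close> and
  \<open>- f - g\<close> decrease; they take the place of \<open>f'\<close> in
  \<open>concave_deriv_antimono\<close>.\<close>

lemma abs_le_of_deriv_le:
  fixes f f' g g' :: "real \<Rightarrow> real"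
  assumes d: "\<And>t. t \<in> {0..R} \<Longrightarrow> (f has_real_derivative f' t) (at t within {0..R})"
    "\<And>t. t \<in> {0..R} \<Longrightarrow> (g has_real_derivative g' t) (at t within {0..R})"
    and le: "\<And>t. 0 < t \<Longrightarrow> t < R \<Longrightarrow> \<bar>f' t\<bar> \<le> g' t" and z: "f 0 = 0" "g 0 = 0"
    and c: "0 \<le> c" "c \<le> R"
  shows "\<bar>f c\<bar> \<le> g c"
proof -
  have "f c - g c \<le> f 0 - g 0" using c
    by (intro concave_deriv_antimono[where f' = "\<lambda>t. f t - g t" and f'' = "\<lambda>t. f' t - g' t"
          and R = R and x = 0 and y = c]) (use le d in \<open>fastforce intro!: derivative_intros\<close>)+
  moreover have "- f c - g c \<le> - f 0 - g 0" using c
    by (intro concave_deriv_antimono[where f' = "\<lambda>t. - f t - g t" and f'' = "\<lambda>t. - f' t - g' t"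
          and R = R and x = 0 and y = c]) (use le d in \<open>fastforce intro!: derivative_intros\<close>)+
  ultimately show ?thesis using z by auto
qed

section \<open>Shooting and uniqueness\<close>

text \<open>The unknown \<open>v\<close> stands for the normalized negative of the signed power of
  \<open>u''\<close>. With both slopes equal to 1, all freedom lies in \<open>a\<close> and
  \<open>b\<close>. No condition is imposed at \<open>R\<close>, so the predicate survives
  shortening the interval, and positivity inside makes plain powers suffice.\<close>

definition shoot :: "real \<Rightarrow> real \<Rightarrow> real \<Rightarrow> real \<Rightarrow> real \<Rightarrow> (real \<Rightarrow> real) \<Rightarrow> (real \<Rightarrow> real) \<Rightarrow>
    (real \<Rightarrow> real) \<Rightarrow> (real \<Rightarrow> real) \<Rightarrow> bool" where
  "shoot \<alpha> \<beta> a b R u u' v v' \<longleftrightarrow> 0 < R \<and>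
     (\<forall>t\<in>{0..R}. (u has_real_derivative u' t) (at t within {0..R}) \<and>
        (u' has_real_derivative - (a * v t powr \<alpha>)) (at t within {0..R}) \<and>
        (v has_real_derivative v' t) (at t within {0..R}) \<and>
        (v' has_real_derivative - (b * u t powr \<beta>)) (at t within {0..R})) \<and>
     u 0 = 0 \<and> v 0 = 0 \<and> u' 0 = 1 \<and> v' 0 = 1 \<and> (\<forall>t\<in>{0<..<R}. 0 < u t \<and> 0 < v t)"

text \<open>The ordering feeds itself: if \<open>v2 < v1\<close> on \<open>(0, c)\<close>, then
  \<open>u2 - u1\<close> has positive second derivative there, and if \<open>u1 < u2\<close>, so has
  \<open>v1 - v2\<close>. Near 0 the gap between \<open>b1\<close> and \<open>b2\<close> starts it,
  and a first time of failure is then impossible.\<close>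

lemma shoot_comparison:
  assumes 1: "shoot \<alpha> \<beta> a b1 R u1 u1' v1 v1'" and 2: "shoot \<alpha> \<beta> a b2 R u2 u2' v2 v2'"
    and par: "0 < \<alpha>" "0 < \<beta>" "0 < a" "0 < b1" "b1 < b2" and s: "0 < s" "s \<le> R"
  shows "u1 s < u2 s \<and> v2 s < v1 s"
proof -
  define y where "y = (\<lambda>t. u2 t - u1 t)"
  define z where "z = (\<lambda>t. v1 t - v2 t)"
  have R: "0 < R" using 1 by (simp add: shoot_def)
  have dy: "(y has_real_derivative u2' t - u1' t) (at t within {0..R})"
    "((\<lambda>t. u2' t - u1' t) has_real_derivative a * (v1 t powr \<alpha> - v2 t powr \<alpha>)) (at t within {0..R})"
    and dz: "(z has_real_derivative v1' t - v2' t) (at t within {0..R})"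
    "((\<lambda>t. v1' t - v2' t) has_real_derivative b2 * u2 t powr \<beta> - b1 * u1 t powr \<beta>) (at t within {0..R})"
    if "t \<in> {0..R}" for t
    using that 1 2 unfolding y_def z_def
    by (auto simp: shoot_def algebra_simps intro!: derivative_eq_intros)
  have pos: "0 < u1 t" "0 < v1 t" "0 < u2 t" "0 < v2 t" if "0 < t" "t < R" for t
    using that 1 2 by (auto simp: shoot_def)
  have ypos: "0 < y c" if "0 < c" "c \<le> R" "\<And>t. 0 < t \<Longrightarrow> t < c \<Longrightarrow> 0 < z t" for c
  proof (rule pos_if_second_deriv_pos[OF dy that(1,2)])
    fix t assume t: "0 < t" "t < c"
    have "v2 t powr \<alpha> < v1 t powr \<alpha>"
      using that(3)[OF t] pos[of t] t that par by (intro powr_less_mono2) (auto simp: z_def)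
    then show "0 < a * (v1 t powr \<alpha> - v2 t powr \<alpha>)" using par by simp
  qed (use 1 2 in \<open>auto simp: shoot_def y_def\<close>)
  have zpos: "0 < z c"
    if "0 < c" "c \<le> R" "\<And>t. 0 < t \<Longrightarrow> t < c \<Longrightarrow> b1 * u1 t powr \<beta> < b2 * u2 t powr \<beta>" for c
    by (rule pos_if_second_deriv_pos[OF dz that(1,2)]) (use 1 2 that(3) in \<open>auto simp: shoot_def z_def\<close>)
  \<comment> \<open>At 0 the quotient \<open>u t / t\<close> tends to the slope 1, so dividing the
    right-hand sides by \<open>t powr \<beta>\<close> isolates the coefficients
    \<open>b1 < b2\<close>.\<close>
  have lim: "((\<lambda>t. b * (u t / t) powr \<beta>) \<longlongrightarrow> b) (at_right 0)"
    if "shoot \<alpha> \<beta> a b R u u' v v'" for b u u' v v'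
  proof -
    have "(u has_real_derivative 1) (at 0 within {0..R})" "u 0 = 0"
      using that R by (auto simp: shoot_def dest!: bspec[of _ _ 0])
    then have "((\<lambda>t. u t / t) \<longlongrightarrow> 1) (at_right 0)"
      using R by (simp add: has_field_derivative_iff at_within_Icc_at_right)
    then have "((\<lambda>t. b * (u t / t) powr \<beta>) \<longlongrightarrow> b * 1 powr \<beta>) (at_right 0)"
      by (intro tendsto_intros) auto
    then show ?thesis by simp
  qed
  have "\<forall>\<^sub>F t in at_right 0. b1 * (u1 t / t) powr \<beta> < b2 * (u2 t / t) powr \<beta>"
    using order_tendstoD(2)[OF lim[OF 1], of "(b1 + b2) / 2"]
      order_tendstoD(1)[OF lim[OF 2], of "(b1 + b2) / 2"] par
    by (auto elim: eventually_elim2)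
  then obtain e where e: "0 < e" "\<And>t. 0 < t \<Longrightarrow> t < e \<Longrightarrow> b1 * (u1 t / t) powr \<beta> < b2 * (u2 t / t) powr \<beta>"
    by (auto simp: eventually_at_right_field)
  define \<epsilon> where "\<epsilon> = min e R / 2"
  have \<epsilon>: "0 < \<epsilon>" "\<epsilon> < e" "\<epsilon> < R" using e R by (auto simp: \<epsilon>_def)
  have z0: "0 < z c" if "0 < c" "c \<le> \<epsilon>" for c
  proof (rule zpos)
    fix t assume t: "0 < t" "t < c"
    then have "b1 * (u1 t / t) powr \<beta> < b2 * (u2 t / t) powr \<beta>" using e that \<epsilon> by auto
    moreover have "0 < t powr \<beta>" using t by simp
    ultimately show "b1 * u1 t powr \<beta> < b2 * u2 t powr \<beta>"
      using t pos[of t] that \<epsilon> by (simp add: powr_divide divide_less_cancel)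
  qed (use that \<epsilon> in auto)
  have y0: "0 < y c" if "0 < c" "c \<le> \<epsilon>" for c
    using that \<epsilon> z0 by (intro ypos) auto
  \<comment> \<open>The times at which the ordering fails. Starting at \<open>\<epsilon>\<close>
    excludes 0, where \<open>y\<close> and \<open>z\<close> vanish; by compactness a nonempty
    \<open>K\<close> has a first element.\<close>
  define K where "K = {t \<in> {\<epsilon>..R}. y t \<le> 0 \<or> z t \<le> 0}"
  have "continuous_on {0..R} y" "continuous_on {0..R} z"
    by (rule DERIV_continuous_on, erule dy dz)+
  then have cont: "continuous_on {\<epsilon>..R} y" "continuous_on {\<epsilon>..R} z"
    using \<epsilon> by (auto elim!: continuous_on_subset)
  have "K = {t \<in> {\<epsilon>..R}. y t \<le> 0} \<union> {t \<in> {\<epsilon>..R}. z t \<le> 0}" by (auto simp: K_def)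
  moreover have "closed {t \<in> {\<epsilon>..R}. y t \<le> 0}" "closed {t \<in> {\<epsilon>..R}. z t \<le> 0}"
    by (intro continuous_on_closed_Collect_le cont continuous_on_const closed_atLeastAtMost)+
  ultimately have "closed K" by auto
  moreover have "bounded K" by (rule bounded_subset[of "{\<epsilon>..R}"]) (auto simp: K_def)
  ultimately have K: "compact K" by (simp add: compact_eq_bounded_closed)
  have "K = {}"
  proof (rule ccontr)
    assume "K \<noteq> {}"
    then obtain \<tau> where \<tau>: "\<tau> \<in> K" "\<And>t. t \<in> K \<Longrightarrow> \<tau> \<le> t"
      using compact_attains_inf[OF K] by auto
    have \<tau>R: "0 < \<tau>" "\<tau> \<le> R" using \<tau> \<epsilon> by (auto simp: K_def)
    have p: "0 < y t \<and> 0 < z t" if "0 < t" "t < \<tau>" for t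
    proof (cases "t \<le> \<epsilon>")
      case False
      then have "t \<notin> K" using \<tau>(2)[of t] that by auto
      then show ?thesis using that False \<tau>R by (auto simp: K_def)
    qed (use y0 z0 that in auto)
    have "0 < y \<tau>" using p by (intro ypos \<tau>R) auto
    moreover have "0 < z \<tau>"
    proof (rule zpos[OF \<tau>R])
      fix t assume t: "0 < t" "t < \<tau>"
      have "u1 t powr \<beta> < u2 t powr \<beta>"
        using p[OF t] pos[of t] t \<tau>R par by (intro powr_less_mono2) (auto simp: y_def)
      then have "b1 * u1 t powr \<beta> < b1 * u2 t powr \<beta>" using par by simp
      also have "\<dots> \<le> b2 * u2 t powr \<beta>" using par by (intro mult_right_mono) auto
      finally show "b1 * u1 t powr \<beta> < b2 * u2 t powr \<beta>" .
    qed
    ultimately show False using \<tau> by (auto simp: K_def)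
  qed
  then have "0 < y s \<and> 0 < z s" using s y0 z0 by (cases "s \<le> \<epsilon>") (auto simp: K_def)
  then show ?thesis by (simp add: y_def z_def)
qed

text \<open>For \<gamma> < 1 the power is not Lipschitz at 0, but on
  \<open>[\<kappa> * s, s]\<close> its derivative is at most a constant times
  \<open>s powr (\<gamma> - 1)\<close>, and the factor \<open>s\<close> in the bound for
  \<open>\<bar>x - y\<bar>\<close> compensates the singularity. In
  \<open>1 + \<kappa> powr (\<gamma> - 1)\<close> the first summand serves \<gamma> \<ge> 1, the
  second \<gamma> < 1.\<close>

lemma powr_diff_le:
  fixes \<kappa> \<gamma> :: real
  assumes "0 < \<kappa>" "0 < s" "\<kappa> * s \<le> x" "x \<le> s" "\<kappa> * s \<le> y" "y \<le> s"
    and "0 < \<gamma>" "\<bar>x - y\<bar> \<le> s * N"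
  shows "\<bar>x powr \<gamma> - y powr \<gamma>\<bar> \<le> \<gamma> * (1 + \<kappa> powr (\<gamma> - 1)) * s powr \<gamma> * N"
  using assms
proof (induction x y rule: linorder_wlog)
  case (sym a b)
  then show ?case by (simp add: abs_minus_commute)
next
  case (le x y)
  have "0 \<le> s * N" using le by (meson abs_ge_zero order_trans)
  then have N: "0 \<le> N" using le by (simp add: zero_le_mult_iff)
  show ?case
  proof (cases "x = y")
    case True
    then show ?thesis using N le by simp
  next
    case False
    have k: "0 < \<kappa> * s" using le by simp
    obtain \<xi> where \<xi>: "x < \<xi>" "\<xi> < y" "y powr \<gamma> - x powr \<gamma> = (y - x) * (\<gamma> * \<xi> powr (\<gamma> - 1))"
    proof -
      have "\<exists>z>x. z < y \<and> y powr \<gamma> - x powr \<gamma> = (y - x) * (\<gamma> * z powr (\<gamma> - 1))"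
      proof (rule MVT2)
        fix t assume "x \<le> t"
        then have "0 < t" using le k by linarith
        then show "((\<lambda>t. t powr \<gamma>) has_real_derivative \<gamma> * t powr (\<gamma> - 1)) (at t)"
          by (rule has_real_derivative_powr)
      qed (use False le in auto)
      then show thesis using that by blast
    qed
    have "\<xi> powr (\<gamma> - 1) \<le> (1 + \<kappa> powr (\<gamma> - 1)) * s powr (\<gamma> - 1)"
    proof (cases "\<gamma> \<ge> 1")
      case True
      then have "\<xi> powr (\<gamma> - 1) \<le> s powr (\<gamma> - 1)" using \<xi> le k by (intro powr_mono2) auto
      then show ?thesis by (simp add: algebra_simps add_increasing2)
    next
      case False
      then have "\<xi> powr (\<gamma> - 1) \<le> (\<kappa> * s) powr (\<gamma> - 1)" using \<xi> le k by (intro powr_mono2') auto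
      also have "\<dots> = \<kappa> powr (\<gamma> - 1) * s powr (\<gamma> - 1)" using le by (simp add: powr_mult)
      finally show ?thesis by (simp add: algebra_simps add_increasing)
    qed
    then have "(y - x) * (\<gamma> * \<xi> powr (\<gamma> - 1)) \<le> (s * N) * (\<gamma> * ((1 + \<kappa> powr (\<gamma> - 1)) * s powr (\<gamma> - 1)))"
      using le N by (intro mult_mono) auto
    also have "\<dots> = \<gamma> * (1 + \<kappa> powr (\<gamma> - 1)) * s powr \<gamma> * N"
      using le by (simp add: powr_diff)
    finally have "y powr \<gamma> - x powr \<gamma> \<le> \<gamma> * (1 + \<kappa> powr (\<gamma> - 1)) * s powr \<gamma> * N"
      using \<xi>(3) by linarith
    moreover have "x powr \<gamma> \<le> y powr \<gamma>" using le k by (intro powr_mono2) auto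
    ultimately show ?thesis by linarith
  qed
qed

lemma shoot_subset:
  assumes "shoot \<alpha> \<beta> a b R u u' v v'" "0 < r" "r \<le> R"
  shows "shoot \<alpha> \<beta> a b r u u' v v'"
proof -
  have sub: "{0..r} \<subseteq> {0..R}" using assms by auto
  show ?thesis unfolding shoot_def
    by (intro conjI ballI; (rule DERIV_subset[OF _ sub])?; use assms in \<open>auto simp: shoot_def\<close>)
qed

text \<open>Picard iteration on the slope differences \<open>y'\<close> and \<open>z'\<close>. If
  both are at most \<open>B n t\<close>, then \<open>y\<close> and \<open>z\<close> are at most
  \<open>t * B n t\<close>, so \<open>powr_diff_le\<close> bounds the second derivatives by
  \<open>L * B n t\<close>, whose primitive is \<open>B (Suc n)\<close>. Staying at
  \<open>r < R\<close> keeps the solutions positive at the right end.\<close>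

lemma shoot_unique_aux:
  assumes 1: "shoot \<alpha> \<beta> a b R u1 u1' v1 v1'" and 2: "shoot \<alpha> \<beta> a b R u2 u2' v2 v2'"
    and par: "0 < \<alpha>" "0 < \<beta>" "0 < a" "0 < b" and s: "0 < r" "r < R"
  shows "u1 r = u2 r \<and> v1 r = v2 r"
proof -
  have bnd: "\<exists>\<kappa>>0. \<forall>t\<in>{0..r}. \<kappa> * t \<le> u t \<and> u t \<le> t \<and> \<kappa> * t \<le> v t \<and> v t \<le> t"
    if S: "shoot \<alpha> \<beta> a b R u u' v v'" for u u' v v'
  proof -
    have *: "\<exists>\<kappa>>0. \<forall>t\<in>{0..r}. \<kappa> * t \<le> f t \<and> f t \<le> t"
      if d: "\<And>t. t \<in> {0..R} \<Longrightarrow> (f has_real_derivative f' t) (at t within {0..R})"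
        "\<And>t. t \<in> {0..R} \<Longrightarrow> (f' has_real_derivative f'' t) (at t within {0..R})"
        and neg: "\<And>t. 0 < t \<Longrightarrow> t < R \<Longrightarrow> f'' t \<le> 0" and z: "f 0 = 0" "f' 0 = 1" "0 < f r"
      for f f' f''
    \<comment> \<open>This is the slope of the chord over \<open>[0, r]\<close>. Concavity puts
      \<open>f\<close> above that chord and below its tangent at 0, which is the diagonal.\<close>
    proof (intro exI[of _ "f r / r"] conjI ballI)
      fix t assume t: "t \<in> {0..r}"
      show "f r / r * t \<le> f t"
        using concave_chord[OF d neg z(1), of t r] t s by (simp add: field_simps)
      show "f t \<le> t"
      proof (cases "t = 0")
        case False
        then obtain \<xi> where \<xi>: "0 < \<xi>" "\<xi> < t" "f t - f 0 = f' \<xi> * (t - 0)"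
          using MVT_Icc[OF d(1), of 0 t] t s by auto
        have "f' \<xi> \<le> f' 0" by (rule concave_deriv_antimono[OF d(2) neg]) (use \<xi> t s in auto)
        then show ?thesis using \<xi> z by simp
      qed (use z in auto)
    qed (use z s in auto)
    obtain k1 where k1: "k1 > 0" "\<forall>t\<in>{0..r}. k1 * t \<le> u t \<and> u t \<le> t"
      using *[of u u' "\<lambda>t. - (a * v t powr \<alpha>)"] S par s by (auto simp: shoot_def)
    obtain k2 where k2: "k2 > 0" "\<forall>t\<in>{0..r}. k2 * t \<le> v t \<and> v t \<le> t"
      using *[of v v' "\<lambda>t. - (b * u t powr \<beta>)"] S par s by (auto simp: shoot_def)
    have "min k1 k2 * t \<le> k1 * t" "min k1 k2 * t \<le> k2 * t" if "t \<in> {0..r}" for t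
      using that by (auto intro!: mult_right_mono)
    then show ?thesis using k1 k2
      by (intro exI[of _ "min k1 k2"]) fastforce
  qed
  obtain k1 where k1: "k1 > 0" "\<forall>t\<in>{0..r}. k1 * t \<le> u1 t \<and> u1 t \<le> t \<and> k1 * t \<le> v1 t \<and> v1 t \<le> t"
    using bnd[OF 1] by auto
  obtain k2 where k2: "k2 > 0" "\<forall>t\<in>{0..r}. k2 * t \<le> u2 t \<and> u2 t \<le> t \<and> k2 * t \<le> v2 t \<and> v2 t \<le> t"
    using bnd[OF 2] by auto
  define \<kappa> where "\<kappa> = min k1 k2"
  have \<kappa>: "0 < \<kappa>" "\<kappa> \<le> k1" "\<kappa> \<le> k2" using k1 k2 by (auto simp: \<kappa>_def)
  have kb: "\<kappa> * t \<le> u1 t" "u1 t \<le> t" "\<kappa> * t \<le> v1 t" "v1 t \<le> t"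
    "\<kappa> * t \<le> u2 t" "u2 t \<le> t" "\<kappa> * t \<le> v2 t" "v2 t \<le> t" if "0 \<le> t" "t \<le> r" for t
  proof -
    have "\<kappa> * t \<le> k1 * t" "\<kappa> * t \<le> k2 * t" using \<kappa> that by (auto intro!: mult_right_mono)
    moreover have "k1 * t \<le> u1 t" "u1 t \<le> t" "k1 * t \<le> v1 t" "v1 t \<le> t"
      "k2 * t \<le> u2 t" "u2 t \<le> t" "k2 * t \<le> v2 t" "v2 t \<le> t"
      using k1(2) k2(2) that by auto
    ultimately show "\<kappa> * t \<le> u1 t" "u1 t \<le> t" "\<kappa> * t \<le> v1 t" "v1 t \<le> t"
      "\<kappa> * t \<le> u2 t" "u2 t \<le> t" "\<kappa> * t \<le> v2 t" "v2 t \<le> t" by linarith+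
  qed
  define y where "y = (\<lambda>t. u1 t - u2 t)"
  define z where "z = (\<lambda>t. v1 t - v2 t)"
  define y' where "y' = (\<lambda>t. u1' t - u2' t)"
  define z' where "z' = (\<lambda>t. v1' t - v2' t)"
  have d: "(y has_real_derivative y' t) (at t within {0..r})"
    "(z has_real_derivative z' t) (at t within {0..r})"
    "(y' has_real_derivative - (a * (v1 t powr \<alpha> - v2 t powr \<alpha>))) (at t within {0..r})"
    "(z' has_real_derivative - (b * (u1 t powr \<beta> - u2 t powr \<beta>))) (at t within {0..r})"
    if "t \<in> {0..r}" for t
    using that shoot_subset[OF 1, of r] shoot_subset[OF 2, of r] s unfolding y_def z_def y'_def z'_def
    by (auto simp: shoot_def algebra_simps intro!: derivative_eq_intros)
  have z0: "y 0 = 0" "z 0 = 0" "y' 0 = 0" "z' 0 = 0"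
    using 1 2 by (auto simp: shoot_def y_def z_def y'_def z'_def)
  define L where "L = a * (\<alpha> * (1 + \<kappa> powr (\<alpha> - 1)) * r powr \<alpha>) + b * (\<beta> * (1 + \<kappa> powr (\<beta> - 1)) * r powr \<beta>)"
  have L: "0 \<le> L" "a * (\<alpha> * (1 + \<kappa> powr (\<alpha> - 1)) * r powr \<alpha>) \<le> L"
     "b * (\<beta> * (1 + \<kappa> powr (\<beta> - 1)) * r powr \<beta>) \<le> L"
    using par by (auto simp: L_def intro!: add_nonneg_nonneg mult_nonneg_nonneg)
  have "continuous_on {0..r} y'" "continuous_on {0..r} z'"
    by (rule DERIV_continuous_on, erule d)+
  then have "bounded (y' ` {0..r})" "bounded (z' ` {0..r})"
    by (auto intro: compact_imp_bounded compact_continuous_image)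
  then obtain M1 M2 where "\<forall>t\<in>{0..r}. \<bar>y' t\<bar> \<le> M1" "\<forall>t\<in>{0..r}. \<bar>z' t\<bar> \<le> M2"
    by (auto simp: bounded_real)
  then obtain M where M: "\<And>t. t \<in> {0..r} \<Longrightarrow> \<bar>y' t\<bar> \<le> M \<and> \<bar>z' t\<bar> \<le> M"
    by (metis max.cobounded1 max.cobounded2 order_trans)
  have M0: "0 \<le> M" using M[of 0] s by auto
  \<comment> \<open>The constant \<open>M\<close>, integrated \<open>n\<close> times from 0 with a
    factor \<open>L\<close> each time; at fixed \<open>t\<close> these are multiples of the terms of
    an exponential series.\<close>
  define B where "B = (\<lambda>n t. M * (L * t) ^ n / fact n)"
  have B0: "0 \<le> B n t" if "0 \<le> t" for n t using that M0 L by (auto simp: B_def)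
  have Bmono: "B n s \<le> B n t" if "0 \<le> s" "s \<le> t" for n s t
    using that M0 L unfolding B_def
    by (intro divide_right_mono mult_left_mono power_mono) auto
  have dB: "(B (Suc n) has_real_derivative L * B n t) (at t within {0..r})" for n t
    unfolding B_def by (rule derivative_eq_intros refl | simp add: field_simps del: of_nat_Suc)+
  have small: "\<bar>f t\<bar> \<le> t * B n t"
    if "0 \<le> t" "t \<le> r" "\<And>t. t \<in> {0..r} \<Longrightarrow> (f has_real_derivative f' t) (at t within {0..r})" "f 0 = 0"
      "\<And>t. t \<in> {0..r} \<Longrightarrow> \<bar>f' t\<bar> \<le> B n t" for f f' t n
  proof (cases "t = 0")
    case False
    then have "0 < t" using that by simp
    note mvt = MVT_Icc[OF that(3) order.refl this that(2)]
    obtain \<xi> where \<xi>: "0 < \<xi>" "\<xi> < t" "f t - f 0 = f' \<xi> * (t - 0)"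
      by (rule mvt)
    have "\<bar>f' \<xi>\<bar> \<le> B n \<xi>" by (rule that(5)) (use \<xi> that in auto)
    also have "\<dots> \<le> B n t" by (rule Bmono) (use \<xi> in auto)
    finally have "\<bar>f' \<xi>\<bar> \<le> B n t" .
    then show ?thesis using \<xi> that by (simp add: abs_mult mult.commute mult_right_mono)
  qed (use that in auto)
  have step: "\<bar>c * (x powr \<gamma> - w powr \<gamma>)\<bar> \<le> L * B n t"
    if "0 < t" "t < r" "\<kappa> * t \<le> x" "x \<le> t" "\<kappa> * t \<le> w" "w \<le> t" "\<bar>x - w\<bar> \<le> t * B n t"
      "0 < \<gamma>" "0 < c" "c * (\<gamma> * (1 + \<kappa> powr (\<gamma> - 1)) * r powr \<gamma>) \<le> L" for c x w \<gamma> t n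
  proof -
    have "\<bar>x powr \<gamma> - w powr \<gamma>\<bar> \<le> \<gamma> * (1 + \<kappa> powr (\<gamma> - 1)) * t powr \<gamma> * B n t"
      using that \<kappa> by (intro powr_diff_le) auto
    also have "\<dots> \<le> \<gamma> * (1 + \<kappa> powr (\<gamma> - 1)) * r powr \<gamma> * B n t"
      using that B0[of t n] by (intro mult_mono powr_mono2) auto
    finally have "c * \<bar>x powr \<gamma> - w powr \<gamma>\<bar> \<le> c * (\<gamma> * (1 + \<kappa> powr (\<gamma> - 1)) * r powr \<gamma> * B n t)"
      using that by (intro mult_left_mono) auto
    also have "\<dots> = (c * (\<gamma> * (1 + \<kappa> powr (\<gamma> - 1)) * r powr \<gamma>)) * B n t"
      by (simp only: mult.assoc)
    also have "\<dots> \<le> L * B n t" using that B0[of t n] by (intro mult_right_mono) auto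
    finally show ?thesis using that by (simp add: abs_mult)
  qed
  have main: "\<forall>t\<in>{0..r}. \<bar>y' t\<bar> \<le> B n t \<and> \<bar>z' t\<bar> \<le> B n t" for n
  proof (induction n)
    case 0
    show ?case using M by (auto simp: B_def)
  next
    case (Suc n)
    have yz: "\<bar>y t\<bar> \<le> t * B n t" "\<bar>z t\<bar> \<le> t * B n t" if "0 \<le> t" "t \<le> r" for t
      using small[OF that d(1) z0(1)] small[OF that d(2) z0(2)] Suc.IH by auto
    show ?case
    proof (intro ballI conjI)
      fix c assume c: "c \<in> {0..r}"
      show "\<bar>y' c\<bar> \<le> B (Suc n) c"
      proof (rule abs_le_of_deriv_le[OF d(3) dB])
        fix t assume t: "0 < t" "t < r"
        show "\<bar>- (a * (v1 t powr \<alpha> - v2 t powr \<alpha>))\<bar> \<le> L * B n t"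
          unfolding abs_minus_cancel
          by (rule step) (use t kb[of t] yz(2)[of t] L par in \<open>auto simp: z_def\<close>)
      qed (use z0 c in \<open>auto simp: B_def\<close>)
      show "\<bar>z' c\<bar> \<le> B (Suc n) c"
      proof (rule abs_le_of_deriv_le[OF d(4) dB])
        fix t assume t: "0 < t" "t < r"
        show "\<bar>- (b * (u1 t powr \<beta> - u2 t powr \<beta>))\<bar> \<le> L * B n t"
          unfolding abs_minus_cancel
          by (rule step) (use t kb[of t] yz(1)[of t] L par in \<open>auto simp: y_def\<close>)
      qed (use z0 c in \<open>auto simp: B_def\<close>)
    qed
  qed
  have le: "\<bar>y r\<bar> \<le> r * B n r" "\<bar>z r\<bar> \<le> r * B n r" for n
    using small[of r y y' n, OF _ _ d(1) z0(1)] small[of r z z' n, OF _ _ d(2) z0(2)] main[of n] s by auto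
  have "(\<lambda>n. r * (M * ((L * r) ^ n / fact n))) \<longlonglongrightarrow> r * (M * 0)"
    by (intro tendsto_intros) (use summable_LIMSEQ_zero[OF summable_exp[of "L * r"]] in
        \<open>simp add: divide_inverse mult.commute\<close>)
  then have lim: "(\<lambda>n. r * B n r) \<longlonglongrightarrow> 0" by (simp add: B_def)
  have "\<bar>y r\<bar> \<le> 0" "\<bar>z r\<bar> \<le> 0"
    by (rule LIMSEQ_le_const[OF lim], use le in blast)+
  then show ?thesis by (simp add: y_def z_def)
qed

lemma shoot_unique:
  assumes 1: "shoot \<alpha> \<beta> a b R u1 u1' v1 v1'" and 2: "shoot \<alpha> \<beta> a b R u2 u2' v2 v2'"
    and par: "0 < \<alpha>" "0 < \<beta>" "0 < a" "0 < b" and t: "t \<in> {0..R}"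
  shows "u1 t = u2 t \<and> v1 t = v2 t"
proof -
  have R: "0 < R" using 1 by (simp add: shoot_def)
  have "continuous_on {0..R} u1" "continuous_on {0..R} u2"
    "continuous_on {0..R} v1" "continuous_on {0..R} v2"
    by (rule DERIV_continuous_on, use 1 2 in \<open>auto simp: shoot_def\<close>)+
  then have c: "continuous_on (closure {0<..<R}) (\<lambda>t. \<bar>u1 t - u2 t\<bar> + \<bar>v1 t - v2 t\<bar>)"
    using R by (auto intro!: continuous_intros)
  have "\<bar>u1 t - u2 t\<bar> + \<bar>v1 t - v2 t\<bar> = 0"
  proof (rule continuous_constant_on_closure[OF c])
    fix r assume "r \<in> {0<..<R}"
    then show "\<bar>u1 r - u2 r\<bar> + \<bar>v1 r - v2 r\<bar> = 0"
      using shoot_unique_aux[OF 1 2 par, of r] by auto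
  qed (use R t in auto)
  then show ?thesis by auto
qed

text \<open>Dividing by \<open>c\<close> keeps the slope 1 at 0. Two derivatives of
  \<open>u (c * t) / c\<close> leave one factor \<open>c\<close>, and writing \<open>v\<close> as
  \<open>c * (v / c)\<close> brings out \<open>c powr \<alpha>\<close>; hence the exponents
  \<open>1 + \<alpha>\<close> and \<open>1 + \<beta>\<close>.\<close>

lemma shoot_rescale:
  assumes S: "shoot \<alpha> \<beta> a b R u u' v v'" and c: "0 < c"
  shows "shoot \<alpha> \<beta> (a * c powr (1 + \<alpha>)) (b * c powr (1 + \<beta>)) (R / c)
    (\<lambda>t. u (c * t) / c) (\<lambda>t. u' (c * t)) (\<lambda>t. v (c * t) / c) (\<lambda>t. v' (c * t))"
proof -
  have img: "(*) c ` {0..R / c} \<subseteq> {0..R}" using c by (auto simp: field_simps)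
  have ch: "((\<lambda>t. f (c * t)) has_real_derivative f' * c) (at t within {0..R / c})"
    if "(f has_real_derivative f') (at (c * t) within {0..R})" for f f' t
    using DERIV_image_chain[of f f' "(*) c" t "{0..R/c}" c] DERIV_subset[OF that img]
    by (simp add: o_def DERIV_cmult_Id)
  have pw: "c * x powr \<gamma> = c powr (1 + \<gamma>) * (x / c) powr \<gamma>" if "0 \<le> x" for x \<gamma>
    using that c by (simp add: powr_divide powr_add)
  have nn: "0 \<le> u s" "0 \<le> v s" if "s \<in> {0..R}" for s
  proof -
    have "continuous_on {0..R} u" "continuous_on {0..R} v"
      by (rule DERIV_continuous_on, use S in \<open>auto simp: shoot_def\<close>)+
    moreover have "closure {0<..<R} = {0..R}" using S by (simp add: shoot_def)
    ultimately show "0 \<le> u s" "0 \<le> v s"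
      using that S continuous_ge_on_closure[of "{0<..<R}" u s 0] continuous_ge_on_closure[of "{0<..<R}" v s 0]
      by (auto simp: shoot_def less_imp_le)
  qed
  have st: "c * t \<in> {0..R}" if "t \<in> {0..R/c}" for t using that img by blast
  show ?thesis
    unfolding shoot_def
  proof (intro conjI ballI)
    fix t assume "t \<in> {0..R/c}"
    note t = st[OF this]
    have e1: "- (a * v (c * t) powr \<alpha>) * c = - (a * c powr (1 + \<alpha>) * (v (c * t) / c) powr \<alpha>)"
      using pw[OF nn(2)[OF t], of \<alpha>] by (simp add: mult.assoc mult.commute)
    have e2: "- (b * u (c * t) powr \<beta>) * c = - (b * c powr (1 + \<beta>) * (u (c * t) / c) powr \<beta>)"
      using pw[OF nn(1)[OF t], of \<beta>] by (simp add: mult.assoc mult.commute)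
    show "((\<lambda>t. u (c * t) / c) has_real_derivative u' (c * t)) (at t within {0..R / c})"
      using DERIV_cdivide[OF ch[of u "u' (c * t)" t], of c] S t c by (simp add: shoot_def)
    show "((\<lambda>t. v (c * t) / c) has_real_derivative v' (c * t)) (at t within {0..R / c})"
      using DERIV_cdivide[OF ch[of v "v' (c * t)" t], of c] S t c by (simp add: shoot_def)
    show "((\<lambda>t. u' (c * t)) has_real_derivative - (a * c powr (1 + \<alpha>) * (v (c * t) / c) powr \<alpha>))
        (at t within {0..R / c})"
      unfolding e1[symmetric] by (rule ch) (use S t in \<open>auto simp: shoot_def\<close>)
    show "((\<lambda>t. v' (c * t)) has_real_derivative - (b * c powr (1 + \<beta>) * (u (c * t) / c) powr \<beta>))
        (at t within {0..R / c})"
      unfolding e2[symmetric] by (rule ch) (use S t in \<open>auto simp: shoot_def\<close>)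
  next
    fix t assume "t \<in> {0<..<R/c}"
    then have "c * t \<in> {0<..<R}" using c by (auto simp: field_simps)
    then show "0 < u (c * t) / c" "0 < v (c * t) / c" using S c by (auto simp: shoot_def)
  qed (use S c in \<open>auto simp: shoot_def\<close>)
qed

text \<open>Rescaling time by \<open>c \<le> 1\<close> equalizes the first coefficients and
  stretches the second solution to \<open>[0, R / c]\<close>, so it is nonnegative at
  \<open>R\<close>, where the first one vanishes. Either strict order of \<open>b1\<close> and
  \<open>b\<close> would make it negative there: its \<open>v\<close> if \<open>b1 < b\<close>, its
  \<open>u\<close> if \<open>b < b1\<close>.\<close>

lemma shoot_dirichlet_unique_aux:
  assumes 1: "shoot \<alpha> \<beta> a1 b1 R u1 u1' v1 v1'" and 2: "shoot \<alpha> \<beta> a2 b2 R u2 u2' v2 v2'"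
    and par: "0 < \<alpha>" "0 < \<beta>" "0 < a1" "0 < b1" "0 < a2" "0 < b2" "a1 \<le> a2"
    and z: "u1 R = 0" "v1 R = 0" "u2 R = 0" "v2 R = 0"
  shows "a1 = a2 \<and> b1 = b2 \<and> (\<forall>t\<in>{0..R}. u1 t = u2 t \<and> v1 t = v2 t)"
proof -
  define c where "c = (a1 / a2) powr (1 / (1 + \<alpha>))"
  have c: "0 < c" "c \<le> 1" using par by (auto simp: c_def intro!: powr_le1)
  have "c powr (1 + \<alpha>) = a1 / a2" using par by (simp add: c_def powr_powr)
  then have ca: "a2 * c powr (1 + \<alpha>) = a1" using par by simp
  define b where "b = b2 * c powr (1 + \<beta>)"
  have b: "0 < b" using par c by (simp add: b_def)
  let ?u = "\<lambda>t. u2 (c * t) / c" and ?v = "\<lambda>t. v2 (c * t) / c"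
  have R: "0 < R" "R \<le> R / c" using 1 c by (auto simp: shoot_def field_simps mult_le_cancel_right1)
  have 3: "shoot \<alpha> \<beta> a1 b R ?u (\<lambda>t. u2' (c * t)) ?v (\<lambda>t. v2' (c * t))"
    using shoot_subset[OF shoot_rescale[OF 2 c(1)] R] by (simp add: ca b_def)
  have nn: "0 \<le> ?u R" "0 \<le> ?v R" and pos: "c < 1 \<Longrightarrow> 0 < ?u R"
  proof -
    show *: "c < 1 \<Longrightarrow> 0 < ?u R"
      using 2 c R by (auto simp: shoot_def)
    have "c < 1 \<Longrightarrow> 0 < ?v R"
      using 2 c R by (auto simp: shoot_def)
    with * show "0 \<le> ?u R" "0 \<le> ?v R" using z c by (cases "c = 1"; force)+
  qed
  have "b1 = b"
  proof (rule ccontr)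
    assume "b1 \<noteq> b"
    then consider "b1 < b" | "b < b1" by linarith
    then show False
    proof cases
      case 1
      then show False using shoot_comparison[OF assms(1) 3 par(1-3) _ _ R(1) order.refl] par nn z by simp
    next
      case 2
      then show False using shoot_comparison[OF 3 1 par(1-3) b _ R(1) order.refl] nn z by simp
    qed
  qed
  with 3 have 3: "shoot \<alpha> \<beta> a1 b1 R ?u (\<lambda>t. u2' (c * t)) ?v (\<lambda>t. v2' (c * t))" by simp
  note eq = shoot_unique[OF 1 3 par(1-4)]
  \<comment> \<open>For \<open>c < 1\<close> the rescaled \<open>u\<close> would still be positive
    at \<open>R\<close>, although it agrees with \<open>u1\<close>, which is 0 there.\<close>
  have "c = 1"
    using pos eq[of R] z c R by force
  then show ?thesis using eq ca \<open>b1 = b\<close> par by (simp add: b_def)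
qed

lemma shoot_dirichlet_unique:
  assumes "shoot \<alpha> \<beta> a1 b1 R u1 u1' v1 v1'" and "shoot \<alpha> \<beta> a2 b2 R u2 u2' v2 v2'"
    and "0 < \<alpha>" "0 < \<beta>" "0 < a1" "0 < b1" "0 < a2" "0 < b2"
    and "u1 R = 0" "v1 R = 0" "u2 R = 0" "v2 R = 0"
  shows "a1 = a2 \<and> b1 = b2 \<and> (\<forall>t\<in>{0..R}. u1 t = u2 t \<and> v1 t = v2 t)"
proof (cases "a1 \<le> a2")
  case True
  then show ?thesis using shoot_dirichlet_unique_aux[OF assms(1-8) _ assms(9-12)] by simp
next
  case False
  then show ?thesis
    using shoot_dirichlet_unique_aux[OF assms(2,1,3,4,7,8,5,6) _ assms(11,12,9,10)] by auto
qed

section \<open>Hoelder's inequality and the Green operator\<close>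

lemma integral_continuous_eq_LINT:
  fixes f :: "real \<Rightarrow> real"
  assumes "continuous_on {a..b} f"
  shows "set_integrable lebesgue {a..b} f" "(LINT x:{a..b}|lebesgue. f x) = integral {a..b} f"
  using absolutely_integrable_continuous_real[OF assms] set_lebesgue_integral_eq_integral(2) by blast+

lemma continuous_on_abs_powr:
  fixes f :: "real \<Rightarrow> real"
  assumes "continuous_on S f" "0 < r"
  shows "continuous_on S (\<lambda>x. \<bar>f x\<bar> powr r)"
  by (rule continuous_on_powr') (use assms in \<open>auto intro!: continuous_intros\<close>)

lemma Lp_space_continuous:
  assumes "continuous_on {0..T} f" "0 < r"
  shows "f \<in> Lp_space T r"
  using integral_continuous_eq_LINT(1)[OF assms(1)] integral_continuous_eq_LINT(1)[OF continuous_on_abs_powr[OF assms]]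
  unfolding Lp_space_def set_borel_measurable_def
  by (auto simp: set_integrable_def)

lemma Lp_norm_continuous:
  assumes "continuous_on {0..T} f" "0 < r"
  shows "Lp_norm T r f = integral {0..T} (\<lambda>x. \<bar>f x\<bar> powr r) powr (1 / r)"
  unfolding Lp_norm_def by (simp add: integral_continuous_eq_LINT(2)[OF continuous_on_abs_powr[OF assms]])

lemma Lp_norm_nonneg: "0 \<le> Lp_norm T r f"
  by (simp add: Lp_norm_def)

lemma Lp_norm_powr:
  assumes "0 < r"
  shows "Lp_norm T r f powr r = (LINT x:{0..T}|lebesgue. \<bar>f x\<bar> powr r)"
proof -
  have "0 \<le> (LINT x:{0..T}|lebesgue. \<bar>f x\<bar> powr r)"
    unfolding set_lebesgue_integral_def by (rule Bochner_Integration.integral_nonneg) auto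
  then show ?thesis using assms by (simp add: Lp_norm_def powr_powr)
qed

lemma Lp_norm_powr_continuous:
  assumes "continuous_on {0..T} f" "0 < r"
  shows "Lp_norm T r f powr r = integral {0..T} (\<lambda>x. \<bar>f x\<bar> powr r)"
  using Lp_norm_powr[OF assms(2)] integral_continuous_eq_LINT(2)[OF continuous_on_abs_powr[OF assms]] by simp

lemma Lp_norm_cong:
  assumes "\<And>x. x \<in> {0..T} \<Longrightarrow> \<bar>f x\<bar> = \<bar>g x\<bar>"
  shows "Lp_norm T r f = Lp_norm T r g"
proof -
  have "(LINT x:{0..T}|lebesgue. \<bar>f x\<bar> powr r) = (LINT x:{0..T}|lebesgue. \<bar>g x\<bar> powr r)"
    by (rule set_lebesgue_integral_cong) (use assms in auto)
  then show ?thesis by (simp add: Lp_norm_def)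
qed

lemma Lp_norm_mono_continuous:
  assumes "continuous_on {0..T} f" "continuous_on {0..T} g" "0 < r"
    and "\<And>x. x \<in> {0..T} \<Longrightarrow> \<bar>f x\<bar> \<le> \<bar>g x\<bar>"
  shows "Lp_norm T r f \<le> Lp_norm T r g"
  unfolding Lp_norm_continuous[OF assms(1,3)] Lp_norm_continuous[OF assms(2,3)]
  using assms by (intro powr_mono2 integral_le integral_nonneg integrable_continuous_interval continuous_on_abs_powr) auto

lemma Lp_norm_scale:
  "Lp_norm T r (\<lambda>x. c * f x) = \<bar>c\<bar> * Lp_norm T r f" if "0 < r"
  using that by (simp add: Lp_norm_def abs_mult powr_mult powr_powr)

lemma Lp_norm_pos:
  assumes "0 < T" "continuous_on {0..T} f" "0 < r" "x \<in> {0..T}" "f x \<noteq> 0"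
  shows "0 < Lp_norm T r f"
proof -
  have "integral {0..T} (\<lambda>x. \<bar>f x\<bar> powr r) \<noteq> 0"
    using integral_eq_0_iff[OF continuous_on_abs_powr[OF assms(2,3)] assms(1)] assms(4,5) by auto
  then show ?thesis by (simp add: Lp_norm_continuous[OF assms(2,3)])
qed

section \<open>Hoelder's inequality and its equality case\<close>

lemma conjugate_exponent:
  fixes p :: real
  assumes "1 < p"
  shows "1 < p / (p - 1)" "1 / p + 1 / (p / (p - 1)) = 1" "1 / (p - 1) * p = p / (p - 1)"
    "1 / (p - 1) + 1 = p / (p - 1)" "0 < 1 / (p - 1)" "(p - 1) * (p / (p - 1)) = p"
    "p / (p - 1) - 1 / (p - 1) = 1"
proof -
  have "0 < (p - 1) * (p - 1)" using assms by simp
  then have "1 + p * p \<noteq> p * 2" by (simp add: algebra_simps)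
  then show "1 < p / (p - 1)" "1 / p + 1 / (p / (p - 1)) = 1" "1 / (p - 1) * p = p / (p - 1)"
    "1 / (p - 1) + 1 = p / (p - 1)" "0 < 1 / (p - 1)" "(p - 1) * (p / (p - 1)) = p"
    "p / (p - 1) - 1 / (p - 1) = 1"
    using assms by (auto simp: field_simps)
qed

text \<open>Young's inequality is integrated after dividing by \<open>a\<close> and
  \<open>b\<close>; \<open>a = b = 1\<close> gives integrability. Choosing the norms plus some
  \<open>e > 0\<close> avoids a separate case for a vanishing norm, and \<open>e\<close> tends to 0
  at the end.\<close>

lemma Holder_Lp:
  assumes p: "1 < p" and f: "f \<in> Lp_space T p" and g: "g \<in> Lp_space T (p / (p - 1))"
  shows "set_integrable lebesgue {0..T} (\<lambda>x. f x * g x)"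
    and "\<bar>LINT x:{0..T}|lebesgue. f x * g x\<bar> \<le> Lp_norm T p f * Lp_norm T (p / (p - 1)) g"
proof -
  define q where "q = p / (p - 1)"
  have q: "1 < q" "1 / p + 1 / q = 1" using conjugate_exponent[OF p] by (auto simp: q_def)
  have [measurable]: "(\<lambda>x. indicator {0..T} x *\<^sub>R f x) \<in> borel_measurable lebesgue"
    "(\<lambda>x. indicator {0..T} x *\<^sub>R g x) \<in> borel_measurable lebesgue"
    using f g by (auto simp: Lp_space_def set_borel_measurable_def)
  have int: "set_integrable lebesgue {0..T} (\<lambda>x. \<bar>f x\<bar> powr p)"
    "set_integrable lebesgue {0..T} (\<lambda>x. \<bar>g x\<bar> powr q)"
    using f g by (auto simp: Lp_space_def q_def)
  have young: "\<bar>f x * g x\<bar> \<le> a * b * (\<bar>f x\<bar> powr p / a powr p / p + \<bar>g x\<bar> powr q / b powr q / q)"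
    if "0 < a" "0 < b" for a b x
  proof -
    have "(\<bar>f x\<bar> / a) * (\<bar>g x\<bar> / b) \<le> (\<bar>f x\<bar> / a) powr p / p + (\<bar>g x\<bar> / b) powr q / q"
      using that p q by (intro Youngs_inequality) auto
    then show ?thesis using that by (simp add: powr_divide abs_mult field_simps)
  qed
  have bi: "set_integrable lebesgue {0..T} (\<lambda>x. a * b * (\<bar>f x\<bar> powr p / a powr p / p + \<bar>g x\<bar> powr q / b powr q / q))" for a b
    using int by (intro set_integrable_mult_right set_integral_add set_integrable_divide) auto
  have fg: "(\<lambda>x. indicator {0..T} x *\<^sub>R (f x * g x)) = (\<lambda>x. (indicator {0..T} x *\<^sub>R f x) * (indicator {0..T} x *\<^sub>R g x))"
    by (auto simp: indicator_def)
  show 1: "set_integrable lebesgue {0..T} (\<lambda>x. f x * g x)"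
    unfolding set_integrable_def
  proof (rule Bochner_Integration.integrable_bound[OF bi[of 1 1, unfolded set_integrable_def]])
    show "(\<lambda>x. indicator {0..T} x *\<^sub>R (f x * g x)) \<in> borel_measurable lebesgue"
      unfolding fg by measurable
    show "AE x in lebesgue. norm (indicator {0..T} x *\<^sub>R (f x * g x))
         \<le> norm (indicator {0..T} x *\<^sub>R (1 * 1 * (\<bar>f x\<bar> powr p / 1 powr p / p + \<bar>g x\<bar> powr q / 1 powr q / q)))"
      using young[of 1 1] by (intro AE_I2) (auto simp: indicator_def intro: order_trans[OF _ abs_ge_self])
  qed
  define A B where "A = Lp_norm T p f" and "B = Lp_norm T q g"
  have AB: "0 \<le> A" "0 \<le> B" by (auto simp: A_def B_def Lp_norm_nonneg)
  have le: "\<bar>LINT x:{0..T}|lebesgue. f x * g x\<bar> \<le> (A + e) * (B + e)" if e: "0 < e" for e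
  proof -
    let ?a = "A + e" and ?b = "B + e"
    have ab: "0 < ?a" "0 < ?b" using AB e by auto
    have "\<bar>LINT x:{0..T}|lebesgue. f x * g x\<bar> \<le> (LINT x:{0..T}|lebesgue. \<bar>f x * g x\<bar>)"
      using 1 set_integral_norm_bound[OF 1] by simp
    also have "\<dots> \<le> (LINT x:{0..T}|lebesgue. ?a * ?b * (\<bar>f x\<bar> powr p / ?a powr p / p + \<bar>g x\<bar> powr q / ?b powr q / q))"
      by (rule set_integral_mono) (use 1 set_integrable_abs bi young[OF ab] in auto)
    also have "\<dots> = ?a * ?b * (A powr p / ?a powr p / p + B powr q / ?b powr q / q)"
      using int p q by (simp add: set_integral_add A_def B_def Lp_norm_powr del: times_divide_eq_right)
    also have "\<dots> \<le> ?a * ?b * (1 / p + 1 / q)"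
    proof -
      have "A powr p / ?a powr p \<le> 1" "B powr q / ?b powr q \<le> 1"
        using AB e p q ab by (auto simp: divide_le_eq_1 intro!: powr_mono2)
      then show ?thesis using ab p q
        by (intro mult_left_mono add_mono divide_right_mono) auto
    qed
    finally show ?thesis using q by simp
  qed
  have "((\<lambda>e. (A + e) * (B + e)) \<longlongrightarrow> (A + 0) * (B + 0)) (at_right 0)"
    by (intro tendsto_intros)
  then have "\<bar>LINT x:{0..T}|lebesgue. f x * g x\<bar> \<le> A * B"
    by (intro tendsto_lowerbound[of "\<lambda>e. (A + e) * (B + e)"])
       (auto simp: eventually_at_right_field intro!: exI[of _ 1] le)
  then show "\<bar>LINT x:{0..T}|lebesgue. f x * g x\<bar> \<le> Lp_norm T p f * Lp_norm T (p / (p - 1)) g"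
    by (simp add: A_def B_def q_def)
qed

lemma Holder_continuous:
  assumes "1 < p" "continuous_on {0..T} f" "continuous_on {0..T} g"
  shows "\<bar>integral {0..T} (\<lambda>x. f x * g x)\<bar> \<le> Lp_norm T p f * Lp_norm T (p / (p - 1)) g"
proof -
  have "(LINT x:{0..T}|lebesgue. f x * g x) = integral {0..T} (\<lambda>x. f x * g x)"
    by (rule integral_continuous_eq_LINT) (intro continuous_intros assms)
  then show ?thesis
    using Holder_Lp(2)[of p f T g] Lp_space_continuous[of T f p] Lp_space_continuous[of T g "p / (p - 1)"]
      assms conjugate_exponent[of p] by auto
qed

text \<open>With \<open>x = p * ln a - q * ln b\<close>, division by \<open>b powr q\<close> turns
  the hypothesis into \<open>exp (x / p) = exp x / p + (1 - 1 / p)\<close>. This is equality in the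
  convexity of \<open>exp\<close> between 0 and \<open>x\<close>, which forces
  \<open>x = 0\<close>.\<close>

lemma Youngs_inequality_eq:
  fixes p q :: real
  assumes p: "1 < p" "1 < q" "1 / p + 1 / q = 1" and a: "0 \<le> a" "0 \<le> b"
    and eq: "a * b = a powr p / p + b powr q / q"
  shows "a powr p = b powr q"
proof (cases "a = 0 \<or> b = 0")
  case True
  then show ?thesis using eq p by auto
next
  case False
  define x where "x = p * ln a - q * ln b"
  have q: "1 / q = 1 - 1 / p" "q * (1 - 1 / p) = 1" using p by (auto simp: field_simps)
  have ab: "a powr p = exp (p * ln a)" "b powr q = exp (q * ln b)" "a = exp (ln a)" "b = exp (ln b)"
    using False a by (auto simp: powr_def)
  have 1: "p * ln a = x + q * ln b" by (simp add: x_def)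
  have "q - q / p = 1" using q(2) by (simp add: algebra_simps)
  then have "(q - q / p) * ln b = ln b" by simp
  moreover have "x / p = ln a - q / p * ln b" using p by (simp add: x_def diff_divide_distrib)
  ultimately have "ln a + ln b = x / p + q * ln b" by (simp add: algebra_simps)
  then have 2: "a * b = exp (x / p) * exp (q * ln b)"
    using ab(3,4) by (metis exp_add)
  have "exp (x / p) * exp (q * ln b) = (exp x / p + 1 / q) * exp (q * ln b)"
    using eq unfolding 2 ab(1,2) 1 exp_add by (simp add: field_simps)
  then have e: "exp (x / p) = exp x / p + (1 - 1 / p)" using q by simp
  have f: "exp (x / p) * exp (x * (1 - 1 / p)) = exp x" "exp (x / p) * exp (- x / p) = 1"
    by (auto simp: exp_add[symmetric] algebra_simps)
  have "exp (x / p) * (exp (x * (1 - 1 / p)) / p + exp (- x / p) * (1 - 1 / p)) = exp x / p + (1 - 1 / p)"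
    using f by (simp add: distrib_left mult.assoc[symmetric])
  with e have E: "exp (x * (1 - 1 / p)) / p + exp (- x / p) * (1 - 1 / p) = 1" by auto
  \<comment> \<open>With weights \<open>1 / p\<close> and \<open>1 - 1 / p\<close> the two tangent
    bounds add up to exactly 1, so by \<open>E\<close> neither can be strict.\<close>
  have g: "1 + x * (1 - 1 / p) \<le> exp (x * (1 - 1 / p))" "1 + - x / p \<le> exp (- x / p)"
    by (rule exp_ge_add_one_self)+
  have "exp (- x / p) = 1 + - x / p"
  proof (rule ccontr)
    assume "exp (- x / p) \<noteq> 1 + - x / p"
    then have "1 + - x / p < exp (- x / p)" using g by auto
    then have "(1 + - x / p) * (1 - 1 / p) < exp (- x / p) * (1 - 1 / p)"
      using p by (intro mult_strict_right_mono) auto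
    moreover have "(1 + x * (1 - 1 / p)) / p \<le> exp (x * (1 - 1 / p)) / p"
      using g p by (intro divide_right_mono) auto
    moreover have "(1 + x * (1 - 1 / p)) / p + (1 + - x / p) * (1 - 1 / p) = 1"
      using p by (simp add: field_simps)
    ultimately show False using E by linarith
  qed
  then have "- x / p = exp (- x / p) - 1" by simp
  then have "ln (exp (- x / p)) = exp (- x / p) - 1" by (simp only: ln_exp)
  then have "exp (- x / p) = 1" by (rule ln_eq_minus_one[rotated]) simp
  then have "x = 0" using p by simp
  then show ?thesis using 1 ab by simp
qed

text \<open>The defect \<open>?D\<close> in Young's inequality is nonnegative with integral
  \<open>1 / p + 1 / q - 1 = 0\<close>. Being continuous, it vanishes pointwise, so the equality
  case of Young's inequality applies at every \<open>t\<close>.\<close>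

lemma Holder_eq_continuous:
  fixes p T :: real and h w :: "real \<Rightarrow> real"
  assumes p: "1 < p" and T: "0 < T" and h: "continuous_on {0..T} h" "continuous_on {0..T} w"
    and nn: "\<And>t. t \<in> {0..T} \<Longrightarrow> 0 \<le> h t" "\<And>t. t \<in> {0..T} \<Longrightarrow> 0 \<le> w t"
    and 1: "integral {0..T} (\<lambda>t. \<bar>h t\<bar> powr p) = 1" "integral {0..T} (\<lambda>t. \<bar>w t\<bar> powr (p / (p - 1))) = 1"
      "integral {0..T} (\<lambda>t. h t * w t) = 1" and t: "t \<in> {0..T}"
  shows "h t = w t powr (1 / (p - 1))"
proof -
  define q where "q = p / (p - 1)"
  have q: "1 < q" "1 / p + 1 / q = 1" using conjugate_exponent[OF p] by (auto simp: q_def)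
  let ?D = "\<lambda>t. \<bar>h t\<bar> powr p / p + \<bar>w t\<bar> powr q / q - h t * w t"
  have c: "continuous_on {0..T} (\<lambda>t. \<bar>h t\<bar> powr p)" "continuous_on {0..T} (\<lambda>t. \<bar>w t\<bar> powr q)"
    "continuous_on {0..T} (\<lambda>t. h t * w t)"
    using p q h by (auto intro!: continuous_on_abs_powr continuous_intros)
  have cD: "continuous_on {0..T} ?D" by (intro continuous_intros c) (use p q in auto)
  have nD: "0 \<le> ?D t" if "t \<in> {0..T}" for t
    using Youngs_inequality[OF p q nn[OF that]] nn[OF that] by auto
  have i: "(\<lambda>t. \<bar>h t\<bar> powr p) integrable_on {0..T}" "(\<lambda>t. \<bar>w t\<bar> powr q) integrable_on {0..T}"
    "(\<lambda>t. h t * w t) integrable_on {0..T}"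
    by (rule integrable_continuous_interval, rule c)+
  have "((\<lambda>t. \<bar>h t\<bar> powr p) has_integral 1) {0..T}" "((\<lambda>t. \<bar>w t\<bar> powr q) has_integral 1) {0..T}"
    "((\<lambda>t. h t * w t) has_integral 1) {0..T}"
    using i 1 by (auto simp: has_integral_iff q_def)
  then have "(?D has_integral (1 / p + 1 / q - 1)) {0..T}"
    by (intro has_integral_diff has_integral_add has_integral_divide)
  then have "integral {0..T} ?D = 0" using q by (simp add: has_integral_iff)
  then have "?D t = 0" using integral_eq_0_iff[OF cD T nD] t by auto
  then have "h t * w t = h t powr p / p + w t powr q / q" using nn[OF t] by simp
  then have "h t powr p = w t powr q" using Youngs_inequality_eq[OF p q nn[OF t]] by simp
  then have "(h t powr p) powr (1 / p) = (w t powr q) powr (1 / p)" by simp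
  then show ?thesis using p nn[OF t] by (simp add: powr_powr q_def)
qed

section \<open>Signed powers and the Green operator\<close>

lemma continuous_on_spow:
  assumes "0 < r" "continuous_on S f"
  shows "continuous_on S (\<lambda>x. spow r (f x))"
proof -
  \<comment> \<open>As \<open>sgn\<close> jumps at 0, the signed power is split into powers of the
    positive and negative parts, which are continuous for \<open>0 < r\<close>.\<close>
  have eq: "spow r x = max x 0 powr r - max (- x) 0 powr r" for x
    by (auto simp: spow_def sgn_if max_def)
  have "continuous_on S (\<lambda>x. max (f x) 0 powr r)" "continuous_on S (\<lambda>x. max (- f x) 0 powr r)"
    by (rule continuous_on_powr'; use assms in \<open>auto intro!: continuous_intros\<close>)+
  then show ?thesis unfolding eq by (rule continuous_on_diff)
qed

lemma spow_simps:
  "\<bar>spow r x\<bar> = \<bar>x\<bar> powr r" "0 \<le> x \<Longrightarrow> spow r x = x powr r" "spow r (- x) = - spow r x"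
  "x * spow r x = \<bar>x\<bar> powr (r + 1)"
  by (auto simp: spow_def sgn_if abs_mult powr_add)

definition prim :: "(real \<Rightarrow> real) \<Rightarrow> real \<Rightarrow> real" where
  "prim g t = integral {0..t} g"

text \<open>The solution of \<open>- u'' = g\<close> with \<open>u 0 = u T = 0\<close>.\<close>

definition green :: "real \<Rightarrow> (real \<Rightarrow> real) \<Rightarrow> real \<Rightarrow> real" where
  "green T g t = t * (prim (prim g) T / T) - prim (prim g) t"

definition green' :: "real \<Rightarrow> (real \<Rightarrow> real) \<Rightarrow> real \<Rightarrow> real" where
  "green' T g t = prim (prim g) T / T - prim g t"

context
  fixes T :: real and g :: "real \<Rightarrow> real"
  assumes T: "0 < T" and g: "continuous_on {0..T} g"
begin

lemma prim_has_derivative: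
  "t \<in> {0..T} \<Longrightarrow> (prim g has_real_derivative g t) (at t within {0..T})"
  unfolding prim_def[abs_def] by (rule integral_has_real_derivative[OF g])

lemma continuous_on_prim: "continuous_on {0..T} (prim g)"
  using prim_has_derivative by (rule DERIV_continuous_on)

lemma prim_prim_has_derivative:
  "t \<in> {0..T} \<Longrightarrow> (prim (prim g) has_real_derivative prim g t) (at t within {0..T})"
  unfolding prim_def[of "prim g", abs_def] by (rule integral_has_real_derivative[OF continuous_on_prim])

lemma green_has_derivative:
  "t \<in> {0..T} \<Longrightarrow> (green T g has_real_derivative green' T g t) (at t within {0..T})"
  unfolding green_def[abs_def] green'_def
  by (rule derivative_eq_intros prim_prim_has_derivative refl | simp)+

lemma green'_has_derivative:
  "t \<in> {0..T} \<Longrightarrow> (green' T g has_real_derivative - g t) (at t within {0..T})"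
  unfolding green'_def[abs_def]
  by (rule derivative_eq_intros prim_has_derivative refl | simp)+

lemma green_boundary: "green T g 0 = 0" "green T g T = 0"
  using T by (auto simp: green_def prim_def)

lemma continuous_on_green: "continuous_on {0..T} (green T g)"
  using green_has_derivative by (rule DERIV_continuous_on)

lemma continuous_on_green': "continuous_on {0..T} (green' T g)"
  using green'_has_derivative by (rule DERIV_continuous_on)

end

lemma concave_Dirichlet_nonneg:
  fixes f f' f'' :: "real \<Rightarrow> real"
  assumes T: "0 < T" and d: "\<And>t. t \<in> {0..T} \<Longrightarrow> (f has_real_derivative f' t) (at t within {0..T})"
    "\<And>t. t \<in> {0..T} \<Longrightarrow> (f' has_real_derivative f'' t) (at t within {0..T})"
    and neg: "\<And>t. 0 < t \<Longrightarrow> t < T \<Longrightarrow> f'' t \<le> 0" and z: "f 0 = 0" "f T = 0" and t: "t \<in> {0..T}"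
  shows "0 \<le> f t"
  using concave_chord[OF d neg z(1), of t T] T t z by (simp add: zero_le_mult_iff)

lemma green_nonneg:
  assumes "0 < T" "continuous_on {0..T} g" "\<And>t. t \<in> {0..T} \<Longrightarrow> 0 \<le> g t" "t \<in> {0..T}"
  shows "0 \<le> green T g t"
  by (rule concave_Dirichlet_nonneg[OF assms(1) green_has_derivative[OF assms(1,2)] green'_has_derivative[OF assms(1,2)]])
     (use assms green_boundary[OF assms(1,2)] in auto)

text \<open>The maximum principle for the sources \<open>\<bar>g\<bar> - g\<close> and
  \<open>\<bar>g\<bar> + g\<close>. It lets a maximizing sequence be chosen nonnegative.\<close>

lemma abs_green_le:
  assumes T: "0 < T" and g: "continuous_on {0..T} g" and t: "t \<in> {0..T}"
  shows "\<bar>green T g t\<bar> \<le> green T (\<lambda>t. \<bar>g t\<bar>) t"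
proof -
  have a: "continuous_on {0..T} (\<lambda>t. \<bar>g t\<bar>)" using g by (intro continuous_intros)
  note d = green_has_derivative[OF T g] green'_has_derivative[OF T g]
    green_has_derivative[OF T a] green'_has_derivative[OF T a]
  note z = green_boundary[OF T g] green_boundary[OF T a]
  have "0 \<le> green T (\<lambda>t. \<bar>g t\<bar>) t - green T g t"
    by (rule concave_Dirichlet_nonneg[OF T DERIV_diff[OF d(3,1)] DERIV_diff[OF d(4,2)]])
       (use z t in auto)
  moreover have "0 \<le> green T (\<lambda>t. \<bar>g t\<bar>) t + green T g t"
    by (rule concave_Dirichlet_nonneg[OF T DERIV_add[OF d(3,1)] DERIV_add[OF d(4,2)]])
       (use z t in auto)
  ultimately show ?thesis by linarith
qed

text \<open>The Wronskian of \<open>green T g\<close> and \<open>green T h\<close> has the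
  difference of the two integrands as its derivative and vanishes at both ends.\<close>

lemma green_symmetric:
  assumes T: "0 < T" and g: "continuous_on {0..T} g" and h: "continuous_on {0..T} h"
  shows "integral {0..T} (\<lambda>t. green T h t * g t) = integral {0..T} (\<lambda>t. h t * green T g t)"
proof -
  note c = continuous_on_green[OF T g] continuous_on_green[OF T h]
  have "((\<lambda>t. green' T h t * green T g t - green T h t * green' T g t) has_real_derivative
      green T h t * g t - h t * green T g t) (at t within {0..T})" if "t \<in> {0..T}" for t
    by (rule derivative_eq_intros green_has_derivative[OF T] green'_has_derivative[OF T] g h that refl)+
       (simp add: algebra_simps)
  then have "((\<lambda>t. green T h t * g t - h t * green T g t) has_integral
      (green' T h T * green T g T - green T h T * green' T g T) - (green' T h 0 * green T g 0 - green T h 0 * green' T g 0)) {0..T}"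
    using T by (intro fundamental_theorem_of_calculus)
      (auto simp: has_real_derivative_iff_has_vector_derivative[symmetric])
  then have "integral {0..T} (\<lambda>t. green T h t * g t - h t * green T g t) = 0"
    by (simp add: green_boundary[OF T g] green_boundary[OF T h] has_integral_iff)
  moreover have "(\<lambda>t. green T h t * g t) integrable_on {0..T}" "(\<lambda>t. h t * green T g t) integrable_on {0..T}"
    by (intro integrable_continuous_interval continuous_intros c g h)+
  ultimately show ?thesis by (simp add: integral_diff)
qed

text \<open>Hoelder's inequality against the constant 1 bounds the integral of
  \<open>\<bar>h\<bar>\<close>, which explains the norm of \<open>\<lambda>_. 1\<close>; the 2
  counts the two terms of \<open>green\<close> and \<open>green'\<close>. These uniform bounds feed
  Arzela-Ascoli.\<close>

lemma green_bounds:
  assumes T: "0 < T" and p: "1 < p" and h: "continuous_on {0..T} h" and N: "Lp_norm T p h \<le> 1" and t: "t \<in> {0..T}"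
  shows "\<bar>green T h t\<bar> \<le> 2 * T * Lp_norm T (p / (p - 1)) (\<lambda>_. 1)" "\<bar>green' T h t\<bar> \<le> 2 * Lp_norm T (p / (p - 1)) (\<lambda>_. 1)"
proof -
  define L where "L = Lp_norm T (p / (p - 1)) (\<lambda>_. 1)"
  have L0: "0 \<le> L" by (simp add: L_def Lp_norm_nonneg)
  have a: "continuous_on {0..T} (\<lambda>t. \<bar>h t\<bar>)" using h by (intro continuous_intros)
  have "\<bar>integral {0..T} (\<lambda>t. \<bar>h t\<bar> * 1)\<bar> \<le> Lp_norm T p (\<lambda>t. \<bar>h t\<bar>) * L"
    unfolding L_def by (rule Holder_continuous[OF p a]) auto
  also have "Lp_norm T p (\<lambda>t. \<bar>h t\<bar>) = Lp_norm T p h" by (simp add: Lp_norm_def)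
  also have "Lp_norm T p h * L \<le> 1 * L" using N L0 by (intro mult_right_mono)
  finally have L: "integral {0..T} (\<lambda>t. \<bar>h t\<bar>) \<le> L" by simp
  have P1: "\<bar>prim h s\<bar> \<le> L" if "s \<in> {0..T}" for s
  proof -
    have sub: "{0..s} \<subseteq> {0..T}" using that by auto
    have i: "h integrable_on {0..s}" "(\<lambda>t. \<bar>h t\<bar>) integrable_on {0..s}" "(\<lambda>t. \<bar>h t\<bar>) integrable_on {0..T}"
      using h a continuous_on_subset[OF _ sub] by (auto intro!: integrable_continuous_interval)
    have "\<bar>prim h s\<bar> \<le> integral {0..s} (\<lambda>t. \<bar>h t\<bar>)"
      unfolding prim_def using integral_norm_bound_integral[OF i(1,2)] by simp
    also have "\<dots> \<le> integral {0..T} (\<lambda>t. \<bar>h t\<bar>)" by (rule integral_subset_le[OF sub i(2,3)]) auto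
    finally show ?thesis using L by simp
  qed
  have P2: "\<bar>prim (prim h) s\<bar> \<le> T * L" if "s \<in> {0..T}" for s
  proof -
    have "\<bar>prim (prim h) s\<bar> \<le> L * (s - 0)"
      unfolding prim_def[of "prim h"] real_norm_def[symmetric]
      by (rule integral_bound) (use that P1 continuous_on_subset[OF continuous_on_prim[OF T h]] in auto)
    also have "\<dots> \<le> L * T" using that L0 by (intro mult_left_mono) auto
    also have "\<dots> = T * L" by simp
    finally show ?thesis .
  qed
  have q: "\<bar>prim (prim h) T / T\<bar> \<le> L" using P2[of T] T by (simp add: field_simps)
  show "\<bar>green' T h t\<bar> \<le> 2 * Lp_norm T (p / (p - 1)) (\<lambda>_. 1)"
    using q P1[OF t] unfolding green'_def L_def[symmetric] by linarith
  have "\<bar>t * (prim (prim h) T / T)\<bar> \<le> T * L"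
    unfolding abs_mult using q t L0 T by (intro mult_mono) auto
  then show "\<bar>green T h t\<bar> \<le> 2 * T * Lp_norm T (p / (p - 1)) (\<lambda>_. 1)"
    unfolding green_def L_def[symmetric]
    by (intro order_trans[OF abs_triangle_ineq4]) (use P2[OF t] in linarith)
qed

section \<open>Maximizers\<close>

lemma deriv_zero_if_zero:
  fixes f f' :: "real \<Rightarrow> real"
  assumes d: "\<And>t. t \<in> {a..b} \<Longrightarrow> (f has_real_derivative f' t) (at t within {a..b})"
    and z: "\<And>t. t \<in> {a<..<b} \<Longrightarrow> f t = 0" and t: "t \<in> {a<..<b}"
  shows "f' t = 0"
proof -
  have "at t within {a..b} = at t" using t by (intro at_within_Icc_at) auto
  with d[of t] t have "(f has_real_derivative f' t) (at t)" by simp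
  moreover have "(f has_real_derivative 0) (at t)"
    by (rule has_field_derivative_transform_within_open[OF DERIV_const, of "{a<..<b}"]) (use t z in auto)
  ultimately show ?thesis by (rule DERIV_unique)
qed

text \<open>The strong maximum principle. If \<open>f s = 0\<close>, the chord from 0 forces
  \<open>f = 0\<close> to the right of \<open>s\<close>; the slope 0 found there makes
  \<open>f\<close> increase on the left, so \<open>f\<close> is at most 0 there too. Then
  \<open>f\<close> vanishes throughout, and so does \<open>f''\<close> inside.\<close>

lemma concave_Dirichlet_pos:
  fixes f f' f'' :: "real \<Rightarrow> real"
  assumes d: "\<And>t. t \<in> {0..T} \<Longrightarrow> (f has_real_derivative f' t) (at t within {0..T})"
    "\<And>t. t \<in> {0..T} \<Longrightarrow> (f' has_real_derivative f'' t) (at t within {0..T})"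
    and neg: "\<And>t. 0 < t \<Longrightarrow> t < T \<Longrightarrow> f'' t \<le> 0" and b: "f 0 = 0" "f T = 0"
    and nz: "x \<in> {0<..<T}" "f'' x \<noteq> 0" and s: "s \<in> {0<..<T}"
  shows "0 < f s"
proof (rule ccontr)
  have T: "0 < T" using s by simp
  have nonneg: "0 \<le> f t" if "t \<in> {0..T}" for t by (rule concave_Dirichlet_nonneg[OF T d neg b that])
  assume "\<not> 0 < f s"
  then have s0: "f s = 0" using nonneg[of s] s by auto
  have anti: "f' y \<le> f' x" if "0 \<le> x" "x \<le> y" "y \<le> T" for x y
    by (rule concave_deriv_antimono[OF d(2) neg that])
  have right: "f r = 0" if "s \<le> r" "r \<le> T" for r
  proof -
    have "s * f r \<le> r * f s"
      by (rule concave_chord[OF d neg b(1)]) (use that s in auto)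
    then show ?thesis using s0 nonneg[of r] that s by (auto simp: mult_le_0_iff)
  qed
  have sT: "0 \<le> s" "s < T" using s by auto
  obtain \<xi> where \<xi>: "s < \<xi>" "\<xi> < T" "f T - f s = f' \<xi> * (T - s)"
    by (rule MVT_Icc[OF d(1) sT order.refl])
  then have \<xi>0: "f' \<xi> = 0" using s0 b by simp
  have left: "f r = 0" if r: "0 \<le> r" "r < s" for r
  proof -
    obtain \<eta> where \<eta>: "r < \<eta>" "\<eta> < s" "f s - f r = f' \<eta> * (s - r)"
      by (rule MVT_Icc[OF d(1) r less_imp_le[OF sT(2)]])
    have "0 \<le> f' \<eta>" using anti[of \<eta> \<xi>] \<xi> \<xi>0 \<eta> r by auto
    then have "0 \<le> f' \<eta> * (s - r)" using r by simp
    then show ?thesis using \<eta> s0 nonneg[of r] r s by auto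
  qed
  have z: "f t = 0" if "t \<in> {0<..<T}" for t
    using left[of t] right[of t] that by (cases "t < s") auto
  have z': "f' t = 0" if "t \<in> {0<..<T}" for t by (rule deriv_zero_if_zero[OF d(1) z that])
  have "f'' x = 0" by (rule deriv_zero_if_zero[OF d(2) z' nz(1)])
  with nz show False by simp
qed

lemma green_pos:
  assumes T: "0 < T" and g: "continuous_on {0..T} g" and nn: "\<And>t. t \<in> {0..T} \<Longrightarrow> 0 \<le> g t"
    and nz: "x \<in> {0<..<T}" "g x \<noteq> 0" and s: "s \<in> {0<..<T}"
  shows "0 < green T g s"
  by (rule concave_Dirichlet_pos[OF green_has_derivative[OF T g] green'_has_derivative[OF T g] _
        green_boundary[OF T g] nz(1) _ s]) (use nn nz in auto)

definition Smax :: "real \<Rightarrow> real \<Rightarrow> real \<Rightarrow> real" where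
  "Smax T p q = Sup ((\<lambda>h. Lp_norm T q (green T h)) ` {h. continuous_on {0..T} h \<and> Lp_norm T p h \<le> 1})"

context
  fixes T p q :: real
  assumes T: "0 < T" and p: "1 < p" and q: "1 < q"
begin

lemma Smax_bdd: "bdd_above ((\<lambda>h. Lp_norm T q (green T h)) ` {h. continuous_on {0..T} h \<and> Lp_norm T p h \<le> 1})"
proof (rule bdd_aboveI2)
  fix h assume "h \<in> {h. continuous_on {0..T} h \<and> Lp_norm T p h \<le> 1}"
  then have h: "continuous_on {0..T} h" "Lp_norm T p h \<le> 1" by auto
  show "Lp_norm T q (green T h) \<le> Lp_norm T q (\<lambda>_. 2 * T * Lp_norm T (p / (p - 1)) (\<lambda>_. 1))"
    using green_bounds(1)[OF T p h] q
    by (intro Lp_norm_mono_continuous continuous_on_green T h) (auto intro!: order_trans[OF _ abs_ge_self])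
qed

lemma Smax_upper: "continuous_on {0..T} h \<Longrightarrow> Lp_norm T p h \<le> 1 \<Longrightarrow> Lp_norm T q (green T h) \<le> Smax T p q"
  unfolding Smax_def by (rule cSup_upper[OF _ Smax_bdd]) auto

lemma Smax_pos: "0 < Smax T p q"
proof -
  define N where "N = Lp_norm T p (\<lambda>_. 1)"
  have N: "0 < N" unfolding N_def by (rule Lp_norm_pos[of _ _ _ 0]) (use T p in auto)
  let ?h = "\<lambda>_::real. 1 / N"
  have h: "continuous_on {0..T} ?h" by simp
  have "Lp_norm T p (\<lambda>x. 1 / N * 1) = \<bar>1 / N\<bar> * N"
    unfolding N_def by (rule Lp_norm_scale) (use p in auto)
  then have h1: "Lp_norm T p ?h \<le> 1" using N by simp
  have "0 < green T ?h (T / 2)" by (rule green_pos[OF T h, of "T / 2"]) (use T N in auto)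
  then have "0 < Lp_norm T q (green T ?h)"
    by (intro Lp_norm_pos[OF T continuous_on_green[OF T h], of _ "T / 2"]) (use T q in auto)
  then show ?thesis using Smax_upper[OF h h1] by simp
qed

text \<open>One step of the nonlinear power iteration \<open>u \<mapsto> green h\<close>: it does not decrease the quotient.\<close>

lemma power_iteration:
  fixes u :: "real \<Rightarrow> real"
  assumes u: "continuous_on {0..T} u"
  defines "v \<equiv> green T (\<lambda>t. spow (q - 1) (u t))"
  defines "m \<equiv> Lp_norm T (p / (p - 1)) v"
  assumes m: "0 < m"
  defines "h \<equiv> \<lambda>t. spow (1 / (p - 1)) (v t / m)"
  shows "continuous_on {0..T} h" "Lp_norm T p h = 1" "integral {0..T} (\<lambda>t. h t * v t) = m"
    "m \<le> Lp_norm T q (green T h) * Lp_norm T q u powr (q - 1)"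
proof -
  note e = conjugate_exponent[OF p]
  have g: "continuous_on {0..T} (\<lambda>t. spow (q - 1) (u t))"
    using q u by (intro continuous_on_spow) auto
  have v: "continuous_on {0..T} v" unfolding v_def by (rule continuous_on_green[OF T g])
  show h: "continuous_on {0..T} h"
    unfolding h_def using e(5) m by (intro continuous_on_spow continuous_intros v) auto
  \<comment> \<open>\<open>h\<close> is the extremal partner of \<open>v\<close> in Hoelder's
    inequality: \<open>\<bar>h\<bar> powr p\<close> is \<open>\<bar>v\<bar>\<close> to the conjugate
    exponent, divided by its integral.\<close>
  have hp: "\<bar>h t\<bar> powr p = \<bar>v t\<bar> powr (p / (p - 1)) / m powr (p / (p - 1))" for t
    using m e(3) by (simp add: h_def spow_simps powr_powr powr_divide)
  have mi: "integral {0..T} (\<lambda>t. \<bar>v t\<bar> powr (p / (p - 1))) = m powr (p / (p - 1))"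
    unfolding m_def by (rule Lp_norm_powr_continuous[symmetric, OF v]) (use e in auto)
  show "Lp_norm T p h = 1"
    using m p by (simp add: Lp_norm_continuous[OF h] hp mi)
  have hv: "h t * v t = \<bar>v t\<bar> powr (p / (p - 1)) / m powr (1 / (p - 1))" for t
  proof -
    have "h t * v t = m * ((v t / m) * spow (1 / (p - 1)) (v t / m))" using m by (simp add: h_def)
    also have "\<dots> = m * (\<bar>v t\<bar> / m) powr (p / (p - 1))"
      unfolding spow_simps e(4) using m by simp
    also have "\<dots> = \<bar>v t\<bar> powr (p / (p - 1)) * (m / m powr (p / (p - 1)))"
      using m by (simp add: powr_divide)
    also have "m / m powr (p / (p - 1)) = 1 / m powr (1 / (p - 1))"
      using m unfolding e(4)[symmetric] powr_add by simp
    finally show ?thesis by simp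
  qed
  show hvm: "integral {0..T} (\<lambda>t. h t * v t) = m"
    unfolding hv using m e(7) by (simp add: mi powr_diff[symmetric])
  have gn: "Lp_norm T (q / (q - 1)) (\<lambda>t. spow (q - 1) (u t)) = Lp_norm T q u powr (q - 1)"
  proof -
    have "\<bar>spow (q - 1) x\<bar> powr (q / (q - 1)) = \<bar>x\<bar> powr q" for x
      using q by (simp add: spow_simps powr_powr)
    then show ?thesis using q by (simp add: Lp_norm_def powr_powr)
  qed
  \<comment> \<open>By symmetry the pairing of \<open>h\<close> with \<open>v\<close> is also that
    of \<open>green T h\<close> with the signed power of \<open>u\<close>, to which Hoelder's
    inequality with exponent \<open>q\<close> applies.\<close>
  have "m = integral {0..T} (\<lambda>t. green T h t * spow (q - 1) (u t))"
    unfolding green_symmetric[OF T g h] v_def[symmetric] hvm ..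
  also have "\<dots> \<le> Lp_norm T q (green T h) * Lp_norm T (q / (q - 1)) (\<lambda>t. spow (q - 1) (u t))"
    using Holder_continuous[OF q continuous_on_green[OF T h] g] by simp
  finally show "m \<le> Lp_norm T q (green T h) * Lp_norm T q u powr (q - 1)" unfolding gn .
qed

text \<open>The \<open>h n\<close> themselves may fail to converge, and the uniform limit
  \<open>u\<close> of their images is never identified as \<open>green\<close> of anything. It is
  enough that \<open>u\<close> has norm \<open>S\<close> and that \<open>S powr q \<le> m\<close>:
  one iteration step from \<open>u\<close> then yields a continuous \<open>w\<close> of norm 1 with
  \<open>green T w\<close> of norm at least \<open>S\<close>.\<close>

lemma exists_maximizer:
  obtains h where "continuous_on {0..T} h" "\<And>t. t \<in> {0..T} \<Longrightarrow> 0 \<le> h t" "Lp_norm T p h = 1"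
    "Lp_norm T q (green T h) = Smax T p q"
proof -
  define S where "S = Smax T p q"
  have S: "0 < S" unfolding S_def by (rule Smax_pos)
  note e = conjugate_exponent[OF p]
  let ?H = "{h. continuous_on {0..T} h \<and> Lp_norm T p h \<le> 1}"
  have "\<exists>h. continuous_on {0..T} h \<and> (\<forall>t. 0 \<le> h t) \<and> Lp_norm T p h \<le> 1 \<and>
      S - 1 / real (Suc n) < Lp_norm T q (green T h)" for n
  proof -
    have "\<exists>x\<in>(\<lambda>h. Lp_norm T q (green T h)) ` ?H. S - 1 / real (Suc n) < x"
      unfolding S_def Smax_def
      by (rule less_cSupD) (auto intro!: exI[of _ "\<lambda>_. 0"] simp: Lp_norm_def)
    then obtain h where h: "continuous_on {0..T} h" "Lp_norm T p h \<le> 1"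
      "S - 1 / real (Suc n) < Lp_norm T q (green T h)" by auto
    have a: "continuous_on {0..T} (\<lambda>t. \<bar>h t\<bar>)" using h by (intro continuous_intros)
    have "Lp_norm T q (green T h) \<le> Lp_norm T q (green T (\<lambda>t. \<bar>h t\<bar>))"
      using abs_green_le[OF T h(1)] q
      by (intro Lp_norm_mono_continuous continuous_on_green T h a) (auto intro!: order_trans[OF _ abs_ge_self])
    moreover have "Lp_norm T p (\<lambda>t. \<bar>h t\<bar>) = Lp_norm T p h" by (simp add: Lp_norm_def)
    ultimately show ?thesis using h a by (intro exI[of _ "\<lambda>t. \<bar>h t\<bar>"]) auto
  qed
  then have "\<exists>h. \<forall>n. continuous_on {0..T} (h n) \<and> (\<forall>t. 0 \<le> h n t) \<and> Lp_norm T p (h n) \<le> 1 \<and>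
      S - 1 / real (Suc n) < Lp_norm T q (green T (h n))"
    by (intro choice allI)
  then obtain h where h: "\<And>n. continuous_on {0..T} (h n)" "\<And>n t. 0 \<le> h n t" "\<And>n. Lp_norm T p (h n) \<le> 1"
    "\<And>n. S - 1 / real (Suc n) < Lp_norm T q (green T (h n))" by blast
  define L where "L = Lp_norm T (p / (p - 1)) (\<lambda>_. 1)"
  define M where "M = 2 * T * L"
  have bM: "\<bar>green T (h n) t\<bar> \<le> M" and bL: "\<bar>green' T (h n) t\<bar> \<le> 2 * L" if "t \<in> {0..T}" for n t
    using green_bounds[OF T p h(1) h(3) that] by (auto simp: M_def L_def)
  have L0: "0 \<le> L" by (simp add: L_def Lp_norm_nonneg)
  have lip: "\<bar>green T (h n) x - green T (h n) y\<bar> \<le> 2 * L * \<bar>x - y\<bar>"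
    if "x \<in> {0..T}" "y \<in> {0..T}" for n x y
    using field_differentiable_bound[of "{0..T}" "green T (h n)" "green' T (h n)" "2 * L" x y] that
      green_has_derivative[OF T h(1)] bL by auto
  obtain u k where u: "continuous_on {0..T} u" and k: "strict_mono (k :: nat \<Rightarrow> nat)"
    and unif: "\<And>e. 0 < e \<Longrightarrow> \<exists>N. \<forall>n x. n \<ge> N \<and> x \<in> {0..T} \<longrightarrow> norm (green T (h (k n)) x - u x) < e"
  proof (rule Arzela_Ascoli[of "{0..T}" "\<lambda>n. green T (h n)" M])
    fix x e :: real assume x: "x \<in> {0..T}" and e: "0 < e"
    show "\<exists>d>0. \<forall>n y. y \<in> {0..T} \<and> norm (x - y) < d \<longrightarrow> norm (green T (h n) x - green T (h n) y) < e"
    \<comment> \<open>The summand 1 keeps the denominator positive, given only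
      \<open>0 \<le> L\<close>.\<close>
    proof (intro exI[of _ "e / (2 * L + 1)"] conjI allI impI)
      fix n y assume y: "y \<in> {0..T} \<and> norm (x - y) < e / (2 * L + 1)"
      then have "norm (green T (h n) x - green T (h n) y) \<le> 2 * L * \<bar>x - y\<bar>" using lip x by auto
      also have "\<dots> \<le> (2 * L + 1) * \<bar>x - y\<bar>" by (intro mult_right_mono) auto
      also have "\<dots> < e" using y L0 by (simp add: field_simps)
      finally show "norm (green T (h n) x - green T (h n) y) < e" .
    qed (use e L0 in auto)
  qed (use bM in auto)
  have lim: "(\<lambda>n. green T (h (k n)) x) \<longlonglongrightarrow> u x" if "x \<in> {0..T}" for x
  proof (rule LIMSEQ_I)
    fix r :: real assume "0 < r"
    from unif[OF this] obtain N where N: "\<forall>n x. n \<ge> N \<and> x \<in> {0..T} \<longrightarrow> norm (green T (h (k n)) x - u x) < r" ..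
    show "\<exists>no. \<forall>n\<ge>no. norm (green T (h (k n)) x - u x) < r"
      by (intro exI[of _ N] allI impI) (use N that in simp)
  qed
  have nn: "0 \<le> green T (h n) x" if "x \<in> {0..T}" for n x
    by (rule green_nonneg[OF T h(1) h(2) that])
  have u0: "0 \<le> u x" if "x \<in> {0..T}" for x
    by (rule LIMSEQ_le_const[OF lim[OF that]]) (use nn that in auto)
  have cg: "continuous_on {0..T} (green T (h n))" for n by (rule continuous_on_green[OF T h(1)])
  let ?g = "\<lambda>t. spow (q - 1) (u t)"
  have g: "continuous_on {0..T} ?g" using q u by (intro continuous_on_spow) auto
  have M0: "0 \<le> M" using T L0 by (simp add: M_def)
  have "(\<lambda>n. integral {0..T} (\<lambda>t. \<bar>green T (h (k n)) t\<bar> powr q)) \<longlonglongrightarrow> integral {0..T} (\<lambda>t. \<bar>u t\<bar> powr q)"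
  proof (rule dominated_convergence(2))
    show "(\<lambda>_. M powr q) integrable_on {0..T}" by (rule integrable_const_ivl)
    show "(\<lambda>t. \<bar>green T (h (k n)) t\<bar> powr q) integrable_on {0..T}" for n
      by (intro integrable_continuous_interval continuous_on_abs_powr cg) (use q in auto)
    show "norm (\<bar>green T (h (k n)) x\<bar> powr q) \<le> M powr q" if "x \<in> {0..T}" for n x
      using bM[OF that] q by (auto intro!: powr_mono2)
    show "(\<lambda>n. \<bar>green T (h (k n)) x\<bar> powr q) \<longlonglongrightarrow> \<bar>u x\<bar> powr q" if "x \<in> {0..T}" for x
      by (rule tendsto_powr'[OF tendsto_rabs[OF lim[OF that]]]) (use q in auto)
  qed
  then have limq: "(\<lambda>n. Lp_norm T q (green T (h (k n))) powr q) \<longlonglongrightarrow> Lp_norm T q u powr q"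
    using q by (simp add: Lp_norm_powr_continuous[OF cg] Lp_norm_powr_continuous[OF u])
  have "(\<lambda>n. S - 1 / real (Suc (k n))) \<longlonglongrightarrow> S - 0"
    using LIMSEQ_subseq_LIMSEQ[OF LIMSEQ_Suc[OF lim_1_over_n[where 'a=real]] k]
    by (intro tendsto_intros) (simp add: o_def)
  then have low: "(\<lambda>n. S - 1 / real (Suc (k n))) \<longlonglongrightarrow> S" by simp
  have "(\<lambda>n. Lp_norm T q (green T (h (k n)))) \<longlonglongrightarrow> S"
  proof (rule tendsto_sandwich[OF _ _ low tendsto_const])
    show "\<forall>\<^sub>F n in sequentially. S - 1 / real (Suc (k n)) \<le> Lp_norm T q (green T (h (k n)))"
      using h(4) by (intro always_eventually allI less_imp_le)
    show "\<forall>\<^sub>F n in sequentially. Lp_norm T q (green T (h (k n))) \<le> S"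
      unfolding S_def by (intro always_eventually allI Smax_upper h)
  qed
  then have "(\<lambda>n. Lp_norm T q (green T (h (k n))) powr q) \<longlonglongrightarrow> S powr q"
    by (intro tendsto_powr tendsto_const) (use S in auto)
  then have "Lp_norm T q u powr q = S powr q" using limq by (rule LIMSEQ_unique[rotated])
  then have "(Lp_norm T q u powr q) powr (1 / q) = (S powr q) powr (1 / q)" by simp
  then have uS: "Lp_norm T q u = S" using q S Lp_norm_nonneg[of T q u] by (simp add: powr_powr)
  define v where "v = green T ?g"
  define m where "m = Lp_norm T (p / (p - 1)) v"
  have v: "continuous_on {0..T} v" unfolding v_def by (rule continuous_on_green[OF T g])
  have limg: "(\<lambda>n. integral {0..T} (\<lambda>t. green T (h (k n)) t * ?g t)) \<longlonglongrightarrow> integral {0..T} (\<lambda>t. u t * ?g t)"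
  proof (rule dominated_convergence(2))
    show "(\<lambda>t. M * \<bar>?g t\<bar>) integrable_on {0..T}"
      by (intro integrable_continuous_interval continuous_intros g)
    show "(\<lambda>t. green T (h (k n)) t * ?g t) integrable_on {0..T}" for n
      by (intro integrable_continuous_interval continuous_intros cg g)
    show "norm (green T (h (k n)) x * ?g x) \<le> M * \<bar>?g x\<bar>" if "x \<in> {0..T}" for n x
      using bM[OF that] by (simp add: abs_mult mult_right_mono)
    show "(\<lambda>n. green T (h (k n)) x * ?g x) \<longlonglongrightarrow> u x * ?g x" if "x \<in> {0..T}" for x
      by (intro tendsto_intros lim[OF that])
  qed
  have int_u: "integral {0..T} (\<lambda>t. u t * ?g t) = S powr q"
    using Lp_norm_powr_continuous[OF u, of q] q uS by (simp add: spow_simps)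
  have int_le: "integral {0..T} (\<lambda>t. green T (h n) t * ?g t) \<le> m" for n
  proof -
    have "integral {0..T} (\<lambda>t. green T (h n) t * ?g t) = integral {0..T} (\<lambda>t. h n t * v t)"
      unfolding v_def by (rule green_symmetric[OF T g h(1)])
    also have "\<dots> \<le> Lp_norm T p (h n) * m"
      using Holder_continuous[OF p h(1) v, of n] by (simp add: m_def)
    also have "\<dots> \<le> 1 * m" using h(3) Lp_norm_nonneg unfolding m_def by (intro mult_right_mono) auto
    finally show ?thesis by simp
  qed
  \<comment> \<open>By symmetry and Hoelder's inequality each term of \<open>limg\<close> is at most
    \<open>m\<close>, while the limit pairs \<open>u\<close> with its own signed power.\<close>
  have Sm: "S powr q \<le> m"
    by (rule LIMSEQ_le_const2[OF limg[unfolded int_u]]) (use int_le in blast)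
  moreover have "0 < S powr q" using S by simp
  ultimately have m: "0 < m" by linarith
  define w where "w = (\<lambda>t. spow (1 / (p - 1)) (v t / m))"
  note step = power_iteration[OF u, folded v_def, folded m_def, OF m, folded w_def]
  have "S powr q \<le> Lp_norm T q (green T w) * S powr (q - 1)" using Sm step(4) uS by simp
  moreover have "S powr q = S * S powr (q - 1)" using S by (simp add: powr_diff)
  ultimately have "S \<le> Lp_norm T q (green T w)" using S by simp
  moreover have "Lp_norm T q (green T w) \<le> S"
    unfolding S_def by (rule Smax_upper) (use step in auto)
  ultimately have "Lp_norm T q (green T w) = Smax T p q" by (simp add: S_def)
  moreover have "0 \<le> w t" if "t \<in> {0..T}" for t
  proof -
    have "0 \<le> v t" unfolding v_def
      by (rule green_nonneg[OF T g _ that]) (use u0 in \<open>auto simp: spow_simps\<close>)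
    then show ?thesis using m by (simp add: w_def spow_simps)
  qed
  ultimately show thesis by (intro that[of w]) (use step in auto)
qed

text \<open>The equation comes from a squeeze instead of a variation. Pairing \<open>h\<close> with
  \<open>v\<close> gives \<open>S powr q \<le> m\<close> by Hoelder's inequality, and the iteration
  step with the maximality of \<open>S\<close> gives \<open>m \<le> S powr q\<close>. So Hoelder's
  inequality is an equality for \<open>h\<close> and \<open>v / m\<close>, which determines
  \<open>h\<close>.\<close>

lemma maximizer_Euler_Lagrange:
  assumes h: "continuous_on {0..T} h" and nn: "\<And>t. t \<in> {0..T} \<Longrightarrow> 0 \<le> h t" and h1: "Lp_norm T p h = 1"
    and hS: "Lp_norm T q (green T h) = Smax T p q" and t: "t \<in> {0..T}"
  shows "h t = (green T (\<lambda>t. green T h t powr (q - 1)) t / Smax T p q powr q) powr (1 / (p - 1))"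
proof -
  define S where "S = Smax T p q"
  have S: "0 < S" unfolding S_def by (rule Smax_pos)
  note e = conjugate_exponent[OF p]
  define u where "u = green T h"
  have u: "continuous_on {0..T} u" unfolding u_def by (rule continuous_on_green[OF T h])
  have u0: "0 \<le> u x" if "x \<in> {0..T}" for x unfolding u_def by (rule green_nonneg[OF T h nn that])
  let ?g = "\<lambda>t. spow (q - 1) (u t)"
  have g: "continuous_on {0..T} ?g" using q u by (intro continuous_on_spow) auto
  define v where "v = green T ?g"
  have v: "continuous_on {0..T} v" unfolding v_def by (rule continuous_on_green[OF T g])
  have v0: "0 \<le> v x" if "x \<in> {0..T}" for x unfolding v_def
    by (rule green_nonneg[OF T g _ that]) (use u0 in \<open>auto simp: spow_simps\<close>)
  define m where "m = Lp_norm T (p / (p - 1)) v"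
  have hv: "integral {0..T} (\<lambda>t. h t * v t) = S powr q"
  proof -
    have "integral {0..T} (\<lambda>t. h t * v t) = integral {0..T} (\<lambda>t. u t * ?g t)"
      unfolding v_def u_def by (rule green_symmetric[symmetric, OF T _ h]) (use g in \<open>simp add: u_def\<close>)
    also have "\<dots> = S powr q"
      using Lp_norm_powr_continuous[OF u, of q] q hS by (simp add: spow_simps u_def S_def)
    finally show ?thesis .
  qed
  have "S powr q \<le> m" using Holder_continuous[OF p h v] h1 hv by (simp add: m_def)
  moreover have "0 < S powr q" using S by simp
  ultimately have m: "0 < m" by linarith
  define w where "w = (\<lambda>t. spow (1 / (p - 1)) (v t / m))"
  note step = power_iteration[OF u, folded v_def, folded m_def, OF m, folded w_def]
  have "m \<le> Lp_norm T q (green T w) * S powr (q - 1)"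
    using step(4) hS by (simp add: u_def S_def)
  also have "\<dots> \<le> S * S powr (q - 1)"
    unfolding S_def by (intro mult_right_mono Smax_upper) (use step in auto)
  also have "\<dots> = S powr q" using S by (simp add: powr_diff)
  finally have mS: "m = S powr q" using \<open>S powr q \<le> m\<close> by simp
  have "h t = (v t / m) powr (1 / (p - 1))"
  proof (rule Holder_eq_continuous[OF p T h _ nn _ _ _ _ t])
    show "continuous_on {0..T} (\<lambda>t. v t / m)" using m by (intro continuous_intros v) auto
    show "0 \<le> v t / m" if "t \<in> {0..T}" for t using v0[OF that] m by simp
    show "integral {0..T} (\<lambda>t. \<bar>h t\<bar> powr p) = 1"
      using Lp_norm_powr_continuous[OF h, of p] p h1 by simp
    have "integral {0..T} (\<lambda>t. \<bar>v t\<bar> powr (p / (p - 1))) = m powr (p / (p - 1))"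
      unfolding m_def by (rule Lp_norm_powr_continuous[symmetric, OF v]) (use e in auto)
    then show "integral {0..T} (\<lambda>t. \<bar>v t / m\<bar> powr (p / (p - 1))) = 1"
      using m by (simp add: powr_divide)
    show "integral {0..T} (\<lambda>t. h t * (v t / m)) = 1" using hv m mS by simp
  qed
  \<comment> \<open>\<open>v\<close> was formed with the signed power of \<open>u\<close>, which is
    the plain power on \<open>[0, T]\<close>; \<open>green\<close> sees its argument only through
    integrals over subintervals.\<close>
  moreover have "v t = green T (\<lambda>t. u t powr (q - 1)) t"
  proof -
    have "integral {0..s} ?g = integral {0..s} (\<lambda>t. u t powr (q - 1))" if "s \<in> {0..T}" for s
      by (rule integral_cong) (use that u0 in \<open>auto simp: spow_simps\<close>)
    then have "prim ?g s = prim (\<lambda>t. u t powr (q - 1)) s" if "s \<in> {0..T}" for s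
      using that by (simp add: prim_def)
    then have "prim (prim ?g) s = prim (prim (\<lambda>t. u t powr (q - 1))) s" if "s \<in> {0..T}" for s
      unfolding prim_def[of "prim ?g"] prim_def[of "prim (\<lambda>t. u t powr (q - 1))"] using that
      by (intro integral_cong) auto
    then show ?thesis using t T by (simp add: v_def green_def)
  qed
  ultimately show ?thesis by (simp add: mS S_def u_def)
qed

end

section \<open>The first spectral couple\<close>

lemma spow_spow: "0 < r \<Longrightarrow> 0 < s \<Longrightarrow> spow s (spow r x) = spow (r * s) x"
  by (auto simp: spow_def sgn_if powr_powr)

lemma spow_one: "spow 1 x = x"
  by (auto simp: spow_def sgn_if)

lemma spow_mult: "0 \<le> c \<Longrightarrow> spow r (c * x) = c powr r * spow r x"
  by (auto simp: spow_def sgn_if powr_mult abs_mult zero_less_mult_iff)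

lemma C1_on_has_derivative:
  assumes "C1_on T f" "t \<in> {0..T}"
  shows "(f has_real_derivative deriv_on T f t) (at t within {0..T})"
  using assms
  by (auto simp: C1_on_def differentiable_on_def deriv_on_def has_real_derivative_iff_has_vector_derivative
      vector_derivative_works[symmetric])

text \<open>Derivatives within \<open>{0..T}\<close> see only values there, so the nested uses of
  \<open>deriv_on\<close> in \<open>eigenpair\<close> can be computed one by one from explicit
  functions that agree on the interval.\<close>

lemma deriv_on_eqI:
  assumes "0 < T" "t \<in> {0..T}" "(g has_real_derivative d) (at t within {0..T})"
    and "\<And>s. s \<in> {0..T} \<Longrightarrow> f s = g s"
  shows "(f has_real_derivative d) (at t within {0..T})" "deriv_on T f t = d"
proof -
  show 1: "(f has_real_derivative d) (at t within {0..T})"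
    using has_field_derivative_transform_within[OF assms(3) zero_less_one assms(2)] assms(4) by auto
  show "deriv_on T f t = d"
    unfolding deriv_on_def using vector_derivative_within_cbox[of 0 T t f d] 1 assms(1,2)
    by (simp add: has_real_derivative_iff_has_vector_derivative)
qed

lemma C1_onI:
  assumes "0 < T" "\<And>t. t \<in> {0..T} \<Longrightarrow> (g has_real_derivative g' t) (at t within {0..T})"
    and "continuous_on {0..T} g'" "\<And>s. s \<in> {0..T} \<Longrightarrow> f s = g s"
  shows "C1_on T f"
  unfolding C1_on_def
proof
  note d = deriv_on_eqI[OF assms(1) _ assms(2) assms(4)]
  show "f differentiable_on {0..T}"
    unfolding differentiable_on_def using d(1) real_differentiable_def by blast
  show "continuous_on {0..T} (deriv_on T f)"
    using assms(3) by (rule continuous_on_eq) (rule d(2)[symmetric])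
qed

text \<open>Certifies a couple from explicitly named derivatives. \<open>f\<close> is kept apart
  from \<open>u\<close> because the spectral function is extended by zero, while \<open>u\<close>
  may be any formula valid on the interval.\<close>

lemma is_first_spectral_coupleI:
  assumes T: "0 < T"
    and u: "\<And>t. t \<in> {0..T} \<Longrightarrow> (u has_real_derivative u' t) (at t within {0..T})"
      "\<And>t. t \<in> {0..T} \<Longrightarrow> (u' has_real_derivative u'' t) (at t within {0..T})"
    and cu: "continuous_on {0..T} u''"
    and w: "\<And>t. t \<in> {0..T} \<Longrightarrow> spow (p - 1) (u'' t) = w t"
      "\<And>t. t \<in> {0..T} \<Longrightarrow> (w has_real_derivative w' t) (at t within {0..T})"
      "\<And>t. t \<in> {0..T} \<Longrightarrow> (w' has_real_derivative lam * spow (q - 1) (u t)) (at t within {0..T})"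
    and b: "u 0 = 0" "u T = 0" "u'' 0 = 0" "u'' T = 0"
    and pos: "\<And>t. t \<in> {0<..<T} \<Longrightarrow> 0 < u t" "0 < lam" "0 < u' 0"
    and N: "Lp_norm T p u'' = 1" and f: "\<And>t. t \<in> {0..T} \<Longrightarrow> f t = u t" and q: "1 < q"
  shows "is_first_spectral_couple p q T f lam"
proof -
  define f1 where "f1 = deriv_on T f"
  define f2 where "f2 = deriv_on T f1"
  define W where "W = (\<lambda>t. spow (p - 1) (f2 t))"
  define W1 where "W1 = deriv_on T W"
  have f1: "f1 t = u' t" if "t \<in> {0..T}" for t
    unfolding f1_def by (rule deriv_on_eqI[OF T that u(1) f]) (use that in auto)
  have f2: "f2 t = u'' t" if "t \<in> {0..T}" for t
    unfolding f2_def by (rule deriv_on_eqI[OF T that u(2) f1]) (use that in auto)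
  have W: "W t = w t" if "t \<in> {0..T}" for t
    unfolding W_def using w(1) f2 that by auto
  have W1: "W1 t = w' t" if "t \<in> {0..T}" for t
    unfolding W1_def by (rule deriv_on_eqI[OF T that w(2) W]) (use that in auto)
  have W2: "deriv_on T W1 t = lam * spow (q - 1) (f t)" if "t \<in> {0..T}" for t
    using deriv_on_eqI(2)[OF T that w(3) W1] that f by auto
  have "continuous_on {0..T} u" "continuous_on {0..T} u'" "continuous_on {0..T} w'"
    by (rule DERIV_continuous_on, erule u w)+
  note c = this
  have "continuous_on {0..T} (\<lambda>t. lam * spow (q - 1) (u t))"
    by (intro continuous_intros continuous_on_spow c) (use q in auto)
  then have "C1_on T W1" by (intro C1_onI[OF T w(3) _ W1])
  moreover have "C1_on T f" by (rule C1_onI[OF T u(1) c(2) f])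
  moreover have "C1_on T f1" by (rule C1_onI[OF T u(2) cu f1])
  moreover have "C1_on T W" by (rule C1_onI[OF T w(2) c(3) W])
  moreover have "Lp_norm T p f2 = Lp_norm T p u''" by (rule Lp_norm_cong) (simp add: f2)
  moreover have "f (T / 2) \<noteq> 0" using pos(1)[of "T / 2"] f[of "T / 2"] T by auto
  ultimately show ?thesis
    using W2 T b pos f f1[of 0] f2[of 0] f2[of T] N
    unfolding is_first_spectral_couple_def spectral_couple_def eigenpair_def Let_def
      f1_def[symmetric] f2_def[symmetric] W_def[symmetric] W1_def[symmetric]
    by (auto intro!: bexI[of _ "T / 2"] simp: less_le[of 0 "u _"])
qed

definition moment :: "real \<Rightarrow> real \<Rightarrow> (real \<Rightarrow> real) \<Rightarrow> real \<Rightarrow> real" where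
  "moment p T f = (\<lambda>t. spow (p - 1) (deriv_on T (deriv_on T f) t))"

text \<open>Zero-free with positive initial slope, \<open>f\<close> is positive. Then
  \<open>- w\<close> is concave with zero boundary values, hence positive, and signed powers become
  plain ones. Dividing by the slopes \<open>A\<close> and \<open>B\<close> produces the two
  coefficients.\<close>

lemma first_spectral_couple_shoot:
  assumes T: "0 < T" and p: "1 < p" and q: "1 < q" and F: "is_first_spectral_couple p q T f lam"
  defines "w \<equiv> moment p T f"
  defines "A \<equiv> deriv_on T f 0" and "B \<equiv> - deriv_on T w 0"
  shows "0 < A" "0 < B" "0 < lam" "Lp_norm T p (deriv_on T (deriv_on T f)) = 1" "f T = 0" "w T = 0"
    "shoot (1 / (p - 1)) (q - 1) (B powr (1 / (p - 1)) / A) (lam * A powr (q - 1) / B) T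
      (\<lambda>t. f t / A) (\<lambda>t. deriv_on T f t / A) (\<lambda>t. - w t / B) (\<lambda>t. - deriv_on T w t / B)"
    "\<And>t. t \<in> {0..T} \<Longrightarrow> deriv_on T (deriv_on T f) t = - ((- w t) powr (1 / (p - 1)))"
    "\<And>t. t \<in> {0..T} \<Longrightarrow> 0 \<le> - w t"
proof -
  define f1 where "f1 = deriv_on T f"
  define f2 where "f2 = deriv_on T f1"
  define w1 where "w1 = deriv_on T w"
  have w: "w = (\<lambda>t. spow (p - 1) (f2 t))" by (simp add: w_def moment_def f1_def f2_def)
  have C: "C1_on T f" "C1_on T f1" "C1_on T w" "C1_on T w1"
    and eq: "\<And>t. t \<in> {0..T} \<Longrightarrow> deriv_on T w1 t = lam * spow (q - 1) (f t)"
    and b: "f 0 = 0" "f T = 0" "f2 0 = 0" "f2 T = 0" and lam: "0 < lam"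
    and N: "Lp_norm T p f2 = 1" and A: "0 < f1 0" and nz: "\<And>t. t \<in> {0<..<T} \<Longrightarrow> f t \<noteq> 0"
    using F
    unfolding is_first_spectral_couple_def spectral_couple_def eigenpair_def Let_def
      f1_def[symmetric] f2_def[symmetric] w[symmetric] w1_def[symmetric]
    by auto
  have d: "(f has_real_derivative f1 t) (at t within {0..T})" "(f1 has_real_derivative f2 t) (at t within {0..T})"
    "(w has_real_derivative w1 t) (at t within {0..T})"
    "(w1 has_real_derivative lam * spow (q - 1) (f t)) (at t within {0..T})"
    if "t \<in> {0..T}" for t
    using C1_on_has_derivative[OF C(1) that] C1_on_has_derivative[OF C(2) that]
      C1_on_has_derivative[OF C(3) that] C1_on_has_derivative[OF C(4) that] eq[OF that]
    by (simp_all add: f1_def f2_def w1_def)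
  have cf: "continuous_on {0..T} f" by (rule DERIV_continuous_on) (rule d)
  \<comment> \<open>The slope at 0 makes \<open>f\<close> positive nearby; a negative value
    elsewhere would produce a zero by connectedness.\<close>
  have fpos: "0 < f t" if t: "t \<in> {0<..<T}" for t
  proof (rule ccontr)
    assume "\<not> 0 < f t"
    then have neg: "f t < 0" using nz[OF t] by linarith
    have "(f has_real_derivative f1 0) (at 0 within {0..T})" using d(1)[of 0] T by simp
    then have "((\<lambda>t. f t / t) \<longlongrightarrow> f1 0) (at_right 0)"
      using T b by (simp add: has_field_derivative_iff at_within_Icc_at_right)
    then have "\<forall>\<^sub>F t in at_right 0. 0 < f t / t" using A by (rule order_tendstoD)
    then obtain e where e: "0 < e" "\<And>t. 0 < t \<Longrightarrow> t < e \<Longrightarrow> 0 < f t / t"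
      by (auto simp: eventually_at_right_field)
    define s where "s = min e T / 2"
    have s: "0 < s" "s < e" "s < T" using e T by (auto simp: s_def)
    then have fs: "0 < f s" using e(2)[of s] by (auto simp: zero_less_divide_iff)
    have "connected (f ` {0<..<T})"
      by (intro connected_continuous_image continuous_on_subset[OF cf]) auto
    then have "0 \<in> f ` {0<..<T}"
      using connectedD_interval[of "f ` {0<..<T}" "f t" "f s" 0] neg fs t s by auto
    then show False using nz by auto
  qed
  have f0: "0 \<le> f t" if "t \<in> {0..T}" for t
    using fpos[of t] b that by (cases "t = 0 \<or> t = T") (auto simp: less_imp_le)
  have wb: "w 0 = 0" "w T = 0" using b by (auto simp: w spow_def)
  have dv: "((\<lambda>t. - w t) has_real_derivative - w1 t) (at t within {0..T})"
    "((\<lambda>t. - w1 t) has_real_derivative - (lam * f t powr (q - 1))) (at t within {0..T})"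
    if "t \<in> {0..T}" for t
    using DERIV_minus[OF d(3)[OF that]] DERIV_minus[OF d(4)[OF that]] f0[OF that] by (simp_all add: spow_simps)
  have vpos: "0 < - w t" if "t \<in> {0<..<T}" for t
    by (rule concave_Dirichlet_pos[OF dv, of "T / 2"])
       (use that T wb lam fpos[of "T / 2"] in \<open>auto intro!: mult_nonneg_nonneg\<close>)
  have v0: "0 \<le> - w t" if "t \<in> {0..T}" for t
    using vpos[of t] wb that by (cases "t = 0 \<or> t = T") (auto simp: less_imp_le)
  show "0 \<le> - w t" if "t \<in> {0..T}" for t by (rule v0[OF that])
  \<comment> \<open>The mean slope of \<open>- w\<close> over \<open>[0, T / 2]\<close> is positive,
    and slopes of a concave function decrease, so the slope at 0 is at least as large.\<close>
  have B: "0 < - w1 0"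
  proof -
    have T2: "0 < T / 2" "T / 2 \<le> T" using T by auto
    obtain \<xi> where \<xi>: "0 < \<xi>" "\<xi> < T / 2" "- w (T / 2) - - w 0 = - w1 \<xi> * (T / 2 - 0)"
      by (rule MVT_Icc[OF dv(1) order.refl T2])
    have "0 < - w1 \<xi> * (T / 2)" using \<xi>(3) vpos[of "T / 2"] T wb by simp
    then have "0 < - w1 \<xi>" using T by (simp add: zero_less_mult_iff mult_less_0_iff)
    moreover have "- w1 \<xi> \<le> - w1 0"
      by (rule concave_deriv_antimono[OF dv(2)]) (use lam \<xi> T in auto)
    ultimately show ?thesis by linarith
  qed
  have f2: "f2 t = - ((- w t) powr (1 / (p - 1)))" if "t \<in> {0..T}" for t
  proof -
    have "f2 t = spow (1 / (p - 1)) (w t)" using p by (simp add: w spow_spow spow_one)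
    also have "\<dots> = - spow (1 / (p - 1)) (- w t)" by (simp add: spow_simps)
    finally show ?thesis using spow_simps(2)[OF v0[OF that]] by simp
  qed
  have AB: "A = f1 0" "B = - w1 0" by (simp_all add: A_def B_def f1_def w1_def)
  show "0 < A" "0 < B" using A B AB by auto
  note AB0 = this
  show "0 < lam" "f T = 0" "w T = 0" by fact+
  show "Lp_norm T p (deriv_on T (deriv_on T f)) = 1" using N by (simp add: f1_def f2_def)
  show "deriv_on T (deriv_on T f) t = - ((- w t) powr (1 / (p - 1)))" if "t \<in> {0..T}" for t
    using f2[OF that] by (simp add: f1_def f2_def)
  have "shoot (1 / (p - 1)) (q - 1) (B powr (1 / (p - 1)) / A) (lam * A powr (q - 1) / B) T
      (\<lambda>t. f t / A) (\<lambda>t. f1 t / A) (\<lambda>t. - w t / B) (\<lambda>t. - w1 t / B)"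
    unfolding shoot_def
  proof (intro conjI ballI)
    fix t assume t: "t \<in> {0..T}"
    show "((\<lambda>t. f t / A) has_real_derivative f1 t / A) (at t within {0..T})"
      by (intro DERIV_cdivide d t)
    show "((\<lambda>t. - w t / B) has_real_derivative - w1 t / B) (at t within {0..T})"
      by (intro DERIV_cdivide dv t)
    have "f2 t / A = - (B powr (1 / (p - 1)) / A * (- w t / B) powr (1 / (p - 1)))"
      unfolding f2[OF t] powr_divide using AB0 by simp
    then show "((\<lambda>t. f1 t / A) has_real_derivative
        - (B powr (1 / (p - 1)) / A * (- w t / B) powr (1 / (p - 1)))) (at t within {0..T})"
      using DERIV_cdivide[OF d(2)[OF t], of A] by simp
    have "- (lam * f t powr (q - 1)) / B = - (lam * A powr (q - 1) / B * (f t / A) powr (q - 1))"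
      unfolding powr_divide using AB0 by simp
    note e = this
    show "((\<lambda>t. - w1 t / B) has_real_derivative
        - (lam * A powr (q - 1) / B * (f t / A) powr (q - 1))) (at t within {0..T})"
      unfolding e[symmetric] by (rule DERIV_cdivide[OF dv(2)[OF t]])
  qed (use T b wb AB AB0 fpos vpos in \<open>auto simp: divide_neg_neg\<close>)
  then show "shoot (1 / (p - 1)) (q - 1) (B powr (1 / (p - 1)) / A) (lam * A powr (q - 1) / B) T
      (\<lambda>t. f t / A) (\<lambda>t. deriv_on T f t / A) (\<lambda>t. - w t / B) (\<lambda>t. - deriv_on T w t / B)"
    by (simp add: f1_def w1_def)
qed

text \<open>Since the shooting solutions coincide, the couples agree up to the slopes
  \<open>A\<close> and \<open>B\<close>. The normalization of \<open>u''\<close> fixes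
  \<open>A\<close>, the first coefficient then fixes \<open>B\<close>, and the second fixes the
  eigenvalue.\<close>

lemma first_spectral_couple_unique:
  assumes T: "0 < T" and p: "1 < p" and q: "1 < q"
    and 1: "is_first_spectral_couple p q T f1 l1" and 2: "is_first_spectral_couple p q T f2 l2"
  shows "l1 = l2" "\<And>t. t \<in> {0..T} \<Longrightarrow> f1 t = f2 t"
proof -
  define w where "w = moment p T"
  define A where "A f = deriv_on T f 0" for f
  define B where "B f = - deriv_on T (w f) 0" for f
  note s1 = first_spectral_couple_shoot[OF T p q 1, folded w_def, folded B_def, folded A_def]
  note s2 = first_spectral_couple_shoot[OF T p q 2, folded w_def, folded B_def, folded A_def]
  have par: "0 < 1 / (p - 1)" "0 < q - 1" using p q by auto
  have "B f1 powr (1 / (p - 1)) / A f1 = B f2 powr (1 / (p - 1)) / A f2 \<and>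
      l1 * A f1 powr (q - 1) / B f1 = l2 * A f2 powr (q - 1) / B f2 \<and>
      (\<forall>t\<in>{0..T}. f1 t / A f1 = f2 t / A f2 \<and> - w f1 t / B f1 = - w f2 t / B f2)"
    by (rule shoot_dirichlet_unique[OF s1(7) s2(7)]) (use par s1 s2 in auto)
  then have a: "B f1 powr (1 / (p - 1)) / A f1 = B f2 powr (1 / (p - 1)) / A f2"
    and l: "l1 * A f1 powr (q - 1) / B f1 = l2 * A f2 powr (q - 1) / B f2"
    and f: "\<And>t. t \<in> {0..T} \<Longrightarrow> f1 t / A f1 = f2 t / A f2"
    and v: "\<And>t. t \<in> {0..T} \<Longrightarrow> - w f1 t / B f1 = - w f2 t / B f2"
    by blast+
  have d: "deriv_on T (deriv_on T f1) t = A f1 / A f2 * deriv_on T (deriv_on T f2) t" if t: "t \<in> {0..T}" for t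
  proof -
    \<comment> \<open>\<open>f''\<close> is expressed through the normalized \<open>v\<close>, which
      both couples share; equality of the first coefficients then turns the prefactors into the
      ratio \<open>A f1 / A f2\<close>.\<close>
    have rep: "deriv_on T (deriv_on T f) t = - (B f powr (1 / (p - 1)) * (- w f t / B f) powr (1 / (p - 1)))"
      if "0 < B f" "deriv_on T (deriv_on T f) t = - ((- w f t) powr (1 / (p - 1)))" for f
      using that unfolding powr_divide by simp
    have "B f1 powr (1 / (p - 1)) = A f1 / A f2 * B f2 powr (1 / (p - 1))"
      using a s1(1) s2(1) by (simp add: field_simps)
    then show ?thesis
      unfolding rep[OF s1(2) s1(8)[OF t]] rep[OF s2(2) s2(8)[OF t]] v[OF t] by simp
  qed
  have "Lp_norm T p (deriv_on T (deriv_on T f1)) = Lp_norm T p (\<lambda>t. A f1 / A f2 * deriv_on T (deriv_on T f2) t)"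
    by (rule Lp_norm_cong) (simp add: d)
  also have "\<dots> = \<bar>A f1 / A f2\<bar> * Lp_norm T p (deriv_on T (deriv_on T f2))"
    using p by (intro Lp_norm_scale) auto
  finally have A: "A f1 = A f2" using s1 s2 by simp
  show "f1 t = f2 t" if "t \<in> {0..T}" for t using f[OF that] A s1 s2 by simp
  have "B f1 powr (1 / (p - 1)) = B f2 powr (1 / (p - 1))" using a A s1 s2 by simp
  then have "(B f1 powr (1 / (p - 1))) powr (p - 1) = (B f2 powr (1 / (p - 1))) powr (p - 1)" by simp
  then have "B f1 = B f2" using p s1 s2 by (simp add: powr_powr)
  then show "l1 = l2" using l A s1 s2 by simp
qed

text \<open>The factor \<open>T powr (2 - 1 / p)\<close> gives \<open>u''\<close> the factor
  \<open>T powr (- 1 / p)\<close>, which preserves its norm. Then \<open>w\<close> scales by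
  \<open>T powr (- (1 - 1 / p))\<close>, its second derivative carries two powers of
  \<open>T\<close> less, and comparison with the power \<open>q - 1\<close> of \<open>u\<close>
  yields the exponent of \<open>lam\<close>.\<close>

lemma first_spectral_couple_scale:
  assumes T: "0 < T" and p: "1 < p" and q: "1 < q" and F: "is_first_spectral_couple p q 1 f lam"
  shows "is_first_spectral_couple p q T (\<lambda>t. T powr (2 - 1 / p) * f (t / T)) (T powr (q / p - 1 - 2 * q) * lam)"
proof -
  define f1 where "f1 = deriv_on 1 f"
  define f2 where "f2 = deriv_on 1 f1"
  define w where "w = (\<lambda>t. spow (p - 1) (f2 t))"
  define w1 where "w1 = deriv_on 1 w"
  have C: "C1_on 1 f" "C1_on 1 f1" "C1_on 1 w" "C1_on 1 w1"
    and eq: "\<And>t. t \<in> {0..1} \<Longrightarrow> deriv_on 1 w1 t = lam * spow (q - 1) (f t)"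
    and b: "f 0 = 0" "f 1 = 0" "f2 0 = 0" "f2 1 = 0" and lam: "0 < lam"
    and N: "Lp_norm 1 p f2 = 1" and A: "0 < f1 0"
    using F
    unfolding is_first_spectral_couple_def spectral_couple_def eigenpair_def Let_def
      f1_def[symmetric] f2_def[symmetric] w_def[symmetric] w1_def[symmetric]
    by auto
  have s: "0 < f t" if "t \<in> {0<..<1}" for t
  proof -
    have "0 < f t / deriv_on 1 f 0"
      using first_spectral_couple_shoot(7)[OF _ p q F] that unfolding shoot_def by simp
    then show ?thesis using A by (simp add: f1_def zero_less_divide_iff)
  qed
  have d: "(f has_real_derivative f1 t) (at t within {0..1})" "(f1 has_real_derivative f2 t) (at t within {0..1})"
    "(w has_real_derivative w1 t) (at t within {0..1})"
    "(w1 has_real_derivative lam * spow (q - 1) (f t)) (at t within {0..1})"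
    if "t \<in> {0..1}" for t
    using C1_on_has_derivative[OF C(1) that] C1_on_has_derivative[OF C(2) that]
      C1_on_has_derivative[OF C(3) that] C1_on_has_derivative[OF C(4) that] eq[OF that]
    by (simp_all add: f1_def f2_def w1_def)
  have cf2: "continuous_on {0..1} f2" using C(2) by (simp add: C1_on_def f2_def)
  have img: "(\<lambda>t. t / T) ` {0..T} \<subseteq> {0..1}" using T by auto
  have tT: "t / T \<in> {0..1}" if "t \<in> {0..T}" for t using img that by blast
  have ch: "((\<lambda>t. c * k (t / T)) has_real_derivative c / T * k' (t / T)) (at t within {0..T})"
    if "\<And>t. t \<in> {0..1} \<Longrightarrow> (k has_real_derivative k' t) (at t within {0..1})" "t \<in> {0..T}" for k k' c t
  proof -
    have "((\<lambda>t. t / T) has_real_derivative 1 / T) (at t within {0..T})"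
      by (intro DERIV_cdivide DERIV_ident)
    from DERIV_image_chain[OF DERIV_subset[OF that(1)[OF tT[OF that(2)]] img] this]
    have "((\<lambda>t. k (t / T)) has_real_derivative k' (t / T) * (1 / T)) (at t within {0..T})"
      by (simp add: o_def)
    from DERIV_cmult[OF this, of c] show ?thesis by simp
  qed
  have Tp: "T powr a / T = T powr (a - 1)" for a using T by (simp add: powr_diff)
  define a where "a = 2 - 1 / p"
  let ?l = "T powr (q / p - 1 - 2 * q) * lam"
  let ?c = "T powr (- (1 - 1 / p))"
  have cw: "spow (p - 1) (T powr (a - 2) * f2 x) = ?c * w x" for x
  proof -
    have "(a - 2) * (p - 1) = - (1 - 1 / p)" using p by (simp add: a_def field_simps)
    then show ?thesis by (simp add: spow_mult powr_powr w_def)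
  qed
  have cl: "T powr (- (1 - 1 / p) - 2) * (lam * spow (q - 1) x) = ?l * spow (q - 1) (T powr a * x)" for x
  proof -
    have "q / p - 1 - 2 * q + a * (q - 1) = - (1 - 1 / p) - 2" using p by (simp add: a_def field_simps)
    then have "T powr (q / p - 1 - 2 * q) * T powr (a * (q - 1)) = T powr (- (1 - 1 / p) - 2)"
      by (metis powr_add)
    then show ?thesis by (simp add: spow_mult powr_powr)
  qed
  show ?thesis unfolding a_def[symmetric]
  proof (rule is_first_spectral_coupleI[where u = "\<lambda>t. T powr a * f (t / T)" and u' = "\<lambda>t. T powr (a - 1) * f1 (t / T)"
        and u'' = "\<lambda>t. T powr (a - 2) * f2 (t / T)" and w = "\<lambda>t. ?c * w (t / T)"
        and w' = "\<lambda>t. T powr (- (1 - 1 / p) - 1) * w1 (t / T)"])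
    fix t assume t: "t \<in> {0..T}"
    show "((\<lambda>t. T powr a * f (t / T)) has_real_derivative T powr (a - 1) * f1 (t / T)) (at t within {0..T})"
      using ch[OF d(1) t, of "T powr a"] by (simp add: Tp)
    show "((\<lambda>t. T powr (a - 1) * f1 (t / T)) has_real_derivative T powr (a - 2) * f2 (t / T)) (at t within {0..T})"
      using ch[OF d(2) t, of "T powr (a - 1)"] by (simp add: Tp)
    show "((\<lambda>t. ?c * w (t / T)) has_real_derivative T powr (- (1 - 1 / p) - 1) * w1 (t / T)) (at t within {0..T})"
      using ch[OF d(3) t, of ?c] unfolding Tp .
    have "- (1 - 1 / p) - 1 - 1 = - (1 - 1 / p) - 2" by simp
    then show "((\<lambda>t. T powr (- (1 - 1 / p) - 1) * w1 (t / T)) has_real_derivative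
        ?l * spow (q - 1) (T powr a * f (t / T))) (at t within {0..T})"
      using ch[OF d(4) t, of "T powr (- (1 - 1 / p) - 1)"] unfolding Tp by (simp only: cl)
    show "spow (p - 1) (T powr (a - 2) * f2 (t / T)) = ?c * w (t / T)" by (rule cw)
  next
    show c2: "continuous_on {0..T} (\<lambda>t. T powr (a - 2) * f2 (t / T))"
      by (intro continuous_intros continuous_on_compose2[OF cf2]) (use T in auto)
    have cp: "continuous_on {0..1} (\<lambda>t. \<bar>f2 t\<bar> powr p)" using cf2 p by (intro continuous_on_abs_powr) auto
    have "(a - 2) * p = - 1" using p by (simp add: a_def)
    then have e: "\<bar>T powr (a - 2) * x\<bar> powr p = 1 / T * \<bar>x\<bar> powr p" for x
      using T by (simp add: abs_mult powr_mult powr_powr powr_minus_divide)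
    have "((\<lambda>t. \<bar>T powr (a - 2) * f2 (t / T)\<bar> powr p) has_integral
        integral {0..T / T} (\<lambda>t. \<bar>f2 t\<bar> powr p) - integral {0..0 / T} (\<lambda>t. \<bar>f2 t\<bar> powr p)) {0..T}"
      unfolding e
    proof (rule fundamental_theorem_of_calculus)
      show "((\<lambda>x. integral {0..x / T} (\<lambda>t. \<bar>f2 t\<bar> powr p)) has_vector_derivative 1 / T * \<bar>f2 (x / T)\<bar> powr p)
          (at x within {0..T})" if "x \<in> {0..T}" for x
        using ch[OF integral_has_real_derivative[OF cp] that, of 1]
        by (simp add: has_real_derivative_iff_has_vector_derivative)
    qed (use T in auto)
    then have "integral {0..T} (\<lambda>t. \<bar>T powr (a - 2) * f2 (t / T)\<bar> powr p) = integral {0..1} (\<lambda>t. \<bar>f2 t\<bar> powr p)"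
      using T by (simp add: has_integral_iff)
    then show "Lp_norm T p (\<lambda>t. T powr (a - 2) * f2 (t / T)) = 1"
      using N p by (simp add: Lp_norm_continuous[OF c2] Lp_norm_continuous[OF cf2])
  qed (use T b lam A q s in auto)
qed

text \<open>For \<open>u = green T h\<close> the second derivative is \<open>- h\<close>, and by the
  Euler-Lagrange identity its signed power is \<open>- green T g / S powr q\<close>; two more
  derivatives give the equation. The end conditions on \<open>u''\<close> are natural ones:
  \<open>h\<close> vanishes there because \<open>green T g\<close> does.\<close>

lemma first_spectral_couple_exists:
  assumes T: "0 < T" and p: "1 < p" and q: "1 < q"
  obtains h where "continuous_on {0..T} h" "Lp_norm T p h = 1" "Lp_norm T q (green T h) = Smax T p q"
    "is_first_spectral_couple p q T (\<lambda>t. if t \<in> {0..T} then green T h t else 0) (Smax T p q powr (- q))"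
proof -
  define S where "S = Smax T p q"
  have S: "0 < S" unfolding S_def by (rule Smax_pos[OF T p q])
  obtain h where h: "continuous_on {0..T} h" "\<And>t. t \<in> {0..T} \<Longrightarrow> 0 \<le> h t" "Lp_norm T p h = 1"
    "Lp_norm T q (green T h) = S"
    unfolding S_def by (rule exists_maximizer[OF T p q]) blast
  define g where "g = (\<lambda>t. green T h t powr (q - 1))"
  have u: "continuous_on {0..T} (green T h)" by (rule continuous_on_green[OF T h(1)])
  have u0: "0 \<le> green T h t" if "t \<in> {0..T}" for t by (rule green_nonneg[OF T h(1,2) that])
  have g: "continuous_on {0..T} g" unfolding g_def using q u u0
    by (intro continuous_on_powr') (auto intro!: continuous_intros)
  have EL: "h t = (green T g t / S powr q) powr (1 / (p - 1))" if "t \<in> {0..T}" for t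
    unfolding g_def S_def
    by (rule maximizer_Euler_Lagrange[OF T p q h(1,2,3) _ that]) (use h(4) in \<open>auto simp: S_def\<close>)
  have v0: "0 \<le> green T g t" if "t \<in> {0..T}" for t by (rule green_nonneg[OF T g _ that]) (simp add: g_def)
  \<comment> \<open>If \<open>h\<close> vanished inside, continuity would make it vanish on
    \<open>[0, T]\<close>, against norm 1. The point \<open>x\<close> feeds the strong maximum
    principle.\<close>
  obtain x where x: "x \<in> {0<..<T}" "h x \<noteq> 0"
  proof -
    have "\<exists>x\<in>{0<..<T}. h x \<noteq> 0"
    proof (rule ccontr)
      assume "\<not> ?thesis"
      then have "h t = 0" if "t \<in> {0..T}" for t
        using continuous_constant_on_closure[of "{0<..<T}" h 0 t] h(1) T that by auto
      then have "Lp_norm T p h = Lp_norm T p (\<lambda>_. 0)" by (intro Lp_norm_cong) auto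
      with h(3) show False by (simp add: Lp_norm_def)
    qed
    then show thesis using that by blast
  qed
  have upos: "0 < green T h t" if "t \<in> {0<..<T}" for t by (rule green_pos[OF T h(1,2) x that])
  have "is_first_spectral_couple p q T (\<lambda>t. if t \<in> {0..T} then green T h t else 0) (S powr (- q))"
  proof (rule is_first_spectral_coupleI[OF T green_has_derivative[OF T h(1)] green'_has_derivative[OF T h(1)],
        where w = "\<lambda>t. - (green T g t / S powr q)" and w' = "\<lambda>t. - (green' T g t / S powr q)"])
    fix t assume t: "t \<in> {0..T}"
    show "((\<lambda>t. - (green T g t / S powr q)) has_real_derivative - (green' T g t / S powr q)) (at t within {0..T})"
      by (intro DERIV_minus DERIV_cdivide green_has_derivative[OF T g] t)
    have "((\<lambda>t. - (green' T g t / S powr q)) has_real_derivative - (- g t / S powr q)) (at t within {0..T})"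
      by (intro DERIV_minus DERIV_cdivide green'_has_derivative[OF T g] t)
    then show "((\<lambda>t. - (green' T g t / S powr q)) has_real_derivative S powr (- q) * spow (q - 1) (green T h t)) (at t within {0..T})"
      using u0[OF t] by (simp add: g_def spow_simps powr_minus_divide)
    show "spow (p - 1) (- h t) = - (green T g t / S powr q)"
      using v0[OF t] S p by (simp add: spow_simps EL[OF t] powr_powr)
  next
    show "0 < green' T h 0"
    proof -
      have T2: "0 < T / 2" "T / 2 \<le> T" using T by auto
      obtain \<xi> where \<xi>: "0 < \<xi>" "\<xi> < T / 2" "green T h (T / 2) - green T h 0 = green' T h \<xi> * (T / 2 - 0)"
        by (rule MVT_Icc[OF green_has_derivative[OF T h(1)] order.refl T2])
      have "0 < green' T h \<xi> * (T / 2)" using \<xi>(3) upos[of "T / 2"] T green_boundary[OF T h(1)] by simp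
      then have "0 < green' T h \<xi>" using T by (simp add: zero_less_mult_iff)
      moreover have "green' T h \<xi> \<le> green' T h 0"
        by (rule concave_deriv_antimono[OF green'_has_derivative[OF T h(1)]]) (use h \<xi> T in auto)
      ultimately show ?thesis by linarith
    qed
    show "continuous_on {0..T} (\<lambda>t. - h t)" by (intro continuous_intros h)
    show "Lp_norm T p (\<lambda>t. - h t) = 1" using h(3) by (simp add: Lp_norm_def)
    show "green T h 0 = 0" "green T h T = 0" using green_boundary[OF T h(1)] by auto
    show "- h 0 = 0" "- h T = 0" using EL[of 0] EL[of T] T green_boundary[OF T g] by auto
  qed (use S upos q in auto)
  then show thesis unfolding S_def by (rule that[OF h(1,3) h(4)[unfolded S_def]])
qed

text \<open>Existence and uniqueness resolve the definite description: uniqueness gives equality on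
  \<open>[0, T]\<close>, and extension by zero supplies the rest.\<close>

lemma first_spectral_couple_eq:
  assumes T: "0 < T" and p: "1 < p" and q: "1 < q"
  obtains h where "continuous_on {0..T} h" "Lp_norm T p h = 1" "Lp_norm T q (green T h) = Smax T p q"
    "\<And>t. t \<in> {0..T} \<Longrightarrow> SN1 p q T t = green T h t" "sn1 p q T = Smax T p q powr (- q)"
    "is_first_spectral_couple p q T (SN1 p q T) (sn1 p q T)"
proof -
  obtain h where h: "continuous_on {0..T} h" "Lp_norm T p h = 1" "Lp_norm T q (green T h) = Smax T p q"
    "is_first_spectral_couple p q T (\<lambda>t. if t \<in> {0..T} then green T h t else 0) (Smax T p q powr (- q))"
    by (rule first_spectral_couple_exists[OF T p q])
  let ?f = "\<lambda>t. if t \<in> {0..T} then green T h t else 0"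
  have "first_spectral_couple p q T = (?f, Smax T p q powr (- q))"
    unfolding first_spectral_couple_def
  proof (rule the_equality)
    fix c assume c: "is_first_spectral_couple p q T (fst c) (snd c) \<and> (\<forall>t. t \<notin> {0..T} \<longrightarrow> fst c t = 0)"
    note eq = first_spectral_couple_unique[OF T p q conjunct1[OF c] h(4)]
    have "fst c = ?f"
    proof
      fix t show "fst c t = ?f t" using eq(2)[of t] c by (cases "t \<in> {0..T}") auto
    qed
    with eq(1) show "c = (?f, Smax T p q powr (- q))" by (simp add: prod_eq_iff)
  qed (use h(4) in auto)
  then have "SN1 p q T = ?f" "sn1 p q T = Smax T p q powr (- q)" by (simp_all add: SN1_def sn1_def)
  then show thesis using h by (intro that[of h]) simp_all
qed

lemma sn1_scale:
  assumes T: "0 < T" and p: "1 < p" and q: "1 < q"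
  shows "sn1 p q T = T powr (q / p - 1 - 2 * q) * lambda1 p q"
proof -
  have "is_first_spectral_couple p q 1 (SN1 p q 1) (sn1 p q 1)"
    by (rule first_spectral_couple_eq[OF zero_less_one p q])
  from first_spectral_couple_scale[OF T p q this]
  have 1: "is_first_spectral_couple p q T (\<lambda>t. T powr (2 - 1 / p) * SN1 p q 1 (t / T)) (T powr (q / p - 1 - 2 * q) * sn1 p q 1)" .
  have 2: "is_first_spectral_couple p q T (SN1 p q T) (sn1 p q T)"
    by (rule first_spectral_couple_eq[OF T p q])
  show ?thesis using first_spectral_couple_unique(1)[OF T p q 2 1] by (simp add: lambda1_def)
qed

section \<open>Test functions\<close>

text \<open>For the two end points of the support of \<open>bump\<close>, where different formulas
  meet.\<close>

lemma has_derivative_zero_if_quadratic: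
  fixes f :: "real \<Rightarrow> real"
  assumes "\<And>x. \<bar>f x\<bar> \<le> K * (x - c)\<^sup>2"
  shows "(f has_real_derivative 0) (at c)"
proof -
  have fc: "f c = 0" using assms[of c] by simp
  have "((\<lambda>x. K * \<bar>x - c\<bar>) \<longlongrightarrow> K * \<bar>c - c\<bar>) (at c)" by (intro tendsto_intros)
  then have lim: "((\<lambda>x. K * \<bar>x - c\<bar>) \<longlongrightarrow> 0) (at c)" by simp
  have "((\<lambda>x. (f x - f c) / (x - c)) \<longlongrightarrow> 0) (at c)"
  proof (rule Lim_null_comparison[OF _ lim])
    have "norm ((f x - f c) / (x - c)) \<le> K * \<bar>x - c\<bar>" if "x \<noteq> c" for x
    proof -
      have "\<bar>f x\<bar> \<le> (K * \<bar>x - c\<bar>) * \<bar>x - c\<bar>" using assms[of x]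
        by (simp add: power2_eq_square mult.assoc abs_mult_self_eq)
      then show ?thesis using that fc by (simp add: abs_divide pos_divide_le_eq)
    qed
    then show "\<forall>\<^sub>F x in at c. norm ((f x - f c) / (x - c)) \<le> K * \<bar>x - c\<bar>"
      by (auto simp: eventually_at_filter)
  qed
  then show ?thesis by (simp add: has_field_derivative_iff)
qed

text \<open>The functions \<open>P r\<^sup>-\<^sup>k exp (- c / r)\<close> with \<open>r = (x - a) (b - x)\<close>, extended by zero, are closed
  under differentiation.\<close>

definition bump :: "real \<Rightarrow> real \<Rightarrow> real \<Rightarrow> real poly \<Rightarrow> nat \<Rightarrow> real \<Rightarrow> real" where
  "bump a b c P k x = (if a < x \<and> x < b
     then poly P x / ((x - a) * (b - x)) ^ k * exp (- c / ((x - a) * (b - x))) else 0)"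

text \<open>The inequality \<open>(1 + y / m) ^ m \<le> exp y\<close> at \<open>y = c / r\<close>
  bounds \<open>exp (- c / r)\<close> by a multiple of \<open>r ^ m\<close>. With
  \<open>m = k + 2\<close> this absorbs the denominator \<open>r ^ k\<close> and leaves
  \<open>r\<^sup>2\<close>, which is at most \<open>(b - a)\<^sup>2\<close> times the squared
  distance to either end.\<close>

lemma bump_bound:
  assumes c: "0 < c" and ab: "a < b"
  obtains K where "0 \<le> K" "\<And>x. \<bar>bump a b c P k x\<bar> \<le> K * (x - a)\<^sup>2" "\<And>x. \<bar>bump a b c P k x\<bar> \<le> K * (x - b)\<^sup>2"
proof -
  have "bounded (poly P ` {a..b})"
    by (intro compact_imp_bounded compact_continuous_image continuous_intros) auto
  then obtain M where M: "\<forall>x\<in>{a..b}. \<bar>poly P x\<bar> \<le> M" by (auto simp: bounded_real)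
  have M0: "0 \<le> M" using M[rule_format, of a] ab by auto
  define m where "m = k + 2"
  define K where "K = M * (real m / c) ^ m * (b - a)\<^sup>2"
  have K0: "0 \<le> K" using M0 c by (simp add: K_def)
  have main: "\<bar>bump a b c P k x\<bar> \<le> M * (real m / c) ^ m * ((x - a) * (b - x))\<^sup>2" if x: "a < x" "x < b" for x
  proof -
    define r where "r = (x - a) * (b - x)"
    have r: "0 < r" using x by (simp add: r_def)
    have "(1 + (c / r) / real m) ^ m \<le> exp (c / r)"
      using c r by (intro exp_ge_one_plus_x_over_n_power_n) (auto simp: m_def intro: order_trans[of _ 0])
    moreover have "((c / r) / real m) ^ m \<le> (1 + (c / r) / real m) ^ m"
      using c r by (intro power_mono) auto
    ultimately have "((c / r) / real m) ^ m \<le> exp (c / r)" by linarith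
    moreover have "0 < ((c / r) / real m) ^ m" using c r by (simp add: m_def)
    ultimately have "inverse (exp (c / r)) \<le> inverse (((c / r) / real m) ^ m)"
      by (intro le_imp_inverse_le)
    also have "\<dots> = (real m / c) ^ m * r ^ m"
      using c r by (simp add: power_divide power_mult_distrib field_simps)
    finally have e: "exp (- c / r) \<le> (real m / c) ^ m * r ^ m" by (simp add: exp_minus)
    have "\<bar>bump a b c P k x\<bar> = \<bar>poly P x\<bar> / r ^ k * exp (- c / r)"
      using x r by (simp add: bump_def r_def[symmetric] abs_mult)
    also have "\<dots> \<le> M / r ^ k * ((real m / c) ^ m * r ^ m)"
      using r e M[rule_format, of x] x M0 by (intro mult_mono divide_right_mono) auto
    also have "\<dots> = M * (real m / c) ^ m * r\<^sup>2"
      using r by (simp add: m_def power_add power2_eq_square)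
    finally show ?thesis by (simp add: r_def)
  qed
  show thesis
  proof (rule that[OF K0])
    have pos: "0 \<le> M * (real m / c) ^ m" using M0 c by simp
    show "\<bar>bump a b c P k x\<bar> \<le> K * (x - a)\<^sup>2" for x
    proof (cases "a < x \<and> x < b")
      case True
      have "((x - a) * (b - x))\<^sup>2 \<le> ((x - a) * (b - a))\<^sup>2" using True by (intro power_mono mult_left_mono) auto
      with main[of x] True mult_left_mono[OF this pos] show ?thesis by (simp add: K_def power_mult_distrib mult_ac)
    qed (use K0 in \<open>auto simp: bump_def\<close>)
    show "\<bar>bump a b c P k x\<bar> \<le> K * (x - b)\<^sup>2" for x
    proof (cases "a < x \<and> x < b")
      case True
      have "((x - a) * (b - x))\<^sup>2 \<le> ((b - a) * (b - x))\<^sup>2" using True by (intro power_mono mult_right_mono) auto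
      with main[of x] True mult_left_mono[OF this pos] show ?thesis
        by (simp add: K_def power_mult_distrib mult_ac power2_commute)
    qed (use K0 in \<open>auto simp: bump_def\<close>)
  qed
qed

text \<open>The three terms differentiate \<open>P\<close>, the denominator \<open>r ^ k\<close> and
  the exponential, brought to the common denominator \<open>r ^ (k + 2)\<close>. At \<open>a\<close>
  and \<open>b\<close> the quadratic bound gives derivative 0.\<close>

lemma bump_has_derivative:
  assumes c: "0 < c" and ab: "a < b"
  defines "r \<equiv> [:- a * b, a + b, - 1:]"
  shows "(bump a b c P k has_real_derivative
    bump a b c (pderiv P * r\<^sup>2 - smult (real k) (P * r * pderiv r) + smult c (P * pderiv r)) (k + 2) x) (at x)"
    (is "(_ has_real_derivative bump a b c ?Q _ x) _")
proof -
  obtain K where K: "\<And>x. \<bar>bump a b c P k x\<bar> \<le> K * (x - a)\<^sup>2" "\<And>x. \<bar>bump a b c P k x\<bar> \<le> K * (x - b)\<^sup>2"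
    using bump_bound[OF c ab] by metis
  have rp: "poly r y = (y - a) * (b - y)" for y by (simp add: r_def algebra_simps)
  consider "x = a" | "x = b" | "x < a \<or> b < x" | "a < x" "x < b" by linarith
  then show ?thesis
  proof cases
    case 1
    then have "bump a b c ?Q (k + 2) x = 0" by (simp add: bump_def)
    with 1 show ?thesis using has_derivative_zero_if_quadratic[OF K(1)] by simp
  next
    case 2
    then have "bump a b c ?Q (k + 2) x = 0" by (simp add: bump_def)
    with 2 show ?thesis using has_derivative_zero_if_quadratic[OF K(2)] by simp
  next
    case 3
    have "open ({..<a} \<union> {b<..})" by auto
    then have "(bump a b c P k has_real_derivative 0) (at x)"
      by (rule has_field_derivative_transform_within_open[OF DERIV_const]) (use 3 in \<open>auto simp: bump_def\<close>)
    moreover have "bump a b c ?Q (k + 2) x = 0" using 3 by (auto simp: bump_def)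
    ultimately show ?thesis by simp
  next
    case 4
    have r: "0 < poly r x" using 4 by (simp add: rp)
    have "((\<lambda>x. poly P x / poly r x ^ k * exp (- c / poly r x)) has_real_derivative
        poly ?Q x / poly r x ^ (k + 2) * exp (- c / poly r x)) (at x)"
      using r
      by (auto intro!: derivative_eq_intros simp: field_simps power2_eq_square)
        (cases k; simp add: field_simps)
    then have "((\<lambda>x. poly P x / poly r x ^ k * exp (- c / poly r x)) has_real_derivative
        bump a b c ?Q (k + 2) x) (at x)" using 4 by (simp add: bump_def rp)
    then show ?thesis
      by (rule has_field_derivative_transform_within_open[of _ _ _ "{a<..<b}"]) (use 4 in \<open>auto simp: bump_def rp\<close>)
  qed
qed

lemma bump_test_function:
  assumes "0 < c" "0 < a" "a < b" "b < T"
  shows "test_function T (bump a b c 1 0)"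
proof -
  have "\<exists>P k. (deriv ^^ n) (bump a b c 1 0) = bump a b c P k" for n
  proof (induction n)
    case (Suc n)
    then obtain P k where "(deriv ^^ n) (bump a b c 1 0) = bump a b c P k" by auto
    then have "(deriv ^^ Suc n) (bump a b c 1 0) x = deriv (bump a b c P k) x" for x by simp
    then show ?case using DERIV_imp_deriv[OF bump_has_derivative[OF assms(1,3), of P k]] by fastforce
  qed auto
  then have "(deriv ^^ n) (bump a b c 1 0) differentiable at x" for n x
    using bump_has_derivative[OF assms(1,3)] real_differentiable_def by metis
  moreover have "x \<notin> {a..b} \<longrightarrow> bump a b c 1 0 x = 0" for x by (auto simp: bump_def)
  ultimately show ?thesis using assms unfolding test_function_def by blast
qed

section \<open>Test functions and their primitives\<close>

lemma test_function_deriv: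
  assumes "test_function T \<phi>"
  shows "(\<phi> has_real_derivative deriv \<phi> x) (at x)"
  using assms DERIV_deriv_iff_real_differentiable funpow_0 unfolding test_function_def by metis

lemma test_function_continuous_deriv:
  assumes "test_function T \<phi>"
  shows "continuous_on S (deriv \<phi>)"
proof -
  have "deriv \<phi> differentiable at x" for x
    using assms unfolding test_function_def by (metis One_nat_def funpow_0 funpow_Suc_right comp_apply funpow.simps(2) id_apply)
  then show ?thesis
    by (intro continuous_at_imp_continuous_on ballI differentiable_imp_continuous_within)
qed

lemma test_function_continuous: "test_function T \<phi> \<Longrightarrow> continuous_on S \<phi>"
  by (rule DERIV_continuous_on) (erule test_function_deriv[THEN has_field_derivative_at_within])

text \<open>The vanishing integral is what makes the primitive vanish to the right of the support,
  so that it is again a test function.\<close>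

lemma test_function_primitive:
  assumes \<psi>: "test_function T \<psi>" and z: "integral {0..T} \<psi> = 0"
  obtains \<phi> where "test_function T \<phi>" "deriv \<phi> = \<psi>"
proof -
  obtain a b where ab: "0 < a" "b < T" "\<And>x. x \<notin> {a..b} \<Longrightarrow> \<psi> x = 0"
    using \<psi> unfolding test_function_def by blast
  define \<phi> where "\<phi> = (\<lambda>x. integral {0..x} \<psi>)"
  have c: "continuous_on S \<psi>" for S by (rule test_function_continuous[OF \<psi>])
  have z1: "\<phi> x = 0" if "x < a" for x
  proof -
    have "integral {0..x} \<psi> = integral {0..x} (\<lambda>_. 0)" by (rule integral_cong) (use ab that in auto)
    then show ?thesis by (simp add: \<phi>_def)
  qed
  \<comment> \<open>Since \<open>{a..b}\<close> may be empty, the signs of \<open>x\<close> and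
    \<open>T\<close> and their order are open here; an integral over a reversed interval is
    0.\<close>
  have z2: "\<phi> x = 0" if x: "b < x" for x
  proof (cases "0 \<le> x")
    case True
    have "integral {0..x} \<psi> = 0"
    proof (cases "x \<le> T")
      case True
      have "integral {0..x} \<psi> + integral {x..T} \<psi> = integral {0..T} \<psi>"
        by (rule Henstock_Kurzweil_Integration.integral_combine) (use \<open>0 \<le> x\<close> True c in \<open>auto intro!: integrable_continuous_interval\<close>)
      moreover have "integral {x..T} \<psi> = integral {x..T} (\<lambda>_. 0)" by (rule integral_cong) (use ab x in auto)
      ultimately show ?thesis using z by simp
    next
      case False
      show ?thesis
      proof (cases "0 \<le> T")
        case True
        have "integral {0..T} \<psi> + integral {T..x} \<psi> = integral {0..x} \<psi>"
          by (rule Henstock_Kurzweil_Integration.integral_combine) (use True False c in \<open>auto intro!: integrable_continuous_interval\<close>)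
        moreover have "integral {T..x} \<psi> = integral {T..x} (\<lambda>_. 0)" by (rule integral_cong) (use ab x in auto)
        ultimately show ?thesis using z by simp
      next
        case False
        have "integral {0..x} \<psi> = integral {0..x} (\<lambda>_. 0)" by (rule integral_cong) (use ab False in auto)
        then show ?thesis by simp
      qed
    qed
    then show ?thesis by (simp add: \<phi>_def)
  qed (use z1 ab in auto)
  have d: "(\<phi> has_real_derivative \<psi> x) (at x)" for x
  proof (cases "x < a")
    case True
    have "(\<phi> has_real_derivative 0) (at x)"
      by (rule has_field_derivative_transform_within_open[OF DERIV_const, of "{..<a}"]) (use True z1 in auto)
    then show ?thesis using ab(3)[of x] True by simp
  next
    case False
    then have x: "x \<in> {0..x + 1}" "at x within {0..x + 1} = at x" using ab by (auto intro!: at_within_Icc_at)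
    show ?thesis using integral_has_real_derivative[OF c x(1)] x(2) by (simp add: \<phi>_def)
  qed
  have dd: "deriv \<phi> = \<psi>" using DERIV_imp_deriv[OF d] by auto
  have "(deriv ^^ n) \<phi> differentiable at x" for n x
  proof (cases n)
    case 0
    then show ?thesis using d real_differentiable_def by auto
  next
    case (Suc m)
    then have "(deriv ^^ n) \<phi> = (deriv ^^ m) \<psi>" by (simp add: funpow_Suc_right dd del: funpow.simps)
    then show ?thesis using \<psi> by (simp add: test_function_def)
  qed
  moreover have "x \<notin> {a..b} \<longrightarrow> \<phi> x = 0" for x using z1[of x] z2[of x] by auto
  ultimately have "test_function T \<phi>" using ab unfolding test_function_def by blast
  then show thesis using dd by (rule that)
qed

section \<open>Weak derivatives\<close>

lemma borel_measurable_indicator_times: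
  fixes f :: "real \<Rightarrow> real"
  assumes "A \<in> sets borel" "f \<in> borel_measurable lebesgue"
  shows "(\<lambda>x. indicator A x * f x) \<in> borel_measurable lebesgue"
proof (rule borel_measurable_times)
  have "A \<in> sets lebesgue" using assms(1) by simp
  then show "indicator A \<in> borel_measurable lebesgue" by (rule borel_measurable_indicator)
qed fact

text \<open>Induction over Borel sets and Fubini's theorem are carried out on \<open>lborel\<close>;
  Lebesgue integrable functions enter there through a Borel version.\<close>

lemma lebesgue_borel_version:
  fixes f :: "real \<Rightarrow> real"
  assumes f: "integrable lebesgue f"
  obtains g where "g \<in> borel_measurable borel" "integrable lborel g" "AE x in lebesgue. f x = g x"
proof -
  obtain g where g: "g \<in> borel_measurable lborel" "AE x in lborel. f x = g x"
    using completion_ex_borel_measurable_real[of f lborel] f by auto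
  have ae: "AE x in lebesgue. f x = g x" using g(2) by (rule AE_completion)
  have "g \<in> borel_measurable lebesgue" using g(1) by (rule measurable_completion)
  then have "integrable lebesgue g"
    using integrable_cong_AE[of f lebesgue g] ae f by auto
  then have "integrable lborel g" using integrable_completion[OF g(1)] by simp
  with g(1) ae show thesis by (intro that) auto
qed

text \<open>The Borel sets over which the integral vanishes form a Dynkin system, with
  \<open>z\<close> serving the complements. It contains the intersection-stable generator of open
  intervals, hence every Borel set; uniqueness of densities finishes.\<close>

lemma AE_zero_if_integral_intervals_zero:
  fixes F :: "real \<Rightarrow> real"
  assumes F: "integrable lebesgue F" and z: "(LINT x|lebesgue. F x) = 0"
    and iv: "\<And>c d. (LINT x:{c<..<d}|lebesgue. F x) = 0"
  shows "AE x in lebesgue. F x = 0"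
proof -
  obtain G where G[measurable]: "G \<in> borel_measurable borel" and int: "integrable lborel G"
    and ae: "AE x in lebesgue. F x = G x"
    by (rule lebesgue_borel_version[OF F])
  have Gl: "G \<in> borel_measurable lebesgue" by (rule measurable_completion) simp
  have trans: "(LINT x:A|lborel. G x) = (LINT x:A|lebesgue. F x)" if A[measurable]: "A \<in> sets borel" for A
  proof -
    have "(\<lambda>x. indicator A x *\<^sub>R F x) \<in> borel_measurable lebesgue" "(\<lambda>x. indicator A x *\<^sub>R G x) \<in> borel_measurable lebesgue"
      unfolding real_scaleR_def using A Gl borel_measurable_integrable[OF F] by (auto intro!: borel_measurable_indicator_times)
    then have "(LINT x:A|lebesgue. F x) = (LINT x:A|lebesgue. G x)"
      unfolding set_lebesgue_integral_def
      by (rule integral_cong_AE) (use ae in auto)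
    also have "\<dots> = (LINT x:A|lborel. G x)"
      unfolding set_lebesgue_integral_def by (rule integral_completion) measurable
    finally show ?thesis ..
  qed
  let ?E = "range (\<lambda>(a, b). box a b :: real set)"
  have sig: "sets borel = sigma_sets UNIV ?E" by (simp add: borel_eq_box)
  have "Int_stable ?E"
  proof (rule Int_stableI)
    fix A B assume "A \<in> ?E" "B \<in> ?E"
    then obtain a b c d where "A = {a<..<b}" "B = {c<..<d}" by auto
    then have "A \<inter> B = box (max a c) (min b d)" by auto
    then show "A \<inter> B \<in> ?E" by (auto intro!: image_eqI[of _ _ "(max a c, min b d)"])
  qed
  moreover have "?E \<subseteq> Pow UNIV" by auto
  moreover have "A \<in> sigma_sets UNIV ?E" if "A \<in> sets borel" for A using that sig by simp
  ultimately have zero: "(LINT x:A|lborel. G x) = 0" if "A \<in> sets borel" for A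
  proof (rule sigma_sets_induct_disjoint[of ?E UNIV A "\<lambda>A. (LINT x:A|lborel. G x) = 0"])
    show "A \<in> sets borel" by (rule that)
    fix A assume "A \<in> ?E"
    then obtain c d where "A = {c<..<d}" by auto
    then show "(LINT x:A|lborel. G x) = 0" using trans[of A] iv[of c d] by simp
  next
    show "(LINT x:{}|lborel. G x) = 0" by (simp add: set_lebesgue_integral_def)
  next
    fix A assume A: "A \<in> sigma_sets UNIV ?E" "(LINT x:A|lborel. G x) = 0"
    then have A': "A \<in> sets borel" using sig by simp
    have "set_integrable lborel B G" if "B \<in> sets borel" for B
      using integrable_mult_indicator[of B lborel G] int that by (simp add: set_integrable_def)
    then have "(LINT x:A \<union> (UNIV - A)|lborel. G x) = (LINT x:A|lborel. G x) + (LINT x:UNIV - A|lborel. G x)"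
      using A' by (intro set_integral_Un) auto
    moreover have "A \<union> (UNIV - A) = UNIV" by auto
    moreover have "(LINT x:UNIV|lborel. G x) = 0"
      using trans[of UNIV] z by (simp add: set_lebesgue_integral_def)
    ultimately show "(LINT x:UNIV - A|lborel. G x) = 0" using A(2) by simp
  next
    fix A :: "nat \<Rightarrow> real set"
    assume A: "disjoint_family A" "range A \<subseteq> sigma_sets UNIV ?E" "\<And>i. (LINT x:A i|lborel. G x) = 0"
    then have A': "\<And>i. A i \<in> sets borel" using sig by auto
    have "(LINT x:(\<Union>i. A i)|lborel. G x) = (\<Sum>i. (LINT x:A i|lborel. G x))"
    proof (rule lebesgue_integral_countable_add)
      show "A i \<inter> A j = {}" if "i \<noteq> j" for i j using A(1) that by (auto simp: disjoint_family_on_def)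
      show "set_integrable lborel (\<Union>i. A i) G"
        using integrable_mult_indicator[of "\<Union>i. A i" lborel G] int A' by (auto simp: set_integrable_def)
    qed (use A' in auto)
    then show "(LINT x:(\<Union>i. A i)|lborel. G x) = 0" using A(3) by simp
  qed
  have "AE x in lborel. G x = 0"
    using density_unique_real[OF int, of "\<lambda>_. 0"] zero by (simp add: set_lebesgue_integral_def)
  then have "AE x in lebesgue. G x = 0" by (rule AE_completion)
  with ae show ?thesis by eventually_elim simp
qed

lemma Fubini_triangle:
  fixes g k :: "real \<Rightarrow> real"
  assumes g: "integrable lborel g" and k: "integrable lborel k"
  shows "(\<integral>x. g x * (\<integral>s. (if s \<le> x then k s else 0) \<partial>lborel) \<partial>lborel) =
    (\<integral>s. k s * (\<integral>x. (if s \<le> x then g x else 0) \<partial>lborel) \<partial>lborel)"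
proof -
  have [measurable]: "g \<in> borel_measurable borel" "k \<in> borel_measurable borel"
    using borel_measurable_integrable[OF g] borel_measurable_integrable[OF k] by simp_all
  let ?f = "\<lambda>x s. if s \<le> x then g x * k s else 0"
  have "integrable (lborel \<Otimes>\<^sub>M lborel) (\<lambda>(x, s). g x * k s)"
  proof (rule lborel_pair.Fubini_integrable)
    show "integrable lborel (\<lambda>x. LINT y|lborel. norm (case (x, y) of (x, s) \<Rightarrow> g x * k s))"
      using g k by (simp add: abs_mult)
    show "AE x in lborel. integrable lborel (\<lambda>y. case (x, y) of (x, s) \<Rightarrow> g x * k s)"
      using k by auto
  qed measurable
  then have "integrable (lborel \<Otimes>\<^sub>M lborel) (\<lambda>(x, s). ?f x s)"
    by (rule Bochner_Integration.integrable_bound) (auto simp: split_beta')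
  then have "(\<integral>s. (\<integral>x. ?f x s \<partial>lborel) \<partial>lborel) = (\<integral>x. (\<integral>s. ?f x s \<partial>lborel) \<partial>lborel)"
    by (rule lborel_pair.Fubini_integral)
  moreover have "(\<integral>s. ?f x s \<partial>lborel) = g x * (\<integral>s. (if s \<le> x then k s else 0) \<partial>lborel)" for x
  proof -
    have "(\<lambda>s. ?f x s) = (\<lambda>s. g x * (if s \<le> x then k s else 0))" by auto
    then show ?thesis by (simp only: integral_mult_right_zero)
  qed
  moreover have "(\<integral>x. ?f x s \<partial>lborel) = k s * (\<integral>x. (if s \<le> x then g x else 0) \<partial>lborel)" for s
  proof -
    have "(\<lambda>x. ?f x s) = (\<lambda>x. k s * (if s \<le> x then g x else 0))" by auto
    then show ?thesis by (simp only: integral_mult_right_zero)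
  qed
  ultimately show ?thesis by simp
qed

text \<open>Fubini over the triangle \<open>s \<le> x\<close>, where the inner integral of
  \<open>\<phi>'\<close> over \<open>[s, T]\<close> is \<open>\<phi> T - \<phi> s\<close>. This
  stands in for the product rule, as \<open>h\<close> is merely integrable.\<close>

lemma integral_by_parts_primitive:
  fixes h \<phi> \<phi>' :: "real \<Rightarrow> real"
  assumes h: "set_integrable lebesgue {0..T} h"
    and d: "\<And>t. t \<in> {0..T} \<Longrightarrow> (\<phi> has_real_derivative \<phi>' t) (at t within {0..T})"
    and c: "continuous_on {0..T} \<phi>'"
  shows "(LINT x:{0..T}|lebesgue. (LINT s:{0..x}|lebesgue. h s) * \<phi>' x) =
    (LINT s:{0..T}|lebesgue. h s * (\<phi> T - \<phi> s))"
proof -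
  define K where "K = (\<lambda>x. indicator {0..T} x * h x)"
  have K: "integrable lebesgue K" using h by (simp add: set_integrable_def K_def)
  obtain k where km[measurable]: "k \<in> borel_measurable borel" and k: "integrable lborel k"
    and ae: "AE x in lebesgue. K x = k x"
    by (rule lebesgue_borel_version[OF K])
  have kl: "k \<in> borel_measurable lebesgue" by (rule measurable_completion) simp
  define g where "g = (\<lambda>x. indicator {0..T} x * \<phi>' x)"
  have gm[measurable]: "g \<in> borel_measurable borel"
    using borel_measurable_continuous_on_indicator[OF _ c] by (simp add: g_def)
  have g: "integrable lborel g"
    using borel_integrable_atLeastAtMost'[OF c] by (simp add: set_integrable_def g_def)
  have inner: "(LINT s:{0..x}|lebesgue. h s) = (\<integral>s. (if s \<le> x then k s else 0) \<partial>lborel)" if x: "x \<in> {0..T}" for x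
  proof -
    have "(LINT s:{0..x}|lebesgue. h s) = (\<integral>s. (if s \<le> x then K s else 0) \<partial>lebesgue)"
      unfolding set_lebesgue_integral_def K_def
      by (rule Bochner_Integration.integral_cong) (use x in \<open>auto simp: indicator_def\<close>)
    also have "\<dots> = (\<integral>s. indicator {..x} s * K s \<partial>lebesgue)"
      by (rule Bochner_Integration.integral_cong) (auto simp: indicator_def)
    also have "\<dots> = (\<integral>s. indicator {..x} s * k s \<partial>lebesgue)"
      by (rule integral_cong_AE)
        (use ae kl borel_measurable_integrable[OF K] in \<open>auto intro!: borel_measurable_indicator_times\<close>)
    also have "\<dots> = (\<integral>s. indicator {..x} s * k s \<partial>lborel)"
      by (rule integral_completion) measurable
    also have "\<dots> = (\<integral>s. (if s \<le> x then k s else 0) \<partial>lborel)"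
      by (rule Bochner_Integration.integral_cong) (auto simp: indicator_def)
    finally show ?thesis .
  qed
  define m where "m = (\<lambda>s. \<integral>x. (if s \<le> x then g x else 0) \<partial>lborel)"
  have mm[measurable]: "m \<in> borel_measurable borel" unfolding m_def by measurable
  have m: "m s = \<phi> T - \<phi> s" if s: "s \<in> {0..T}" for s
  proof -
    have sub: "{s..T} \<subseteq> {0..T}" using s by auto
    have cs: "continuous_on {s..T} \<phi>'" by (rule continuous_on_subset[OF c sub])
    have "m s = (LINT x:{s..T}|lborel. \<phi>' x)"
      unfolding m_def g_def set_lebesgue_integral_def
      by (rule Bochner_Integration.integral_cong) (use s in \<open>auto simp: indicator_def\<close>)
    also have "\<dots> = integral {s..T} \<phi>'"
      by (rule set_borel_integral_eq_integral(2)[OF borel_integrable_atLeastAtMost'[OF cs]])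
    also have "(\<phi>' has_integral \<phi> T - \<phi> s) {s..T}"
      by (rule fundamental_theorem_of_calculus)
        (use s DERIV_subset[OF d sub] in \<open>auto simp: has_real_derivative_iff_has_vector_derivative\<close>)
    then have "integral {s..T} \<phi>' = \<phi> T - \<phi> s" by (rule integral_unique)
    finally show ?thesis .
  qed
  have "(LINT x:{0..T}|lebesgue. (LINT s:{0..x}|lebesgue. h s) * \<phi>' x) =
      (\<integral>x. g x * (\<integral>s. (if s \<le> x then k s else 0) \<partial>lborel) \<partial>lebesgue)"
    unfolding set_lebesgue_integral_def[of _ "{0..T}"]
    by (rule Bochner_Integration.integral_cong) (auto simp: g_def indicator_def inner)
  also have "\<dots> = (\<integral>x. g x * (\<integral>s. (if s \<le> x then k s else 0) \<partial>lborel) \<partial>lborel)"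
    by (rule integral_completion) measurable
  also have "\<dots> = (\<integral>s. k s * m s \<partial>lborel)" unfolding m_def by (rule Fubini_triangle[OF g k])
  also have "\<dots> = (\<integral>s. k s * m s \<partial>lebesgue)" by (rule integral_completion[symmetric]) measurable
  also have "\<dots> = (\<integral>s. K s * m s \<partial>lebesgue)"
  proof -
    have "m \<in> borel_measurable lebesgue" by (rule measurable_completion) simp
    then show ?thesis using ae K kl
      by (intro integral_cong_AE) (auto intro!: borel_measurable_times)
  qed
  also have "\<dots> = (LINT s:{0..T}|lebesgue. h s * (\<phi> T - \<phi> s))"
    unfolding set_lebesgue_integral_def K_def
    by (rule Bochner_Integration.integral_cong) (auto simp: indicator_def m)
  finally show ?thesis .
qed

lemma LINT_Ioo_eq_Icc:
  fixes f :: "real \<Rightarrow> real"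
  assumes "set_integrable lebesgue {a..b} f"
  shows "(LINT x:{a<..<b}|lebesgue. f x) = (LINT x:{a..b}|lebesgue. f x)"
proof -
  have "set_integrable lebesgue {a<..<b} f" by (rule set_integrable_subset[OF assms]) auto
  then show ?thesis
    by (simp add: set_lebesgue_integral_eq_integral(2) assms integral_open_interval_real)
qed

text \<open>The property shared by a test function and its derivative that makes their products with
  locally integrable functions integrable.\<close>

definition cont_compact_support :: "real \<Rightarrow> (real \<Rightarrow> real) \<Rightarrow> bool" where
  "cont_compact_support T \<psi> \<longleftrightarrow> continuous_on UNIV \<psi> \<and> (\<exists>a b. 0 < a \<and> b < T \<and> (\<forall>x. x \<notin> {a..b} \<longrightarrow> \<psi> x = 0))"

lemma test_function_support: "test_function T \<phi> \<Longrightarrow> cont_compact_support T \<phi>"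
  unfolding cont_compact_support_def using test_function_continuous[of T \<phi> UNIV]
  by (simp only: test_function_def) blast

lemma test_function_deriv_support:
  assumes "test_function T \<phi>"
  shows "cont_compact_support T (deriv \<phi>)"
proof -
  obtain a b where ab: "0 < a" "b < T" "\<And>x. x \<notin> {a..b} \<Longrightarrow> \<phi> x = 0"
    using assms unfolding test_function_def by blast
  have "deriv \<phi> x = 0" if "x \<notin> {a..b}" for x
  proof -
    have "(\<phi> has_real_derivative 0) (at x)"
      by (rule has_field_derivative_transform_within_open[OF DERIV_const, of "- {a..b}"]) (use ab that in auto)
    then show ?thesis by (rule DERIV_imp_deriv)
  qed
  then show ?thesis using ab test_function_continuous_deriv[OF assms] unfolding cont_compact_support_def by blast
qed

lemma locally_integrable_times:
  assumes f: "locally_integrable T f" and \<psi>: "cont_compact_support T \<psi>"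
  shows "set_integrable lebesgue {0<..<T} (\<lambda>x. f x * \<psi> x)"
proof -
  obtain a b where ab: "0 < a" "b < T" "\<And>x. x \<notin> {a..b} \<Longrightarrow> \<psi> x = 0"
    using \<psi> unfolding cont_compact_support_def by blast
  have c: "continuous_on UNIV \<psi>" using \<psi> by (simp add: cont_compact_support_def)
  have "bounded (\<psi> ` {a..b})"
    by (intro compact_imp_bounded compact_continuous_image continuous_on_subset[OF c]) auto
  then obtain M where M: "\<forall>x\<in>{a..b}. \<bar>\<psi> x\<bar> \<le> M" by (auto simp: bounded_real)
  have F: "integrable lebesgue (\<lambda>x. indicator {a..b} x * f x)"
    using f ab by (simp add: locally_integrable_def set_integrable_def)
  have "\<psi> \<in> borel_measurable lebesgue"
    using borel_measurable_continuous_onI[OF c] by (intro measurable_completion) simp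
  then have "integrable lebesgue (\<lambda>x. (indicator {a..b} x * f x) * \<psi> x)"
  proof (intro Bochner_Integration.integrable_bound[OF integrable_mult_right[OF F, of M]])
    show "AE x in lebesgue. norm (indicator {a..b} x * f x * \<psi> x) \<le> norm (M * (indicator {a..b} x * f x))"
    proof (intro AE_I2)
      fix x show "norm (indicator {a..b} x * f x * \<psi> x) \<le> norm (M * (indicator {a..b} x * f x))"
      proof (cases "x \<in> {a..b}")
        case True
        then have "\<bar>\<psi> x\<bar> \<le> \<bar>M\<bar>" using M by fastforce
        then show ?thesis using True by (simp add: abs_mult mult.commute mult_right_mono)
      qed auto
    qed
    show "(\<lambda>x. indicator {a..b} x * f x * \<psi> x) \<in> borel_measurable lebesgue"
      by (rule borel_measurable_times[OF borel_measurable_integrable[OF F]]) fact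
  qed
  moreover have "(\<lambda>x. indicator {a..b} x * f x * \<psi> x) = (\<lambda>x. indicator {0<..<T} x *\<^sub>R (f x * \<psi> x))"
    using ab by (auto simp: indicator_def fun_eq_iff)
  ultimately show ?thesis by (simp add: set_integrable_def)
qed

lemma locally_integrable_diff:
  "locally_integrable T f \<Longrightarrow> locally_integrable T g \<Longrightarrow> locally_integrable T (\<lambda>x. f x - g x)"
  by (simp add: locally_integrable_def set_integral_diff)

lemma locally_integrable_if_integrable:
  "set_integrable lebesgue {0..T} f \<Longrightarrow> locally_integrable T f"
  unfolding locally_integrable_def by (auto elim!: set_integrable_subset)

text \<open>As their parameter \<open>c\<close> tends to 0, the bumps converge to the indicator of
  \<open>(a, b)\<close> and stay at most 1. By dominated convergence \<open>f\<close> integrates to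
  0 over every interval with closure inside \<open>(0, T)\<close>.\<close>

lemma AE_zero_if_weakly_zero:
  assumes f: "locally_integrable T f"
    and z: "\<And>\<phi>. test_function T \<phi> \<Longrightarrow> (LINT x:{0<..<T}|lebesgue. f x * \<phi> x) = 0"
  shows "AE x in lebesgue. x \<in> {0<..<T} \<longrightarrow> f x = 0"
proof -
  have iv: "(LINT x:{a<..<b}|lebesgue. f x) = 0" if ab: "0 < a" "a < b" "b < T" for a b
  proof -
    let ?\<phi> = "\<lambda>n. bump a b (1 / real (Suc n)) 1 0"
    have t: "test_function T (?\<phi> n)" for n using ab by (intro bump_test_function) auto
    have F: "integrable lebesgue (\<lambda>x. indicator {a..b} x * f x)"
      using f ab by (simp add: locally_integrable_def set_integrable_def)
    have z': "(\<integral>x. indicator {a..b} x * f x * ?\<phi> n x \<partial>lebesgue) = 0" for n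
    proof -
      have "(\<lambda>x. indicator {a..b} x * f x * ?\<phi> n x) = (\<lambda>x. indicator {0<..<T} x *\<^sub>R (f x * ?\<phi> n x))"
        using ab by (auto simp: indicator_def fun_eq_iff bump_def)
      then show ?thesis using z[OF t[of n]] by (simp add: set_lebesgue_integral_def)
    qed
    have "(\<lambda>n. \<integral>x. indicator {a..b} x * f x * ?\<phi> n x \<partial>lebesgue) \<longlonglongrightarrow> (\<integral>x. indicator {a<..<b} x * f x \<partial>lebesgue)"
    proof (rule integral_dominated_convergence[where w = "\<lambda>x. \<bar>indicator {a..b} x * f x\<bar>"])
      have "?\<phi> n \<in> borel_measurable lebesgue" for n
        using borel_measurable_continuous_onI[OF test_function_continuous[OF t]]
        by (intro measurable_completion) simp
      then show "(\<lambda>x. indicator {a..b} x * f x * ?\<phi> n x) \<in> borel_measurable lebesgue" for n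
        by (rule borel_measurable_times[OF borel_measurable_integrable[OF F]])
      have "(\<lambda>x. indicator {a<..<b} x * (indicator {a..b} x * f x)) \<in> borel_measurable lebesgue"
        by (rule borel_measurable_indicator_times[OF _ borel_measurable_integrable[OF F]]) simp
      moreover have "(\<lambda>x. indicator {a<..<b} x * (indicator {a..b} x * f x)) = (\<lambda>x. indicator {a<..<b} x * f x)"
        by (auto simp: indicator_def fun_eq_iff)
      ultimately show "(\<lambda>x. indicator {a<..<b} x * f x) \<in> borel_measurable lebesgue" by simp
      show "integrable lebesgue (\<lambda>x. \<bar>indicator {a..b} x * f x\<bar>)" using F by (rule integrable_abs)
      show "AE x in lebesgue. norm (indicator {a..b} x * f x * ?\<phi> n x) \<le> \<bar>indicator {a..b} x * f x\<bar>" for n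
      proof (intro AE_I2)
        fix x
        have "\<bar>?\<phi> n x\<bar> \<le> 1" by (auto simp: bump_def)
        then show "norm (indicator {a..b} x * f x * ?\<phi> n x) \<le> \<bar>indicator {a..b} x * f x\<bar>"
          by (simp add: abs_mult mult_left_le)
      qed
      show "AE x in lebesgue. (\<lambda>n. indicator {a..b} x * f x * ?\<phi> n x) \<longlonglongrightarrow> indicator {a<..<b} x * f x"
      proof (intro AE_I2)
        fix x
        show "(\<lambda>n. indicator {a..b} x * f x * ?\<phi> n x) \<longlonglongrightarrow> indicator {a<..<b} x * f x"
        proof (cases "a < x \<and> x < b")
          case True
          have "(\<lambda>n. f x * exp (- (1 / real (Suc n)) / ((x - a) * (b - x)))) \<longlonglongrightarrow> f x * exp (- 0 / ((x - a) * (b - x)))"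
            by (intro tendsto_intros LIMSEQ_Suc[OF lim_1_over_n]) (use True in auto)
          then show ?thesis using True by (simp add: bump_def)
        qed (auto simp: bump_def)
      qed
    qed
    then have "(\<lambda>n::nat. 0::real) \<longlonglongrightarrow> (\<integral>x. indicator {a<..<b} x * f x \<partial>lebesgue)" unfolding z' .
    then have "(\<integral>x. indicator {a<..<b} x * f x \<partial>lebesgue) = 0" by (simp add: LIMSEQ_const_iff)
    then show ?thesis by (simp add: set_lebesgue_integral_def)
  qed
  have ae: "AE x in lebesgue. indicator {a..b} x * f x = 0" if ab: "0 < a" "b < T" for a b
  proof (rule AE_zero_if_integral_intervals_zero)
    have i: "set_integrable lebesgue {a..b} f" using f ab by (simp add: locally_integrable_def)
    then show "integrable lebesgue (\<lambda>x. indicator {a..b} x * f x)" by (simp add: set_integrable_def)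
    have iv': "(LINT x:{c<..<d}|lebesgue. f x) = 0" if "a \<le> c" "d \<le> b" for c d
      using iv[of c d] that ab by (cases "c < d") (auto simp: set_lebesgue_integral_def)
    show "(LINT x|lebesgue. indicator {a..b} x * f x) = 0"
      using LINT_Ioo_eq_Icc[OF i] iv'[of a b] by (simp add: set_lebesgue_integral_def)
    show "(LINT x:{c<..<d}|lebesgue. indicator {a..b} x * f x) = 0" for c d
    proof -
      have j: "set_integrable lebesgue {max a c..min b d} f" by (rule set_integrable_subset[OF i]) auto
      have k: "set_integrable lebesgue ({c<..<d} \<inter> {a..b}) f" by (rule set_integrable_subset[OF i]) auto
      have "(LINT x:{c<..<d}|lebesgue. indicator {a..b} x * f x) = (LINT x:{c<..<d} \<inter> {a..b}|lebesgue. f x)"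
        unfolding set_lebesgue_integral_def
        by (rule Bochner_Integration.integral_cong) (auto simp: indicator_def)
      also have "\<dots> = integral ({c<..<d} \<inter> {a..b}) f" by (rule set_lebesgue_integral_eq_integral(2)[OF k])
      \<comment> \<open>The two sets differ at most in the points \<open>c\<close> and
        \<open>d\<close>.\<close>
      also have "\<dots> = integral {max a c..min b d} f"
      proof (rule integral_spike_set)
        have "negligible {c, d}" by simp
        then show "negligible {x \<in> {c<..<d} \<inter> {a..b} - {max a c..min b d}. f x \<noteq> 0}"
          "negligible {x \<in> {max a c..min b d} - {c<..<d} \<inter> {a..b}. f x \<noteq> 0}"
          by (rule negligible_subset, auto)+
      qed
      also have "\<dots> = (LINT x:{max a c<..<min b d}|lebesgue. f x)"
        unfolding LINT_Ioo_eq_Icc[OF j] by (rule set_lebesgue_integral_eq_integral(2)[OF j, symmetric])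
      also have "\<dots> = 0" by (rule iv') auto
      finally show ?thesis .
    qed
  qed
  \<comment> \<open>A countable exhaustion of \<open>(0, T)\<close>, since local integrability
    controls compact subintervals only.\<close>
  have "AE x in lebesgue. \<forall>n::nat. indicator {1 / real (Suc n)..T - 1 / real (Suc n)} x * f x = 0"
    unfolding AE_all_countable by (intro allI ae) auto
  then show ?thesis
  proof eventually_elim
    fix x assume n: "\<forall>n::nat. indicator {1 / real (Suc n)..T - 1 / real (Suc n)} x * f x = 0"
    show "x \<in> {0<..<T} \<longrightarrow> f x = 0"
    proof
      assume x: "x \<in> {0<..<T}"
      then have "0 < min x (T - x)" by auto
      then obtain n where "1 / real (Suc n) < min x (T - x)" by (rule nat_approx_posE)
      then have "x \<in> {1 / real (Suc n)..T - 1 / real (Suc n)}" by auto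
      then show "f x = 0" using n[rule_format, of n] by (simp del: of_nat_Suc)
    qed
  qed
qed

lemma has_weak_deriv_unique:
  assumes 1: "has_weak_deriv T u g" and 2: "has_weak_deriv T u h"
  shows "AE x in lebesgue. x \<in> {0<..<T} \<longrightarrow> g x = h x"
proof -
  have l: "locally_integrable T g" "locally_integrable T h" using 1 2 by (auto simp: has_weak_deriv_def)
  have "AE x in lebesgue. x \<in> {0<..<T} \<longrightarrow> g x - h x = 0"
  proof (rule AE_zero_if_weakly_zero)
    show "locally_integrable T (\<lambda>x. g x - h x)" using l by (rule locally_integrable_diff)
    fix \<phi> assume \<phi>: "test_function T \<phi>"
    note i = locally_integrable_times[OF l(1) test_function_support[OF \<phi>]]
      locally_integrable_times[OF l(2) test_function_support[OF \<phi>]]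
    have "(LINT x:{0<..<T}|lebesgue. g x * \<phi> x) = (LINT x:{0<..<T}|lebesgue. h x * \<phi> x)"
    proof -
      have "- (LINT x:{0<..<T}|lebesgue. g x * \<phi> x) = - (LINT x:{0<..<T}|lebesgue. h x * \<phi> x)"
        using 1 2 \<phi> unfolding has_weak_deriv_def by simp
      then show ?thesis by simp
    qed
    then show "(LINT x:{0<..<T}|lebesgue. (g x - h x) * \<phi> x) = 0"
      using set_integral_diff(2)[OF i] by (simp add: left_diff_distrib)
  qed
  then show ?thesis by auto
qed

lemma test_function_diff_scale:
  assumes \<phi>: "test_function T \<phi>" and \<psi>: "test_function T \<psi>"
  shows "test_function T (\<lambda>x. \<phi> x - c * \<psi> x)"
proof -
  have d: "(deriv ^^ n) \<phi> differentiable at x" "(deriv ^^ n) \<psi> differentiable at x" for n x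
    using \<phi> \<psi> by (auto simp: test_function_def)
  have eq: "(deriv ^^ n) (\<lambda>x. \<phi> x - c * \<psi> x) = (\<lambda>x. (deriv ^^ n) \<phi> x - c * (deriv ^^ n) \<psi> x)" for n
  proof (induction n)
    case (Suc n)
    show ?case
    proof
      fix x
      have "((\<lambda>x. (deriv ^^ n) \<phi> x - c * (deriv ^^ n) \<psi> x) has_real_derivative
          deriv ((deriv ^^ n) \<phi>) x - c * deriv ((deriv ^^ n) \<psi>) x) (at x)"
        using d[of n x] by (intro DERIV_diff DERIV_cmult) (simp_all add: DERIV_deriv_iff_real_differentiable)
      then show "(deriv ^^ Suc n) (\<lambda>x. \<phi> x - c * \<psi> x) x = (deriv ^^ Suc n) \<phi> x - c * (deriv ^^ Suc n) \<psi> x"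
        using Suc.IH by (simp add: DERIV_imp_deriv)
    qed
  qed simp
  obtain a b where ab: "0 < a" "b < T" "\<And>x. x \<notin> {a..b} \<Longrightarrow> \<phi> x = 0"
    using \<phi> unfolding test_function_def by blast
  obtain a' b' where ab': "0 < a'" "b' < T" "\<And>x. x \<notin> {a'..b'} \<Longrightarrow> \<psi> x = 0"
    using \<psi> unfolding test_function_def by blast
  have "\<phi> x - c * \<psi> x = 0" if "x \<notin> {min a a'..max b b'}" for x
  proof -
    have "x \<notin> {a..b}" "x \<notin> {a'..b'}" using that by auto
    then have "\<phi> x = 0" "\<psi> x = 0" by (auto intro: ab(3) ab'(3) simp del: atLeastAtMost_iff)
    then show ?thesis by simp
  qed
  then show ?thesis unfolding test_function_def eq
    using ab ab' d by (intro conjI allI exI[of _ "min a a'"] exI[of _ "max b b'"]) (auto intro!: differentiable_diff differentiable_mult)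
qed

text \<open>The lemma of du Bois-Reymond. Subtracting a multiple of the fixed bump \<open>e\<close>
  gives any test function integral 0 and hence a primitive among the test functions. The constant is
  the mean of \<open>f\<close> weighted by \<open>e\<close>.\<close>

lemma AE_const_if_weak_deriv_zero:
  assumes T: "0 < T" and f: "locally_integrable T f"
    and z: "\<And>\<phi>. test_function T \<phi> \<Longrightarrow> (LINT x:{0<..<T}|lebesgue. f x * deriv \<phi> x) = 0"
  shows "\<exists>c. AE x in lebesgue. x \<in> {0<..<T} \<longrightarrow> f x = c"
proof -
  define e where "e = bump (T / 3) (2 * T / 3) 1 1 0"
  have e: "test_function T e" unfolding e_def using T by (intro bump_test_function) auto
  define J where "J = integral {0..T} e"
  have J: "J \<noteq> 0"
  proof
    assume "J = 0"
    then have "\<forall>x\<in>{0..T}. e x = 0"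
      using integral_eq_0_iff[OF test_function_continuous[OF e] T] by (auto simp: J_def e_def bump_def)
    then have "e (T / 2) = 0" using T by auto
    then show False using T by (simp add: e_def bump_def)
  qed
  define c where "c = (LINT x:{0<..<T}|lebesgue. f x * e x) / J"
  have open_int: "(LINT x:{0<..<T}|lebesgue. \<psi> x) = integral {0..T} \<psi>" if "test_function T \<psi>" for \<psi>
  proof -
    note i = integral_continuous_eq_LINT[OF test_function_continuous[OF that, of "{0..T}"]]
    show ?thesis using LINT_Ioo_eq_Icc[OF i(1)] i(2) by simp
  qed
  have lc: "locally_integrable T (\<lambda>_. c)"
    by (rule locally_integrable_if_integrable, rule integral_continuous_eq_LINT) simp
  have "AE x in lebesgue. x \<in> {0<..<T} \<longrightarrow> f x - c = 0"
  proof (rule AE_zero_if_weakly_zero)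
    show "locally_integrable T (\<lambda>x. f x - c)" using f lc by (rule locally_integrable_diff)
    fix \<psi> assume \<psi>: "test_function T \<psi>"
    define d where "d = integral {0..T} \<psi> / J"
    have "integral {0..T} (\<lambda>x. \<psi> x - d * e x) = integral {0..T} \<psi> - d * J"
      unfolding J_def using test_function_continuous[OF \<psi>] test_function_continuous[OF e]
      by (subst integral_diff) (auto intro!: integrable_continuous_interval continuous_intros)
    then have "integral {0..T} (\<lambda>x. \<psi> x - d * e x) = 0" using J by (simp add: d_def)
    then obtain \<phi> where \<phi>: "test_function T \<phi>" "deriv \<phi> = (\<lambda>x. \<psi> x - d * e x)"
      by (rule test_function_primitive[OF test_function_diff_scale[OF \<psi> e]])
    have i: "set_integrable lebesgue {0<..<T} (\<lambda>x. f x * \<psi> x)" "set_integrable lebesgue {0<..<T} (\<lambda>x. f x * e x)"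
      "set_integrable lebesgue {0<..<T} (\<lambda>x. c * \<psi> x)"
      by (rule locally_integrable_times[OF f test_function_support[OF \<psi>]]
          locally_integrable_times[OF f test_function_support[OF e]]
          locally_integrable_times[OF lc test_function_support[OF \<psi>]])+
    have "0 = (LINT x:{0<..<T}|lebesgue. f x * (\<psi> x - d * e x))" using z[OF \<phi>(1)] \<phi>(2) by simp
    also have "\<dots> = (LINT x:{0<..<T}|lebesgue. f x * \<psi> x - d * (f x * e x))"
      by (simp add: algebra_simps)
    also have "\<dots> = (LINT x:{0<..<T}|lebesgue. f x * \<psi> x) - d * (LINT x:{0<..<T}|lebesgue. f x * e x)"
      using i by (subst set_integral_diff) auto
    also have "d * (LINT x:{0<..<T}|lebesgue. f x * e x) = c * integral {0..T} \<psi>"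
      by (simp add: d_def c_def)
    also have "\<dots> = (LINT x:{0<..<T}|lebesgue. c * \<psi> x)"
      by (simp add: open_int[OF \<psi>])
    finally have "(LINT x:{0<..<T}|lebesgue. f x * \<psi> x) - (LINT x:{0<..<T}|lebesgue. c * \<psi> x) = 0" by simp
    then show "(LINT x:{0<..<T}|lebesgue. (f x - c) * \<psi> x) = 0"
      using set_integral_diff(2)[OF i(1,3)] by (simp add: left_diff_distrib)
  qed
  then show ?thesis by (intro exI[of _ c]) auto
qed

section \<open>Weak derivatives up to null sets\<close>

lemma Lp_space_integrable:
  assumes "1 < p" "f \<in> Lp_space T p"
  shows "set_integrable lebesgue {0..T} f"
  using Holder_Lp(1)[OF assms Lp_space_continuous[of T "\<lambda>_. 1"]] conjugate_exponent(1)[OF assms(1)] by simp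

lemma locally_integrable_cong_AE:
  assumes f: "locally_integrable T f" and ae: "AE x in lebesgue. x \<in> {0<..<T} \<longrightarrow> f x = g x"
  shows "locally_integrable T g"
  unfolding locally_integrable_def
proof (intro allI impI)
  fix a b :: real assume ab: "0 < a \<and> b < T"
  then have i: "integrable lebesgue (\<lambda>x. indicator {a..b} x * f x)"
    using f by (auto simp: locally_integrable_def set_integrable_def)
  have ae': "AE x in lebesgue. indicator {a..b} x * f x = indicator {a..b} x * g x"
    using ae by eventually_elim (use ab in \<open>auto simp: indicator_def\<close>)
  have "(\<lambda>x. indicator {a..b} x * g x) \<in> borel_measurable lebesgue"
    by (rule borel_measurable_AE[OF borel_measurable_integrable[OF i] ae'])
  then have "integrable lebesgue (\<lambda>x. indicator {a..b} x * g x)"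
    using integrable_cong_AE[OF borel_measurable_integrable[OF i] _ ae'] i by simp
  then show "set_integrable lebesgue {a..b} g" by (simp add: set_integrable_def)
qed

lemma LINT_test_cong_AE:
  assumes f: "locally_integrable T f" and g: "locally_integrable T g"
    and ae: "AE x in lebesgue. x \<in> {0<..<T} \<longrightarrow> f x = g x" and \<psi>: "cont_compact_support T \<psi>"
  shows "(LINT x:{0<..<T}|lebesgue. f x * \<psi> x) = (LINT x:{0<..<T}|lebesgue. g x * \<psi> x)"
  unfolding set_lebesgue_integral_def
proof (rule integral_cong_AE)
  show "(\<lambda>x. indicator {0<..<T} x *\<^sub>R (f x * \<psi> x)) \<in> borel_measurable lebesgue"
    "(\<lambda>x. indicator {0<..<T} x *\<^sub>R (g x * \<psi> x)) \<in> borel_measurable lebesgue"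
    using locally_integrable_times[OF f \<psi>] locally_integrable_times[OF g \<psi>]
    by (auto simp: set_integrable_def)
  show "AE x in lebesgue. indicator {0<..<T} x *\<^sub>R (f x * \<psi> x) = indicator {0<..<T} x *\<^sub>R (g x * \<psi> x)"
    using ae by eventually_elim (auto simp: indicator_def)
qed

text \<open>\<open>weak_deriv\<close> is a choice by \<open>SOME\<close>, so its values are known
  only up to null sets and facts must be transferred between almost everywhere equal
  functions.\<close>

lemma has_weak_deriv_cong_AE:
  assumes w: "has_weak_deriv T u g" and u: "AE x in lebesgue. x \<in> {0<..<T} \<longrightarrow> u x = v x"
    and g: "AE x in lebesgue. x \<in> {0<..<T} \<longrightarrow> g x = h x"
  shows "has_weak_deriv T v h"
proof -
  have l: "locally_integrable T u" "locally_integrable T g" using w by (auto simp: has_weak_deriv_def)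
  note l' = locally_integrable_cong_AE[OF l(1) u] locally_integrable_cong_AE[OF l(2) g]
  show ?thesis unfolding has_weak_deriv_def
  proof (intro conjI l' allI impI)
    fix \<phi> assume \<phi>: "test_function T \<phi>"
    show "(LINT x:{0<..<T}|lebesgue. v x * deriv \<phi> x) = - (LINT x:{0<..<T}|lebesgue. h x * \<phi> x)"
      using w \<phi> unfolding has_weak_deriv_def
      by (simp add: LINT_test_cong_AE[OF l(1) l'(1) u test_function_deriv_support[OF \<phi>], symmetric]
        LINT_test_cong_AE[OF l(2) l'(2) g test_function_support[OF \<phi>], symmetric])
  qed
qed

lemma continuous_on_LINT_primitive:
  fixes h :: "real \<Rightarrow> real"
  assumes "set_integrable lebesgue {0..T} h"
  shows "continuous_on {0..T} (\<lambda>x. LINT s:{0..x}|lebesgue. h s)"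
proof -
  have "continuous_on {0..T} (\<lambda>x. integral {0..x} h)"
    by (rule indefinite_integral_continuous_1[OF set_lebesgue_integral_eq_integral(1)[OF assms]])
  then show ?thesis
  proof (rule continuous_on_eq)
    show "integral {0..x} h = (LINT s:{0..x}|lebesgue. h s)" if "x \<in> {0..T}" for x
      by (rule set_lebesgue_integral_eq_integral(2)[OF set_integrable_subset[OF assms], symmetric])
        (use that in auto)
  qed
qed

lemma has_weak_deriv_primitive:
  assumes T: "0 < T" and h: "set_integrable lebesgue {0..T} h"
  shows "has_weak_deriv T (\<lambda>x. c + (LINT s:{0..x}|lebesgue. h s)) h"
  unfolding has_weak_deriv_def
proof (intro conjI allI impI)
  let ?H = "\<lambda>x. LINT s:{0..x}|lebesgue. h s"
  have cH: "continuous_on {0..T} ?H" by (rule continuous_on_LINT_primitive[OF h])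
  show "locally_integrable T h" using h by (rule locally_integrable_if_integrable)
  have l: "locally_integrable T (\<lambda>x. c + ?H x)"
    by (intro locally_integrable_if_integrable integral_continuous_eq_LINT continuous_intros cH)
  then show "locally_integrable T (\<lambda>x. c + ?H x)" .
  fix \<phi> assume \<phi>: "test_function T \<phi>"
  have z: "\<phi> 0 = 0" "\<phi> T = 0" using \<phi> by (auto simp: test_function_def)
  have d: "(\<phi> has_real_derivative deriv \<phi> t) (at t within {0..T})" for t
    by (rule has_field_derivative_at_within[OF test_function_deriv[OF \<phi>]])
  note cd = test_function_continuous_deriv[OF \<phi>, of "{0..T}"]
  have i1: "set_integrable lebesgue {0..T} (\<lambda>x. c * deriv \<phi> x)" "set_integrable lebesgue {0..T} (\<lambda>x. ?H x * deriv \<phi> x)"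
    "set_integrable lebesgue {0..T} (\<lambda>x. (c + ?H x) * deriv \<phi> x)"
    by (intro integral_continuous_eq_LINT continuous_intros cH cd)+
  have "(deriv \<phi> has_integral \<phi> T - \<phi> 0) {0..T}"
    by (rule fundamental_theorem_of_calculus)
      (use T d in \<open>auto simp: has_real_derivative_iff_has_vector_derivative\<close>)
  then have c0: "(LINT x:{0..T}|lebesgue. c * deriv \<phi> x) = 0"
    using integral_continuous_eq_LINT(2)[OF cd] z by (simp add: has_integral_iff)
  have "(LINT x:{0<..<T}|lebesgue. (c + ?H x) * deriv \<phi> x) = (LINT x:{0..T}|lebesgue. (c + ?H x) * deriv \<phi> x)"
    by (rule LINT_Ioo_eq_Icc[OF i1(3)])
  also have "\<dots> = (LINT x:{0..T}|lebesgue. c * deriv \<phi> x) + (LINT x:{0..T}|lebesgue. ?H x * deriv \<phi> x)"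
    using set_integral_add(2)[OF i1(1,2)] by (simp add: distrib_right)
  also have "\<dots> = (LINT s:{0..T}|lebesgue. h s * (\<phi> T - \<phi> s))"
    using integral_by_parts_primitive[OF h d cd] c0 by simp
  also have "\<dots> = - (LINT s:{0..T}|lebesgue. h s * \<phi> s)"
    using z by (simp add: set_lebesgue_integral_def)
  also have "(LINT s:{0..T}|lebesgue. h s * \<phi> s) = (LINT s:{0<..<T}|lebesgue. h s * \<phi> s)"
    unfolding set_lebesgue_integral_def
    by (rule Bochner_Integration.integral_cong) (use z in \<open>auto simp: indicator_def\<close>)
  finally show "(LINT x:{0<..<T}|lebesgue. (c + ?H x) * deriv \<phi> x) = - (LINT x:{0<..<T}|lebesgue. h x * \<phi> x)" .
qed

text \<open>Subtracting the primitive of \<open>h\<close> leaves a function with weak derivative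
  0.\<close>

lemma weak_deriv_primitive:
  assumes T: "0 < T" and w: "has_weak_deriv T g h" and h: "set_integrable lebesgue {0..T} h"
  shows "\<exists>c. AE x in lebesgue. x \<in> {0<..<T} \<longrightarrow> g x = c + (LINT s:{0..x}|lebesgue. h s)"
proof -
  let ?H = "\<lambda>x. LINT s:{0..x}|lebesgue. h s"
  have w': "has_weak_deriv T ?H h" using has_weak_deriv_primitive[OF T h, of 0] by simp
  have l: "locally_integrable T g" "locally_integrable T ?H"
    using w w' by (auto simp: has_weak_deriv_def)
  have "\<exists>c. AE x in lebesgue. x \<in> {0<..<T} \<longrightarrow> g x - ?H x = c"
  proof (rule AE_const_if_weak_deriv_zero[OF T])
    show "locally_integrable T (\<lambda>x. g x - ?H x)" using l by (rule locally_integrable_diff)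
    fix \<phi> assume \<phi>: "test_function T \<phi>"
    note i = locally_integrable_times[OF l(1) test_function_deriv_support[OF \<phi>]]
      locally_integrable_times[OF l(2) test_function_deriv_support[OF \<phi>]]
    have "(LINT x:{0<..<T}|lebesgue. g x * deriv \<phi> x) = (LINT x:{0<..<T}|lebesgue. ?H x * deriv \<phi> x)"
      using w w' \<phi> unfolding has_weak_deriv_def by simp
    then show "(LINT x:{0<..<T}|lebesgue. (g x - ?H x) * deriv \<phi> x) = 0"
      using set_integral_diff(2)[OF i] by (simp add: left_diff_distrib)
  qed
  then obtain c where c: "AE x in lebesgue. x \<in> {0<..<T} \<longrightarrow> g x - ?H x = c" ..
  have "AE x in lebesgue. x \<in> {0<..<T} \<longrightarrow> g x = c + ?H x"
    using c by eventually_elim auto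
  then show ?thesis ..
qed

lemma LINT_cong_AE:
  fixes f g :: "real \<Rightarrow> real"
  assumes f: "set_borel_measurable lebesgue {0..T} f" and ae: "AE x in lebesgue. x \<in> {0<..<T} \<longrightarrow> f x = g x"
  shows "(LINT x:{0..T}|lebesgue. f x) = (LINT x:{0..T}|lebesgue. g x)"
proof -
  have ends: "AE x in lebesgue. x \<noteq> 0" "AE x in lebesgue. x \<noteq> T"
    by (rule AE_completion[OF AE_lborel_singleton])+
  have ae': "AE x in lebesgue. indicator {0..T} x *\<^sub>R f x = indicator {0..T} x *\<^sub>R g x"
    using ae ends by eventually_elim (auto simp: indicator_def)
  have m: "(\<lambda>x. indicator {0..T} x *\<^sub>R f x) \<in> borel_measurable lebesgue"
    using f unfolding set_borel_measurable_def .
  show ?thesis unfolding set_lebesgue_integral_def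
    by (rule integral_cong_AE[OF m borel_measurable_AE[OF m ae'] ae'])
qed

lemma Lp_norm_cong_AE:
  assumes f: "f \<in> Lp_space T p" and ae: "AE x in lebesgue. x \<in> {0<..<T} \<longrightarrow> f x = g x"
  shows "Lp_norm T p f = Lp_norm T p g"
proof -
  have "(LINT x:{0..T}|lebesgue. \<bar>f x\<bar> powr p) = (LINT x:{0..T}|lebesgue. \<bar>g x\<bar> powr p)"
  proof (rule LINT_cong_AE)
    show "set_borel_measurable lebesgue {0..T} (\<lambda>x. \<bar>f x\<bar> powr p)"
      using f unfolding Lp_space_def set_integrable_def set_borel_measurable_def by auto
    show "AE x in lebesgue. x \<in> {0<..<T} \<longrightarrow> \<bar>f x\<bar> powr p = \<bar>g x\<bar> powr p"
      using ae by eventually_elim auto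
  qed
  then show ?thesis by (simp add: Lp_norm_def)
qed

text \<open>The nested choices are resolved from inside: \<open>g\<close> agrees with the chosen
  first derivative, so \<open>h\<close> is a weak derivative of that one too and agrees with the
  chosen second derivative.\<close>

lemma W2D_norm_eq:
  assumes u: "has_weak_deriv T u g" and g: "has_weak_deriv T g h" and h: "h \<in> Lp_space T p"
  shows "W2D_norm T p u = Lp_norm T p h"
proof -
  define g' where "g' = weak_deriv T u"
  have "has_weak_deriv T u g'" unfolding g'_def weak_deriv_def by (rule someI[of _ g]) (rule u)
  then have ae: "AE x in lebesgue. x \<in> {0<..<T} \<longrightarrow> g x = g' x" by (rule has_weak_deriv_unique[OF u])
  have g': "has_weak_deriv T g' h" by (rule has_weak_deriv_cong_AE[OF g ae]) simp
  then have "has_weak_deriv T g' (weak_deriv T g')" unfolding weak_deriv_def by (rule someI[of "has_weak_deriv T g'"])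
  then have "AE x in lebesgue. x \<in> {0<..<T} \<longrightarrow> h x = weak_deriv T g' x" by (rule has_weak_deriv_unique[OF g'])
  from Lp_norm_cong_AE[OF h this] show ?thesis by (simp add: W2D_norm_def g'_def)
qed

section \<open>The Sobolev space and the embedding bound\<close>

lemma continuous_AE_eq:
  fixes f g :: "real \<Rightarrow> real"
  assumes T: "0 < T" and f: "continuous_on {0..T} f" and g: "continuous_on {0..T} g"
    and ae: "AE x in lebesgue. x \<in> {0<..<T} \<longrightarrow> f x = g x" and x: "x \<in> {0..T}"
  shows "f x = g x"
proof -
  have c: "continuous_on {0..T} (\<lambda>x. \<bar>f x - g x\<bar>)" by (intro continuous_intros f g)
  note i = integral_continuous_eq_LINT[OF c]
  have "(LINT x:{0..T}|lebesgue. \<bar>f x - g x\<bar>) = (LINT x:{0..T}|lebesgue. 0)"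
  proof (rule LINT_cong_AE)
    show "set_borel_measurable lebesgue {0..T} (\<lambda>x. \<bar>f x - g x\<bar>)"
      using i(1) unfolding set_integrable_def set_borel_measurable_def by auto
    show "AE x in lebesgue. x \<in> {0<..<T} \<longrightarrow> \<bar>f x - g x\<bar> = 0" using ae by eventually_elim auto
  qed
  then have "integral {0..T} (\<lambda>x. \<bar>f x - g x\<bar>) = 0" using i(2) by simp
  then show ?thesis using integral_eq_0_iff[OF c T] x by auto
qed

text \<open>Two integrations by parts move the derivatives from \<open>u\<close> to
  \<open>green T k\<close>, whose second derivative is \<open>- k\<close>. The boundary values of
  \<open>u\<close> remove the first boundary term; those of \<open>green T k\<close> remove the
  second one and the integration constant \<open>c\<close>.\<close>

lemma W2D_integral_by_parts:
  assumes T: "0 < T" and u: "continuous_on {0..T} u" "u 0 = 0" "u T = 0"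
    and w: "has_weak_deriv T u g" "has_weak_deriv T g h"
    and i: "set_integrable lebesgue {0..T} g" "set_integrable lebesgue {0..T} h"
    and v: "continuous_on {0..T} k"
  shows "integral {0..T} (\<lambda>x. u x * k x) = - (LINT x:{0..T}|lebesgue. h x * green T k x)"
proof -
  let ?G = "\<lambda>x. LINT s:{0..x}|lebesgue. g s" and ?H = "\<lambda>x. LINT s:{0..x}|lebesgue. h s"
  have cG: "continuous_on {0..T} ?G" and cH: "continuous_on {0..T} ?H"
    by (rule continuous_on_LINT_primitive, fact)+
  obtain a where a: "AE x in lebesgue. x \<in> {0<..<T} \<longrightarrow> u x = a + ?G x"
    using weak_deriv_primitive[OF T w(1) i(1)] ..
  obtain c where c: "AE x in lebesgue. x \<in> {0<..<T} \<longrightarrow> g x = c + ?H x"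
    using weak_deriv_primitive[OF T w(2) i(2)] ..
  have ua: "u x = a + ?G x" if "x \<in> {0..T}" for x
    by (rule continuous_AE_eq[OF T u(1) _ a that]) (intro continuous_intros cG)
  have "?G 0 = 0"
  proof -
    have "set_integrable lebesgue {0..0} g" by (rule set_integrable_subset[OF i(1)]) (use T in auto)
    from set_lebesgue_integral_eq_integral(2)[OF this] show ?thesis by simp
  qed
  \<comment> \<open>Evaluation at 0 gives \<open>a = 0\<close>; evaluation at \<open>T\<close> then
    shows that \<open>g\<close> has integral 0.\<close>
  then have uG: "u x = ?G x" if "x \<in> {0..T}" for x using ua[of 0] ua[OF that] u T by simp
  then have GT: "?G T = 0" using u T by simp
  note d = green_has_derivative[OF T v] green'_has_derivative[OF T v]
  note b = green_boundary[OF T v]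
  have ck: "continuous_on {0..T} (\<lambda>x. - k x)" by (intro continuous_intros v)
  have cg': "continuous_on {0..T} (green' T k)" by (rule continuous_on_green'[OF T v])
  have gi: "set_integrable lebesgue {0..T} (\<lambda>s. g s * green' T k s)"
    "set_integrable lebesgue {0..T} (\<lambda>s. g s * green' T k T)"
  proof -
    have m: "(\<lambda>x. indicator {0..T} x * g x) \<in> borel_measurable lebesgue"
      using i(1) by (auto simp: set_integrable_def)
    have "bounded (green' T k ` {0..T})" by (intro compact_imp_bounded compact_continuous_image cg') simp
    then obtain M where M: "\<forall>x\<in>{0..T}. \<bar>green' T k x\<bar> \<le> M" by (auto simp: bounded_real)
    have gm: "(\<lambda>x. indicator {0..T} x * green' T k x) \<in> borel_measurable lebesgue"
      using integral_continuous_eq_LINT(1)[OF cg'] by (auto simp: set_integrable_def)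
    have "(\<lambda>x. (indicator {0..T} x * g x) * (indicator {0..T} x * green' T k x)) \<in> borel_measurable lebesgue"
      by (rule borel_measurable_times[OF m gm])
    moreover have "(\<lambda>x. (indicator {0..T} x * g x) * (indicator {0..T} x * green' T k x)) =
        (\<lambda>x. indicator {0..T} x * (g x * green' T k x))" by (auto simp: indicator_def fun_eq_iff)
    ultimately have m2: "(\<lambda>x. indicator {0..T} x * (g x * green' T k x)) \<in> borel_measurable lebesgue" by simp
    have "integrable lebesgue (\<lambda>x. M * (indicator {0..T} x * g x))"
      using i(1) by (auto simp: set_integrable_def)
    then have "integrable lebesgue (\<lambda>x. indicator {0..T} x * (g x * green' T k x))"
    proof (rule Bochner_Integration.integrable_bound[OF _ m2])
      show "AE x in lebesgue. norm (indicator {0..T} x * (g x * green' T k x)) \<le> norm (M * (indicator {0..T} x * g x))"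
      proof (intro AE_I2)
        fix x show "norm (indicator {0..T} x * (g x * green' T k x)) \<le> norm (M * (indicator {0..T} x * g x))"
        proof (cases "x \<in> {0..T}")
          case True
          then have "\<bar>green' T k x\<bar> \<le> \<bar>M\<bar>" using M by fastforce
          then have "\<bar>green' T k x\<bar> * \<bar>g x\<bar> \<le> \<bar>M\<bar> * \<bar>g x\<bar>" by (rule mult_right_mono) simp
          then show ?thesis using True by (simp add: abs_mult mult.commute)
        qed auto
      qed
    qed
    then show "set_integrable lebesgue {0..T} (\<lambda>s. g s * green' T k s)" by (simp add: set_integrable_def)
    show "set_integrable lebesgue {0..T} (\<lambda>s. g s * green' T k T)" using i(1) by simp
  qed
  have "integral {0..T} (\<lambda>x. u x * k x) = (LINT x:{0..T}|lebesgue. u x * k x)"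
    by (rule integral_continuous_eq_LINT(2)[symmetric]) (intro continuous_intros u v)
  also have "\<dots> = - (LINT x:{0..T}|lebesgue. ?G x * - k x)"
  proof -
    have "(LINT x:{0..T}|lebesgue. u x * k x) = (LINT x:{0..T}|lebesgue. - (?G x * - k x))"
      by (rule set_lebesgue_integral_cong) (auto simp: uG)
    then show ?thesis by (simp add: set_lebesgue_integral_def)
  qed
  also have "(LINT x:{0..T}|lebesgue. ?G x * - k x) = (LINT s:{0..T}|lebesgue. g s * (green' T k T - green' T k s))"
    by (rule integral_by_parts_primitive[OF i(1) d(2) ck])
  also have "\<dots> = - (LINT s:{0..T}|lebesgue. g s * green' T k s)"
    using set_integral_diff(2)[OF gi(2,1)] GT by (simp add: right_diff_distrib)
  \<comment> \<open>\<open>g\<close> is exchanged for the primitive of \<open>h\<close> plus a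
    constant, which allows the second integration by parts.\<close>
  also have "(LINT s:{0..T}|lebesgue. g s * green' T k s) = (LINT s:{0..T}|lebesgue. (c + ?H s) * green' T k s)"
  proof (rule LINT_cong_AE)
    show "set_borel_measurable lebesgue {0..T} (\<lambda>s. g s * green' T k s)"
      using gi(1) unfolding set_integrable_def set_borel_measurable_def by auto
    show "AE x in lebesgue. x \<in> {0<..<T} \<longrightarrow> g x * green' T k x = (c + ?H x) * green' T k x"
      using c by eventually_elim auto
  qed
  also have "\<dots> = (LINT s:{0..T}|lebesgue. c * green' T k s) + (LINT s:{0..T}|lebesgue. ?H s * green' T k s)"
  proof -
    have "set_integrable lebesgue {0..T} (\<lambda>s. c * green' T k s)" "set_integrable lebesgue {0..T} (\<lambda>s. ?H s * green' T k s)"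
      by (intro integral_continuous_eq_LINT continuous_intros cg' cH)+
    from set_integral_add(2)[OF this] show ?thesis by (simp add: distrib_right)
  qed
  also have "(LINT s:{0..T}|lebesgue. c * green' T k s) = 0"
  proof -
    have "(green' T k has_integral green T k T - green T k 0) {0..T}"
      by (rule fundamental_theorem_of_calculus)
        (use T d(1) in \<open>auto simp: has_real_derivative_iff_has_vector_derivative\<close>)
    then show ?thesis using integral_continuous_eq_LINT(2)[OF cg'] b by (simp add: has_integral_iff)
  qed
  also have "(LINT s:{0..T}|lebesgue. ?H s * green' T k s) = (LINT s:{0..T}|lebesgue. h s * (green T k T - green T k s))"
    by (rule integral_by_parts_primitive[OF i(2) d(1) cg'])
  also have "\<dots> = - (LINT s:{0..T}|lebesgue. h s * green T k s)"
    using b by (simp add: set_lebesgue_integral_def)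
  finally show ?thesis by simp
qed

lemma W2D_representation:
  assumes p: "1 < p" and u: "u \<in> W2D T p"
  obtains g h where "has_weak_deriv T u g" "has_weak_deriv T g h" "set_integrable lebesgue {0..T} g"
    "h \<in> Lp_space T p" "set_integrable lebesgue {0..T} h" "W2D_norm T p u = Lp_norm T p h"
proof -
  obtain g h where gh: "has_weak_deriv T u g" "g \<in> Lp_space T p" "has_weak_deriv T g h" "h \<in> Lp_space T p"
    using u unfolding W2D_def W2_def by blast
  show thesis
    by (rule that[OF gh(1,3) Lp_space_integrable[OF p gh(2)] gh(4) Lp_space_integrable[OF p gh(4)]
          W2D_norm_eq[OF gh(1,3,4)]])
qed

text \<open>Integration by parts and Hoelder's inequality bound the \<open>q\<close>-th power of the
  norm of \<open>u\<close> by \<open>Lp_norm T p h * m\<close>. The iteration step started at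
  \<open>u\<close> itself bounds \<open>m\<close> through the continuous competitor
  \<open>w\<close>, so \<open>Smax\<close> also controls weak second derivatives.\<close>

lemma embedding_bound:
  assumes T: "0 < T" and p: "1 < p" and q: "1 < q" and u: "u \<in> W2D T p"
  shows "Lp_norm T q u \<le> Smax T p q * W2D_norm T p u"
proof (cases "Lp_norm T q u = 0")
  case True
  then show ?thesis using Smax_pos[OF T p q] by (simp add: W2D_norm_def Lp_norm_nonneg)
next
  case False
  then have N: "0 < Lp_norm T q u" using Lp_norm_nonneg[of T q u] by simp
  obtain g h where gh: "has_weak_deriv T u g" "has_weak_deriv T g h" "set_integrable lebesgue {0..T} g"
    "h \<in> Lp_space T p" "set_integrable lebesgue {0..T} h" "W2D_norm T p u = Lp_norm T p h"
    by (rule W2D_representation[OF p u])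
  have c: "continuous_on {0..T} u" "u 0 = 0" "u T = 0" using u by (auto simp: W2D_def)
  let ?k = "\<lambda>t. spow (q - 1) (u t)"
  have k: "continuous_on {0..T} ?k" using q c by (intro continuous_on_spow) auto
  define v where "v = green T ?k"
  have v: "continuous_on {0..T} v" unfolding v_def by (rule continuous_on_green[OF T k])
  define m where "m = Lp_norm T (p / (p - 1)) v"
  have "Lp_norm T q u powr q = integral {0..T} (\<lambda>x. u x * ?k x)"
    using Lp_norm_powr_continuous[OF c(1), of q] q by (simp add: spow_simps)
  also have "\<dots> = - (LINT x:{0..T}|lebesgue. h x * v x)"
    unfolding v_def by (rule W2D_integral_by_parts[OF T c gh(1,2,3,5) k])
  also have "\<dots> \<le> Lp_norm T p h * m"
    using Holder_Lp(2)[OF p gh(4) Lp_space_continuous[OF v]] conjugate_exponent(1)[OF p] by (simp add: m_def)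
  finally have le: "Lp_norm T q u powr q \<le> Lp_norm T p h * m" .
  moreover have "0 < Lp_norm T q u powr q" using N by simp
  ultimately have "0 < Lp_norm T p h * m" by linarith
  then have m: "0 < m" using Lp_norm_nonneg[of T p h] by (simp add: zero_less_mult_iff)
  define w where "w = (\<lambda>t. spow (1 / (p - 1)) (v t / m))"
  note step = power_iteration[OF T p q c(1), folded v_def, folded m_def, OF m, folded w_def]
  have "Lp_norm T q (green T w) \<le> Smax T p q"
    by (rule Smax_upper[OF T p q]) (use step in auto)
  then have "m \<le> Smax T p q * Lp_norm T q u powr (q - 1)"
    using step(4) mult_right_mono[of "Lp_norm T q (green T w)" "Smax T p q" "Lp_norm T q u powr (q - 1)"] by simp
  then have "Lp_norm T p h * m \<le> Lp_norm T p h * (Smax T p q * Lp_norm T q u powr (q - 1))"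
    using Lp_norm_nonneg by (rule mult_left_mono)
  moreover have "Lp_norm T q u powr q = Lp_norm T q u * Lp_norm T q u powr (q - 1)"
    using N by (simp add: powr_diff)
  ultimately have "Lp_norm T q u * Lp_norm T q u powr (q - 1) \<le> (Smax T p q * Lp_norm T p h) * Lp_norm T q u powr (q - 1)"
    using le by (simp add: mult_ac)
  then have "Lp_norm T q u \<le> Smax T p q * Lp_norm T p h" using N by simp
  then show ?thesis using gh(6) by simp
qed

text \<open>By the fundamental theorem of calculus a continuous classical derivative is a weak one;
  here the second is \<open>- h\<close>.\<close>

lemma green_in_W2D:
  assumes T: "0 < T" and p: "1 < p" and h: "continuous_on {0..T} h"
  shows "green T h \<in> W2D T p" "W2D_norm T p (green T h) = Lp_norm T p h"
proof -
  note d = green_has_derivative[OF T h] green'_has_derivative[OF T h]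
  note b = green_boundary[OF T h]
  note c = continuous_on_green[OF T h] continuous_on_green'[OF T h]
  have ch: "continuous_on {0..T} (\<lambda>t. - h t)" by (intro continuous_intros h)
  have w: "has_weak_deriv T f f'"
    if d: "\<And>t. t \<in> {0..T} \<Longrightarrow> (f has_real_derivative f' t) (at t within {0..T})" and c: "continuous_on {0..T} f'" for f f'
  proof -
    note i = integral_continuous_eq_LINT(1)[OF c]
    have "f 0 + (LINT s:{0..x}|lebesgue. f' s) = f x" if x: "x \<in> {0..T}" for x
    proof -
      have sub: "{0..x} \<subseteq> {0..T}" using x by auto
      have "(LINT s:{0..x}|lebesgue. f' s) = integral {0..x} f'"
        by (rule integral_continuous_eq_LINT(2)[OF continuous_on_subset[OF c sub]])
      moreover have "(f' has_integral f x - f 0) {0..x}"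
        by (rule fundamental_theorem_of_calculus)
          (use x DERIV_subset[OF d sub] in \<open>auto simp: has_real_derivative_iff_has_vector_derivative\<close>)
      ultimately show ?thesis by (simp add: has_integral_iff)
    qed
    then show ?thesis
      by (intro has_weak_deriv_cong_AE[OF has_weak_deriv_primitive[OF T i, of "f 0"]] AE_I2) auto
  qed
  have L: "green T h \<in> Lp_space T p" "green' T h \<in> Lp_space T p" "(\<lambda>t. - h t) \<in> Lp_space T p"
    using p c ch by (auto intro!: Lp_space_continuous)
  show "green T h \<in> W2D T p"
    unfolding W2D_def W2_def using L w[OF d(1) c(2)] w[OF d(2) ch] c b by blast
  show "W2D_norm T p (green T h) = Lp_norm T p h"
    using W2D_norm_eq[OF w[OF d(1) c(2)] w[OF d(2) ch] L(3)] by (simp add: Lp_norm_def)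
qed

theorem theorem7p1:
  fixes t0 p q :: real
  assumes "0 < t0" and "1 < p" and "1 < q"
  shows "E2 ` W2D t0 p \<subseteq> Lp_space t0 q \<and>
    op_norm (W2D t0 p) (W2D_norm t0 p) (Lp_norm t0 q) E2 =
      (SUP u\<in>{u \<in> W2D t0 p. \<exists>t\<in>{0..t0}. u t \<noteq> 0}. ereal (Lp_norm t0 q u / W2D_norm t0 p u)) \<and>
    (SUP u\<in>{u \<in> W2D t0 p. \<exists>t\<in>{0..t0}. u t \<noteq> 0}. ereal (Lp_norm t0 q u / W2D_norm t0 p u)) =
      ereal (Lp_norm t0 q (SN1 p q t0)) \<and>
    Lp_norm t0 q (SN1 p q t0) = sn1 p q t0 powr (- 1 / q) \<and>
    sn1 p q t0 powr (- 1 / q) = t0 powr (1 / q - 1 / p + 2) * lambda1 p q powr (- 1 / q)"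
proof -
  define S where "S = Smax t0 p q"
  have S: "0 < S" unfolding S_def by (rule Smax_pos[OF assms])
  obtain h where h: "continuous_on {0..t0} h" "Lp_norm t0 p h = 1" "Lp_norm t0 q (green t0 h) = S"
    "\<And>t. t \<in> {0..t0} \<Longrightarrow> SN1 p q t0 t = green t0 h t" "sn1 p q t0 = S powr (- q)"
    unfolding S_def by (rule first_spectral_couple_eq[OF assms]) blast
  note u = green_in_W2D[OF assms(1,2) h(1), unfolded h(2)]
  have SN: "Lp_norm t0 q (SN1 p q t0) = S"
    using Lp_norm_cong[of t0 "SN1 p q t0" "green t0 h" q] h(3,4) by simp
  \<comment> \<open>The supremum runs over functions that are not identically 0, so the maximizer
    must qualify.\<close>
  have nz: "\<exists>t\<in>{0..t0}. green t0 h t \<noteq> 0"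
  proof (rule ccontr)
    assume "\<not> ?thesis"
    then have "Lp_norm t0 q (green t0 h) = Lp_norm t0 q (\<lambda>_. 0)" by (intro Lp_norm_cong) auto
    then show False using h(3) S by (simp add: Lp_norm_def)
  qed
  have bound: "Lp_norm t0 q v \<le> S * W2D_norm t0 p v" if "v \<in> W2D t0 p" for v
    unfolding S_def by (rule embedding_bound[OF assms that])
  have sub: "E2 ` W2D t0 p \<subseteq> Lp_space t0 q"
    using assms by (auto simp: E2_def W2D_def intro: Lp_space_continuous)
  have sup: "(SUP u\<in>{u \<in> W2D t0 p. \<exists>t\<in>{0..t0}. u t \<noteq> 0}. ereal (Lp_norm t0 q u / W2D_norm t0 p u)) = ereal S"
  proof (rule antisym)
    show "(SUP u\<in>{u \<in> W2D t0 p. \<exists>t\<in>{0..t0}. u t \<noteq> 0}. ereal (Lp_norm t0 q u / W2D_norm t0 p u)) \<le> ereal S"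
    proof (rule SUP_least)
      fix v assume "v \<in> {u \<in> W2D t0 p. \<exists>t\<in>{0..t0}. u t \<noteq> 0}"
      then have "Lp_norm t0 q v \<le> S * W2D_norm t0 p v" using bound by simp
      moreover have "0 \<le> W2D_norm t0 p v" by (simp add: W2D_norm_def Lp_norm_nonneg)
      \<comment> \<open>A zero denominator makes the quotient 0 by convention, which is still at
        most \<open>S\<close>.\<close>
      ultimately have "Lp_norm t0 q v / W2D_norm t0 p v \<le> S"
        using S by (cases "W2D_norm t0 p v = 0") (auto simp: pos_divide_le_eq)
      then show "ereal (Lp_norm t0 q v / W2D_norm t0 p v) \<le> ereal S" by simp
    qed
    have "ereal S = ereal (Lp_norm t0 q (green t0 h) / W2D_norm t0 p (green t0 h))" using h(3) u(2) by simp
    also have "\<dots> \<le> (SUP u\<in>{u \<in> W2D t0 p. \<exists>t\<in>{0..t0}. u t \<noteq> 0}. ereal (Lp_norm t0 q u / W2D_norm t0 p u))"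
      by (rule SUP_upper) (use u(1) nz in auto)
    finally show "ereal S \<le> (SUP u\<in>{u \<in> W2D t0 p. \<exists>t\<in>{0..t0}. u t \<noteq> 0}. ereal (Lp_norm t0 q u / W2D_norm t0 p u))" .
  qed
  have op: "op_norm (W2D t0 p) (W2D_norm t0 p) (Lp_norm t0 q) E2 = ereal S"
    unfolding op_norm_def
  proof (rule antisym)
    \<comment> \<open>\<open>S\<close> is itself an admissible bound; testing any other bound on the
      maximizer \<open>green t0 h\<close> gives the converse.\<close>
    show "(INF C\<in>{C. 0 \<le> C \<and> (\<forall>x\<in>W2D t0 p. Lp_norm t0 q (E2 x) \<le> C * W2D_norm t0 p x)}. ereal C) \<le> ereal S"
      by (rule INF_lower) (use S bound in \<open>auto simp: E2_def\<close>)
    show "ereal S \<le> (INF C\<in>{C. 0 \<le> C \<and> (\<forall>x\<in>W2D t0 p. Lp_norm t0 q (E2 x) \<le> C * W2D_norm t0 p x)}. ereal C)"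
    proof (rule INF_greatest)
      fix C assume "C \<in> {C. 0 \<le> C \<and> (\<forall>x\<in>W2D t0 p. Lp_norm t0 q (E2 x) \<le> C * W2D_norm t0 p x)}"
      then have "Lp_norm t0 q (green t0 h) \<le> C * W2D_norm t0 p (green t0 h)"
        using u(1) by (auto simp: E2_def)
      then show "ereal S \<le> ereal C" using h(3) u(2) by simp
    qed
  qed
  have sn: "sn1 p q t0 powr (- 1 / q) = S" using S assms(3) by (simp add: h(5) powr_powr)
  have "(q / p - 1 - 2 * q) * (- 1 / q) = 1 / q - 1 / p + 2" using assms by (simp add: field_simps)
  then have scale: "sn1 p q t0 powr (- 1 / q) = t0 powr (1 / q - 1 / p + 2) * lambda1 p q powr (- 1 / q)"
    unfolding sn1_scale[OF assms] by (simp only: powr_mult powr_powr)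
  show ?thesis using sub sup op SN sn scale by simp
qed

end
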